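(* Let $E$ be a field and let $v$ be a $\mathbb Z$-valuation on $E$, with residue field $\kappa_v$. Then $E$ is quasi-finite if and only if $v$ is henselian, $\kappa_v$ is algebraically closed and $\operatorname{char}(\kappa_v)=0$.
   Context: A $\mathbb Z$-valuation is a valuation with value group $\mathbb Z$. A field is quasi-finite if it has a finite field extension of every degree and all its finite field extensions are cyclic (i.e. Galois with cyclic Galois group); equivalently, it is perfect and its absolute Galois group is isomorphic to $\hat{\mathbb Z}$. A valuation on $E$ is henselian if it extends uniquely to every finite field extension of $E$. *)

theory Defs
  imports "HOL-Algebra.Algebra"
begin

section \<open>Field extensions\<close>

text \<open>
  An extension of \<open>E\<close> is a field \<open>L\<close> with an embedding \<open>h\<close> of \<open>E\<close> into \<open>L\<close>; its base field,
  as a subfield of \<open>L\<close>, is \<open>h ` carrier E\<close>.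
\<close>

definition field_extension ::
  "('a, 'm) ring_scheme \<Rightarrow> ('c, 'n) ring_scheme \<Rightarrow> ('a \<Rightarrow> 'c) \<Rightarrow> bool"
  where "field_extension E L h \<longleftrightarrow> field E \<and> field L \<and> h \<in> ring_hom E L"

definition extension_of_degree ::
  "nat \<Rightarrow> ('a, 'm) ring_scheme \<Rightarrow> ('c, 'n) ring_scheme \<Rightarrow> ('a \<Rightarrow> 'c) \<Rightarrow> bool"
  where "extension_of_degree n E L h \<longleftrightarrow>
    field_extension E L h \<and> ring.dimension L n (h ` carrier E) (carrier L)"

definition finite_extension ::
  "('a, 'm) ring_scheme \<Rightarrow> ('c, 'n) ring_scheme \<Rightarrow> ('a \<Rightarrow> 'c) \<Rightarrow> bool"
  where "finite_extension E L h \<longleftrightarrow>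
    field_extension E L h \<and> ring.finite_dimension L (h ` carrier E) (carrier L)"

definition Gal :: "('c, 'n) ring_scheme \<Rightarrow> 'c set \<Rightarrow> ('c \<Rightarrow> 'c) monoid"
  where "Gal L K = BijGroup (carrier L)
    \<lparr>carrier := {\<sigma> \<in> ring_hom L L \<inter> Bij (carrier L). \<forall>x\<in>K. \<sigma> x = x}\<rparr>"

text \<open>Galois in the sense of Artin: the base field is the fixed field of the Galois group.\<close>

definition galois_extension ::
  "('a, 'm) ring_scheme \<Rightarrow> ('c, 'n) ring_scheme \<Rightarrow> ('a \<Rightarrow> 'c) \<Rightarrow> bool"
  where "galois_extension E L h \<longleftrightarrow>
    {x \<in> carrier L. \<forall>\<sigma>\<in>carrier (Gal L (h ` carrier E)). \<sigma> x = x} = h ` carrier E"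

definition cyclic_extension ::
  "('a, 'm) ring_scheme \<Rightarrow> ('c, 'n) ring_scheme \<Rightarrow> ('a \<Rightarrow> 'c) \<Rightarrow> bool"
  where "cyclic_extension E L h \<longleftrightarrow>
    galois_extension E L h \<and> cyclic_group (Gal L (h ` carrier E))"

text \<open>
  HOL cannot quantify over all types inside a definition, so the extensions below have their
  carriers in the type \<^typ>\<open>'a list\<close>. This is no restriction: by
  \<open>finite_extension_universe\<close> below, every finite extension of \<open>E\<close>, of whatever type, is
  isomorphic over \<open>E\<close> to one of these.
\<close>

definition quasi_finite :: "('a, 'm) ring_scheme \<Rightarrow> bool"
  where "quasi_finite E \<longleftrightarrow>
    field E \<and>
    (\<forall>n>0. \<exists>(L :: 'a list ring) h. extension_of_degree n E L h) \<and>
    (\<forall>(L :: 'a list ring) h. finite_extension E L h \<longrightarrow> cyclic_extension E L h)"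


section \<open>Valuations\<close>

text \<open>
  The value \<open>\<infinity>\<close> of zero is left implicit: only the values of nonzero elements matter.
\<close>

locale valuation = field K for K (structure) +
  fixes v :: "'a \<Rightarrow> 'g::linordered_ab_group_add"
  assumes val_mult: "\<lbrakk> x \<in> carrier K - {\<zero>}; y \<in> carrier K - {\<zero>} \<rbrakk> \<Longrightarrow> v (x \<otimes> y) = v x + v y"
    and val_add: "\<lbrakk> x \<in> carrier K - {\<zero>}; y \<in> carrier K - {\<zero>}; x \<oplus> y \<noteq> \<zero> \<rbrakk>
      \<Longrightarrow> min (v x) (v y) \<le> v (x \<oplus> y)"

locale Z_valuation = valuation K v for K (structure) and v :: "'a \<Rightarrow> int" +
  assumes value_group: "v ` (carrier K - {\<zero>}) = UNIV"

definition valuation_ring :: "('a, 'm) ring_scheme \<Rightarrow> ('a \<Rightarrow> 'g::linordered_ab_group_add) \<Rightarrow> 'a set"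
  where "valuation_ring K v = {x \<in> carrier K. x = \<zero>\<^bsub>K\<^esub> \<or> 0 \<le> v x}"

definition valuation_ideal :: "('a, 'm) ring_scheme \<Rightarrow> ('a \<Rightarrow> 'g::linordered_ab_group_add) \<Rightarrow> 'a set"
  where "valuation_ideal K v = {x \<in> carrier K. x = \<zero>\<^bsub>K\<^esub> \<or> 0 < v x}"

definition residue_field ::
  "('a, 'm) ring_scheme \<Rightarrow> ('a \<Rightarrow> 'g::linordered_ab_group_add) \<Rightarrow> 'a set ring"
  where "residue_field K v = (K\<lparr>carrier := valuation_ring K v\<rparr>) Quot (valuation_ideal K v)"

text \<open>
  An extension to \<open>L\<close> of a \<open>\<int>\<close>-valuation on \<open>E\<close> has, for \<open>L\<close> finite over \<open>E\<close>, its value group in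
  the divisible hull \<open>\<rat>\<close> of \<open>\<int>\<close>. By \<open>rational_extension_unique\<close> below, the \<open>\<rat>\<close>-valued
  extensions that literally restrict to \<open>v\<close> represent each equivalence class of extensions (with
  values in arbitrary ordered abelian groups) exactly once.
\<close>

definition extends_valuation ::
  "('a, 'm) ring_scheme \<Rightarrow> ('a \<Rightarrow> int) \<Rightarrow> ('c, 'n) ring_scheme \<Rightarrow> ('a \<Rightarrow> 'c) \<Rightarrow> ('c \<Rightarrow> rat) \<Rightarrow> bool"
  where "extends_valuation E v L h w \<longleftrightarrow>
    valuation L w \<and> (\<forall>a\<in>carrier E - {\<zero>\<^bsub>E\<^esub>}. w (h a) = of_int (v a))"

definition henselian :: "('a, 'm) ring_scheme \<Rightarrow> ('a \<Rightarrow> int) \<Rightarrow> bool"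
  where "henselian E v \<longleftrightarrow>
    valuation E v \<and>
    (\<forall>(L :: 'a list ring) h. finite_extension E L h \<longrightarrow>
      (\<exists>w. extends_valuation E v L h w \<and>
        (\<forall>w'. extends_valuation E v L h w' \<longrightarrow> (\<forall>x\<in>carrier L - {\<zero>\<^bsub>L\<^esub>}. w' x = w x))))"

text \<open>Like \<open>CHAR\<close> for type classes: the nonnegative generator of the ideal of annihilating integers.\<close>

definition characteristic :: "('a, 'm) ring_scheme \<Rightarrow> nat"
  where "characteristic R = Gcd {n :: nat. [n] \<cdot>\<^bsub>R\<^esub> \<one>\<^bsub>R\<^esub> = \<zero>\<^bsub>R\<^esub>}"


section \<open>Adequacy of the encodings\<close>

lemma field_extension_base:
  assumes "field_extension E L h"
  shows "ring_hom_ring E L h" "inj_on h (carrier E)" "subfield (h ` carrier E) L"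
proof -
  interpret E: field E using assms by (simp add: field_extension_def)
  interpret L: field L using assms by (simp add: field_extension_def)
  show hom: "ring_hom_ring E L h"
    using assms ring_hom_ringI2[OF E.is_ring L.is_ring] by (simp add: field_extension_def)
  interpret ring_hom_ring E L h by (rule hom)
  show "inj_on h (carrier E)" "subfield (h ` carrier E) L"
    using img_is_subfield[OF E.carrier_is_subfield] L.one_not_zero by auto
qed

theorem finite_extension_universe:
  fixes E :: "('a, 'm) ring_scheme" and M :: "('c, 'n) ring_scheme"
  assumes "extension_of_degree n E M g"
  obtains L :: "'a list ring" and \<phi>
  where "\<phi> \<in> ring_iso M L" "extension_of_degree n E L (\<phi> \<circ> g)"
proof -
  have ext: "field_extension E M g" and dimM: "ring.dimension M n (g ` carrier E) (carrier M)"
    using assms by (auto simp: extension_of_degree_def)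
  interpret M: field M using ext by (simp add: field_extension_def)
  note base = field_extension_base[OF ext]
  let ?K = "g ` carrier E"
  obtain Us where Us: "set Us \<subseteq> carrier M" "M.Span ?K Us = carrier M"
    using M.exists_base[OF base(3) dimM] by blast
  have "\<exists>Ks. set Ks \<subseteq> ?K \<and> x = M.combine Ks Us" if "x \<in> carrier M" for x
    using that M.Span_eq_combine_set[OF base(3) Us(1)] unfolding Us(2) by auto
  then obtain c where c: "\<And>x. x \<in> carrier M \<Longrightarrow> set (c x) \<subseteq> ?K \<and> x = M.combine (c x) Us"
    by metis
  define \<phi> where "\<phi> x = map (inv_into (carrier E) g) (c x)" for x
  have c_eq: "map g (\<phi> x) = c x" if "x \<in> carrier M" for x
    using c[OF that] by (auto simp: \<phi>_def f_inv_into_f intro!: map_idI)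
  have inj: "inj_on \<phi> (carrier M)"
    by (rule inj_onI) (metis c c_eq)
  let ?L = "image_ring \<phi> M"
  have L: "field ?L" and iso: "\<phi> \<in> ring_iso M ?L"
    using M.inj_imp_image_ring_is_field[OF inj] inj_imp_image_ring_iso[OF inj] by auto
  have hom: "\<phi> \<in> ring_hom M ?L" using iso by (simp add: ring_iso_def)
  interpret L: field ?L by (rule L)
  interpret \<phi>: ring_hom_ring M ?L \<phi>
    using ring_hom_ringI2[OF M.is_ring L.is_ring hom] .
  have "field_extension E ?L (\<phi> \<circ> g)"
    using ext L ring_hom_trans[OF _ hom] by (auto simp: field_extension_def)
  moreover have "L.dimension n ((\<phi> \<circ> g) ` carrier E) (carrier ?L)"
    using \<phi>.inj_hom_dimension[OF base(3) L.one_not_zero inj dimM]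
    by (simp add: image_comp image_ring_carrier)
  ultimately show ?thesis
    using that[OF iso] by (simp add: extension_of_degree_def)
qed

lemma (in valuation) val_one: "v \<one> = 0"
  using val_mult[of \<one> \<one>] by simp

lemma (in valuation) val_pow:
  assumes "x \<in> carrier K - {\<zero>}"
  shows "x [^] (n :: nat) \<in> carrier K - {\<zero>}" "v (x [^] Suc n) = v (x [^] n) + v x"
proof -
  show *: "x [^] n \<in> carrier K - {\<zero>}" for n :: nat
    using assms by (induction n) (auto simp: integral_iff)
  show "v (x [^] Suc n) = v (x [^] n) + v x"
    using val_mult[OF * assms] by simp
qed

lemma (in valuation) val_pow_mono:
  assumes x: "x \<in> carrier K - {\<zero>}" and y: "y \<in> carrier K - {\<zero>}" and "n > (0 :: nat)"
  shows "v (x [^] n) \<le> v (y [^] n) \<longleftrightarrow> v x \<le> v y"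
proof -
  have le: "v (a [^] n) \<le> v (b [^] n)"
    if "a \<in> carrier K - {\<zero>}" "b \<in> carrier K - {\<zero>}" "v a \<le> v b" for a b and n :: nat
  proof (induction n)
    case (Suc n)
    then show ?case
      unfolding val_pow(2)[OF that(1)] val_pow(2)[OF that(2)] using that(3) by (rule add_mono)
  qed simp
  have less: "v (b [^] Suc n) < v (a [^] Suc n)"
    if "a \<in> carrier K - {\<zero>}" "b \<in> carrier K - {\<zero>}" "v b < v a" for a b and n :: nat
    unfolding val_pow(2)[OF that(1)] val_pow(2)[OF that(2)]
    using that le[of b a n] by (intro add_le_less_mono) auto
  obtain m where "n = Suc m" using \<open>n > 0\<close> by (cases n) auto
  then show ?thesis
    using le[OF x y] less[OF x y] by (metis leD leI)
qed

lemma (in valuation) val_uminus: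
  assumes "x \<in> carrier K - {\<zero>}" shows "\<ominus> x \<in> carrier K - {\<zero>}" "v (\<ominus> x) = v x"
proof -
  show *: "\<ominus> x \<in> carrier K - {\<zero>}" using assms minus_minus[of x] by auto
  have "(\<ominus> x) [^] (2 :: nat) = x [^] (2 :: nat)"
    using assms by (auto simp: numeral_2_eq_2 l_minus r_minus)
  then show "v (\<ominus> x) = v x"
    using val_pow_mono[OF * assms, of 2] val_pow_mono[OF assms *, of 2] by auto
qed

lemma (in valuation) val_add_neq:
  assumes x: "x \<in> carrier K - {\<zero>}" and y: "y \<in> carrier K - {\<zero>}" and "v x \<noteq> v y"
  shows "x \<oplus> y \<noteq> \<zero>" "v (x \<oplus> y) = min (v x) (v y)"
proof -
  have *: "a \<oplus> b \<noteq> \<zero> \<and> v (a \<oplus> b) = v a"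
    if a: "a \<in> carrier K - {\<zero>}" and b: "b \<in> carrier K - {\<zero>}" and less: "v a < v b" for a b
  proof -
    have nz: "a \<oplus> b \<noteq> \<zero>"
    proof
      assume "a \<oplus> b = \<zero>"
      then have "a = \<ominus> b" using a b minus_equality by auto
      then show False using val_uminus(2)[OF b] less by simp
    qed
    have "(a \<oplus> b) \<oplus> \<ominus> b = a" using a b by (simp add: a_assoc r_neg)
    then have "min (v (a \<oplus> b)) (v b) \<le> v a"
      using val_add[of "a \<oplus> b" "\<ominus> b"] val_uminus[OF b] a b nz by auto
    moreover have "min (v a) (v b) \<le> v (a \<oplus> b)" using val_add[OF a b nz] .
    ultimately show ?thesis using nz less by (auto simp: min_def split: if_splits)
  qed
  show "x \<oplus> y \<noteq> \<zero>" "v (x \<oplus> y) = min (v x) (v y)"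
    using *[OF x y] *[OF y x] assms a_comm[of x y] by (auto simp: min_def neq_iff)
qed

lemma (in valuation) torsion_over_subfield:
  assumes F: "subfield F K" and fin: "finite_dimension F (carrier K)"
    and x: "x \<in> carrier K - {\<zero>}"
  obtains n :: nat and k where "n > 0" "k \<in> F - {\<zero>}" "v (x [^] n) = v k"
proof (rule ccontr)
  assume "\<not> thesis"
  with that have H: "v (x [^] n) \<noteq> v k" if "n > 0" "k \<in> F - {\<zero>}" for n :: nat and k
    using that by blast
  have Fsub: "F \<subseteq> carrier K" using subfieldE(3)[OF F] .
  have claim: "(eval p x = \<zero> \<longrightarrow> set p \<subseteq> {\<zero>}) \<and>
      (eval p x \<noteq> \<zero> \<longrightarrow> (\<exists>i<length p. \<exists>k\<in>F - {\<zero>}. v (eval p x) = v k + v (x [^] i)))"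
    if "set p \<subseteq> F" for p
    using that
  proof (induction p)
    case (Cons a p)
    then have a: "a \<in> F" "a \<in> carrier K" and p: "set p \<subseteq> F" "set p \<subseteq> carrier K"
      using Fsub by auto
    have ep: "eval p x \<in> carrier K" using eval_in_carrier[OF p(2)] x by simp
    have xp: "x [^] length p \<in> carrier K - {\<zero>}" using val_pow(1)[OF x] .
    have ev: "eval (a # p) x = a \<otimes> x [^] length p \<oplus> eval p x" by simp
    show ?case
    proof (cases "a = \<zero>")
      case True
      then have "eval (a # p) x = eval p x" unfolding ev using ep xp by simp
      then show ?thesis using Cons.IH[OF p(1)] True by (auto simp del: eval.simps intro: less_SucI)
    next
      case False
      then have t: "a \<otimes> x [^] length p \<in> carrier K - {\<zero>}"
        and vt: "v (a \<otimes> x [^] length p) = v a + v (x [^] length p)"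
        using a xp val_mult[of a] integral[of a "x [^] length p"] by auto
      show ?thesis
      proof (cases "eval p x = \<zero>")
        case True
        then have "eval (a # p) x = a \<otimes> x [^] length p" unfolding ev using t by simp
        then show ?thesis using t vt a False by (auto simp del: eval.simps)
      next
        case nz: False
        then obtain i k where i: "i < length p" and k: "k \<in> F - {\<zero>}"
          and e: "v (eval p x) = v k + v (x [^] i)"
          using Cons.IH[OF p(1)] by blast
        have neq: "v (a \<otimes> x [^] length p) \<noteq> v (eval p x)"
        proof
          assume eq: "v (a \<otimes> x [^] length p) = v (eval p x)"
          define d where "d = length p - i"
          have kc: "k \<in> carrier K - {\<zero>}" using k Fsub by auto
          have ac: "a \<in> carrier K - {\<zero>}" using a False by auto
          have ik: "inv a \<in> F - {\<zero>}" "inv a \<in> carrier K - {\<zero>}" "a \<otimes> inv a = \<one>"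
            using subfield_m_inv[OF F, of a] a False Fsub by auto
          have "x [^] length p = x [^] d \<otimes> x [^] i"
            using x i by (simp add: d_def nat_pow_mult)
          then have "v (x [^] length p) = v (x [^] d) + v (x [^] i)"
            using val_mult[OF val_pow(1)[OF x] val_pow(1)[OF x], of d i] by simp
          with eq e vt have "v a + v (x [^] d) = v k" by (simp add: algebra_simps)
          moreover have "v a + v (inv a) = 0"
            using val_mult[OF ac ik(2)] ik(3) val_one by simp
          moreover have "v (k \<otimes> inv a) = v k + v (inv a)" using val_mult[OF kc ik(2)] .
          ultimately have "v (x [^] d) = v (k \<otimes> inv a)"
            by (metis add.commute add.left_commute add.right_neutral)
          moreover have "k \<otimes> inv a \<in> F - {\<zero>}"
            using k ik kc integral[of k "inv a"] subringE(6)[OF subfieldE(1)[OF F]] by auto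
          ultimately show False using H[of d "k \<otimes> inv a"] i by (simp add: d_def)
        qed
        have "eval (a # p) x \<noteq> \<zero>"
          "v (eval (a # p) x) = min (v a + v (x [^] length p)) (v k + v (x [^] i))"
          unfolding ev using val_add_neq[OF t _ neq] nz ep e vt by auto
        then show ?thesis
          using i k a False by (auto simp del: eval.simps simp: min_def intro: less_SucI)
      qed
    qed
  qed auto
  have "(algebraic over F) x"
    using finite_dimension_imp_algebraic[OF F carrier_is_subring fin] x by auto
  then obtain p where p: "p \<in> carrier (F[X])" "p \<noteq> []" "eval p x = \<zero>"
    using algebraicE[OF subfieldE(1)[OF F]] x by auto
  then have "set p \<subseteq> F" "lead_coeff p \<noteq> \<zero>"
    by (auto simp: univ_poly_carrier[symmetric] polynomial_def)
  then show False
    using claim p by (metis hd_in_set subsetD singletonD)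
qed

text \<open>
  The hypothesis on \<open>w\<close> says that \<open>w\<close> extends \<open>v\<close> up to equivalence.
\<close>

theorem rational_extension_unique:
  fixes E :: "('a, 'm) ring_scheme" and L :: "('c, 'n) ring_scheme"
    and v :: "'a \<Rightarrow> int" and w :: "'c \<Rightarrow> 'g::linordered_ab_group_add"
  assumes v: "Z_valuation E v" and fin: "finite_extension E L h" and w: "valuation L w"
    and ext: "\<And>a b. \<lbrakk> a \<in> carrier E - {\<zero>\<^bsub>E\<^esub>}; b \<in> carrier E - {\<zero>\<^bsub>E\<^esub>} \<rbrakk>
      \<Longrightarrow> w (h a) \<le> w (h b) \<longleftrightarrow> v a \<le> v b"
  obtains u where "extends_valuation E v L h u"
    "\<And>x y. \<lbrakk> x \<in> carrier L - {\<zero>\<^bsub>L\<^esub>}; y \<in> carrier L - {\<zero>\<^bsub>L\<^esub>} \<rbrakk> \<Longrightarrow> u x \<le> u y \<longleftrightarrow> w x \<le> w y"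
    "\<And>u' x. \<lbrakk> extends_valuation E v L h u';
       \<And>x y. \<lbrakk> x \<in> carrier L - {\<zero>\<^bsub>L\<^esub>}; y \<in> carrier L - {\<zero>\<^bsub>L\<^esub>} \<rbrakk> \<Longrightarrow> u' x \<le> u' y \<longleftrightarrow> w x \<le> w y;
       x \<in> carrier L - {\<zero>\<^bsub>L\<^esub>} \<rbrakk> \<Longrightarrow> u' x = u x"
proof -
  have fe: "field_extension E L h"
    and fd: "ring.finite_dimension L (h ` carrier E) (carrier L)"
    using fin by (auto simp: finite_extension_def)
  note base = field_extension_base[OF fe]
  interpret E: Z_valuation E v by (rule v)
  interpret L: valuation L w by (rule w)
  interpret h: ring_hom_ring E L h by (rule base(1))
  let ?E = "carrier E - {\<zero>\<^bsub>E\<^esub>}" and ?L = "carrier L - {\<zero>\<^bsub>L\<^esub>}"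
  have hnz: "h a \<in> ?L" if "a \<in> ?E" for a
    using that inj_onD[OF base(2), of a "\<zero>\<^bsub>E\<^esub>"] by auto
  have hpow: "h (a [^]\<^bsub>E\<^esub> n) = h a [^]\<^bsub>L\<^esub> n" if "a \<in> ?E" for a and n :: nat
    using that h.hom_nat_pow by auto
  have epow: "v (a [^]\<^bsub>E\<^esub> n) = int n * v a" if "a \<in> ?E" for a and n :: nat
  proof (induction n)
    case 0
    then show ?case using E.val_one by simp
  next
    case (Suc n)
    then show ?case using E.val_pow(2)[OF that, of n] by (simp add: algebra_simps)
  qed
  have eqv: "w (h a) = w (h b) \<longleftrightarrow> v a = v b" if "a \<in> ?E" "b \<in> ?E" for a b
    using ext[OF that] ext[OF that(2,1)] by auto
  have tors: "\<exists>n a. n > 0 \<and> a \<in> ?E \<and> w (x [^]\<^bsub>L\<^esub> (n :: nat)) = w (h a)" if "x \<in> ?L" for x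
  proof -
    obtain n :: nat and k where n: "n > 0" "k \<in> h ` carrier E - {\<zero>\<^bsub>L\<^esub>}" "w (x [^]\<^bsub>L\<^esub> n) = w k"
      by (rule L.torsion_over_subfield[OF base(3) fd \<open>x \<in> ?L\<close>])
    then obtain a where "a \<in> carrier E" "k = h a" by auto
    moreover from this n(2) have "a \<noteq> \<zero>\<^bsub>E\<^esub>" by auto
    ultimately show ?thesis using n by blast
  qed
  have tors_pow: "w (x [^]\<^bsub>L\<^esub> (n * m)) = w (h (a [^]\<^bsub>E\<^esub> m))"
    if x: "x \<in> ?L" and a: "a \<in> ?E" and e: "w (x [^]\<^bsub>L\<^esub> n) = w (h a)" for x a and n m :: nat
  proof -
    have "w ((x [^]\<^bsub>L\<^esub> n) [^]\<^bsub>L\<^esub> m) = w (h a [^]\<^bsub>L\<^esub> m)"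
    proof (cases "m = 0")
      case False
      then show ?thesis
        using L.val_pow_mono[OF L.val_pow(1)[OF x] hnz[OF a], of m n]
          L.val_pow_mono[OF hnz[OF a] L.val_pow(1)[OF x], of m n] e by auto
    qed simp
    then show ?thesis using x hpow[OF a] by (simp add: L.nat_pow_pow)
  qed
  have le: "w x \<le> w y \<longleftrightarrow> int m * v a \<le> int n * v b"
    if x: "x \<in> ?L" "n > 0" "a \<in> ?E" "w (x [^]\<^bsub>L\<^esub> n) = w (h a)"
      and y: "y \<in> ?L" "m > 0" "b \<in> ?E" "w (y [^]\<^bsub>L\<^esub> m) = w (h b)" for x y a b and n m :: nat
  proof -
    have "w x \<le> w y \<longleftrightarrow> w (x [^]\<^bsub>L\<^esub> (n * m)) \<le> w (y [^]\<^bsub>L\<^esub> (m * n))"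
      using L.val_pow_mono[OF x(1) y(1), of "n * m"] x(2) y(2) by (simp add: mult.commute)
    also have "\<dots> \<longleftrightarrow> v (a [^]\<^bsub>E\<^esub> m) \<le> v (b [^]\<^bsub>E\<^esub> n)"
      using tors_pow[OF x(1,3,4), of m] tors_pow[OF y(1,3,4), of n]
        ext[OF E.val_pow(1)[OF x(3)] E.val_pow(1)[OF y(3)]] by simp
    finally show ?thesis using epow x y by simp
  qed
  obtain N A where NA: "\<And>x. x \<in> ?L \<Longrightarrow>
      N x > (0 :: nat) \<and> A x \<in> ?E \<and> w (x [^]\<^bsub>L\<^esub> N x) = w (h (A x))"
    using tors by metis
  define u :: "'c \<Rightarrow> rat" where "u x = of_int (v (A x)) / of_nat (N x)" for x
  have u_eq: "u x = of_int (v a) / of_nat n"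
    if "x \<in> ?L" "n > 0" "a \<in> ?E" "w (x [^]\<^bsub>L\<^esub> n) = w (h a)" for x a and n :: nat
  proof -
    have "int n * v (A x) = int (N x) * v a"
      using le[OF that, of x "N x" "A x"] le[of x "N x" "A x" x n a] that NA[OF that(1)] by auto
    then have "rat_of_int (int n * v (A x)) = rat_of_int (int (N x) * v a)" by simp
    then show ?thesis using that NA[OF that(1)] by (simp add: u_def field_simps)
  qed
  have u_le: "u x \<le> u y \<longleftrightarrow> w x \<le> w y" if "x \<in> ?L" "y \<in> ?L" for x y
  proof -
    have "u x \<le> u y \<longleftrightarrow> rat_of_int (int (N y) * v (A x)) \<le> rat_of_int (int (N x) * v (A y))"
      using NA that by (simp add: u_def field_simps)
    then show ?thesis
      using le[of x "N x" "A x" y "N y" "A y"] NA that by (simp only: of_int_le_iff)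
  qed
  have u_mult: "u (x \<otimes>\<^bsub>L\<^esub> y) = u x + u y" if x: "x \<in> ?L" and y: "y \<in> ?L" for x y
  proof -
    let ?n = "N x" and ?m = "N y" and ?a = "A x" and ?b = "A y"
    note X = NA[OF x] and Y = NA[OF y]
    let ?c = "?a [^]\<^bsub>E\<^esub> ?m \<otimes>\<^bsub>E\<^esub> ?b [^]\<^bsub>E\<^esub> ?n"
    have am: "?a [^]\<^bsub>E\<^esub> ?m \<in> ?E" and bn: "?b [^]\<^bsub>E\<^esub> ?n \<in> ?E"
      using E.val_pow(1) X Y by blast+
    have c: "?c \<in> ?E" using am bn E.integral by auto
    have xy: "x \<otimes>\<^bsub>L\<^esub> y \<in> ?L" using x y L.integral by auto
    have "(x \<otimes>\<^bsub>L\<^esub> y) [^]\<^bsub>L\<^esub> (?n * ?m) = x [^]\<^bsub>L\<^esub> (?n * ?m) \<otimes>\<^bsub>L\<^esub> y [^]\<^bsub>L\<^esub> (?m * ?n)"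
      using x y by (simp add: L.nat_pow_distrib mult.commute)
    then have "w ((x \<otimes>\<^bsub>L\<^esub> y) [^]\<^bsub>L\<^esub> (?n * ?m)) = w (h (?a [^]\<^bsub>E\<^esub> ?m)) + w (h (?b [^]\<^bsub>E\<^esub> ?n))"
      using L.val_mult[OF L.val_pow(1)[OF x] L.val_pow(1)[OF y]]
        tors_pow[OF x, of ?a ?n ?m] tors_pow[OF y, of ?b ?m ?n] X Y by simp
    also have "\<dots> = w (h ?c)"
      using L.val_mult[OF hnz[OF am] hnz[OF bn]] am bn by simp
    finally have "u (x \<otimes>\<^bsub>L\<^esub> y) = of_int (v ?c) / of_nat (?n * ?m)"
      using u_eq[OF xy _ c, of "?n * ?m"] X Y by (metis nat_0_less_mult_iff)
    moreover have "v ?c = int ?m * v ?a + int ?n * v ?b"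
      using E.val_mult[OF am bn] epow X Y by simp
    ultimately show ?thesis using X Y by (simp add: u_def field_simps)
  qed
  have val_u: "valuation L u"
  proof (unfold_locales)
    fix x y assume x: "x \<in> ?L" and y: "y \<in> ?L"
    show "u (x \<otimes>\<^bsub>L\<^esub> y) = u x + u y" using u_mult[OF x y] .
    assume nz: "x \<oplus>\<^bsub>L\<^esub> y \<noteq> \<zero>\<^bsub>L\<^esub>"
    then have s: "x \<oplus>\<^bsub>L\<^esub> y \<in> ?L" using x y by auto
    show "min (u x) (u y) \<le> u (x \<oplus>\<^bsub>L\<^esub> y)"
      using L.val_add[OF x y nz] u_le[OF x s] u_le[OF y s] by (auto simp: min_le_iff_disj)
  qed
  have u_ext: "u (h a) = of_int (v a)" if "a \<in> ?E" for a
    using u_eq[OF hnz[OF that], of 1 a] that by simp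
  show ?thesis
  proof (rule that)
    show "extends_valuation E v L h u"
      using val_u u_ext by (simp add: extends_valuation_def)
    show "u x \<le> u y \<longleftrightarrow> w x \<le> w y" if "x \<in> ?L" "y \<in> ?L" for x y
      using u_le[OF that] .
    fix u' x
    assume u': "extends_valuation E v L h u'"
      and u'_le: "\<And>x y. \<lbrakk> x \<in> ?L; y \<in> ?L \<rbrakk> \<Longrightarrow> u' x \<le> u' y \<longleftrightarrow> w x \<le> w y"
      and x: "x \<in> ?L"
    interpret u': valuation L u' using u' by (simp add: extends_valuation_def)
    note X = NA[OF x]
    have pow: "u' (x [^]\<^bsub>L\<^esub> n) = of_nat n * u' x" for n :: nat
    proof (induction n)
      case 0
      then show ?case using u'.val_one by simp
    next
      case (Suc n)
      then show ?case using u'.val_pow(2)[OF x, of n] by (simp add: algebra_simps)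
    qed
    have "u' (x [^]\<^bsub>L\<^esub> N x) = u' (h (A x))"
      using u'_le[OF L.val_pow(1)[OF x] hnz, of "A x" "N x"]
        u'_le[OF hnz L.val_pow(1)[OF x], of "A x" "N x"] X by auto
    also have "\<dots> = of_int (v (A x))"
      using u' X by (simp add: extends_valuation_def)
    finally show "u' x = u x"
      using X pow by (simp add: u_def field_simps)
  qed
qed

lemma Gal_group:
  assumes "field L" and "K \<subseteq> carrier L"
  shows "group (Gal L K)"
proof -
  interpret L: field L by fact
  have "subgroup {\<sigma> \<in> ring_hom L L \<inter> Bij (carrier L). \<forall>x\<in>K. \<sigma> x = x} (BijGroup (carrier L))"
    (is "subgroup ?H _")
  proof (rule group.subgroupI[OF group_BijGroup])
    show "?H \<subseteq> carrier (BijGroup (carrier L))" by (auto simp: BijGroup_def)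
    have "(\<lambda>x\<in>carrier L. x) \<in> ?H"
      using assms(2) id_Bij by (auto simp: ring_hom_def)
    then show "?H \<noteq> {}" by blast
  next
    fix \<sigma> assume \<sigma>: "\<sigma> \<in> ?H"
    then have bij: "bij_betw \<sigma> (carrier L) (carrier L)" and B: "\<sigma> \<in> Bij (carrier L)"
      and hom: "\<sigma> \<in> ring_hom L L" by (auto simp: Bij_def)
    let ?\<tau> = "\<lambda>x\<in>carrier L. inv_into (carrier L) \<sigma> x"
    have "inv_into (carrier L) \<sigma> \<in> ring_hom L L"
      using ring_iso_set_sym[OF L.is_ring, of \<sigma> L] bij hom
      by (auto simp: ring_iso_def)
    then have "?\<tau> \<in> ring_hom L L" by (auto simp: ring_hom_def)
    moreover have "?\<tau> x = x" if "x \<in> K" for x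
      using that assms(2) \<sigma> bij by (auto simp: inv_into_f_eq bij_betw_def)
    ultimately show "inv\<^bsub>BijGroup (carrier L)\<^esub> \<sigma> \<in> ?H"
      using B restrict_inv_into_Bij[OF B] by (simp add: inv_BijGroup)
  next
    fix \<sigma> \<tau> assume "\<sigma> \<in> ?H" "\<tau> \<in> ?H"
    then show "\<sigma> \<otimes>\<^bsub>BijGroup (carrier L)\<^esub> \<tau> \<in> ?H"
      using assms(2) compose_Bij[of \<sigma> "carrier L" \<tau>]
      by (auto simp: BijGroup_def compose_def ring_hom_def Pi_iff subset_iff)
  qed
  then show ?thesis
    unfolding Gal_def by (rule group.subgroup_imp_group[OF group_BijGroup])
qed

theorem (in valuation) residue_field_is_field: "field (residue_field K v)"
proof -
  let ?O = "valuation_ring K v" and ?m = "valuation_ideal K v"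
  have m_sub: "?m \<subseteq> ?O" and O_sub: "?O \<subseteq> carrier K"
    by (auto simp: valuation_ring_def valuation_ideal_def)
  have one: "\<one> \<in> ?O" by (simp add: valuation_ring_def val_one)
  have neg: "\<ominus> x \<in> ?O" if "x \<in> ?O" for x
    using that val_uminus[of x] by (cases "x = \<zero>") (auto simp: valuation_ring_def)
  have neg': "\<ominus> x \<in> ?m" if "x \<in> ?m" for x
    using that val_uminus[of x] by (cases "x = \<zero>") (auto simp: valuation_ideal_def)
  have mult: "x \<otimes> y \<in> ?O" if "x \<in> ?O" "y \<in> ?O" for x y
    using that val_mult[of x y]
    by (cases "x = \<zero>"; cases "y = \<zero>") (auto simp: valuation_ring_def)
  have mult': "x \<otimes> y \<in> ?m" if "x \<in> ?m" "y \<in> ?O" for x y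
    using that val_mult[of x y]
    by (cases "x = \<zero>"; cases "y = \<zero>")
      (auto simp: valuation_ring_def valuation_ideal_def add_pos_nonneg)
  then have mult'': "y \<otimes> x \<in> ?m" if "x \<in> ?m" "y \<in> ?O" for x y
    using that m_sub O_sub m_comm[of x y] by (metis subsetD)
  have add: "x \<oplus> y \<in> ?O" if "x \<in> ?O" "y \<in> ?O" for x y
  proof (cases "x = \<zero> \<or> y = \<zero> \<or> x \<oplus> y = \<zero>")
    case False
    then have "min (v x) (v y) \<le> v (x \<oplus> y)" "0 \<le> min (v x) (v y)"
      using that val_add[of x y] by (auto simp: valuation_ring_def)
    then have "0 \<le> v (x \<oplus> y)" by (rule order_trans[rotated])
    then show ?thesis using that by (auto simp: valuation_ring_def)
  qed (use that in \<open>auto simp: valuation_ring_def\<close>)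
  have add': "x \<oplus> y \<in> ?m" if "x \<in> ?m" "y \<in> ?m" for x y
  proof (cases "x = \<zero> \<or> y = \<zero> \<or> x \<oplus> y = \<zero>")
    case False
    then have "min (v x) (v y) \<le> v (x \<oplus> y)" "0 < min (v x) (v y)"
      using that val_add[of x y] by (auto simp: valuation_ideal_def)
    then have "0 < v (x \<oplus> y)" by (rule less_le_trans[rotated])
    then show ?thesis using that by (auto simp: valuation_ideal_def)
  qed (use that in \<open>auto simp: valuation_ideal_def\<close>)
  have sub: "subring ?O K"
    using O_sub one neg mult add by (intro subringI) auto
  let ?R = "K\<lparr>carrier := ?O\<rparr>"
  have cring: "cring ?R"
    using subcring_iff[OF O_sub] subcringI'[OF sub] by simp
  interpret R: cring ?R by (rule cring)
  have minus_R: "\<ominus>\<^bsub>?R\<^esub> x = \<ominus> x" if "x \<in> ?O" for x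
    using R.minus_equality[of "\<ominus> x" x] that neg[OF that] O_sub l_neg by auto
  have ideal: "ideal ?m ?R"
  proof (rule idealI[OF cring.axioms(1)[OF cring]])
    show "subgroup ?m (add_monoid ?R)"
    proof (rule R.add.subgroupI)
      show "?m \<noteq> {}" by (auto simp: valuation_ideal_def)
      fix x assume x: "x \<in> ?m"
      show "\<ominus>\<^bsub>?R\<^esub> x \<in> ?m"
        using minus_R[of x] x m_sub neg'[OF x] by auto
    qed (use m_sub add' in auto)
  qed (use mult' mult'' in auto)
  have "maximalideal ?m ?R"
  proof (rule maximalidealI[OF ideal])
    have "\<one> \<notin> ?m" by (simp add: valuation_ideal_def val_one)
    then show "carrier ?R \<noteq> ?m" using one by auto
    fix J assume J: "ideal J ?R" "?m \<subseteq> J" "J \<subseteq> carrier ?R"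
    interpret J: ideal J ?R by (rule J(1))
    show "J = ?m \<or> J = carrier ?R"
    proof (cases "J \<subseteq> ?m")
      case False
      then obtain x where x: "x \<in> J" "x \<in> ?O" "x \<notin> ?m" using J(3) by auto
      then have x': "x \<in> carrier K - {\<zero>}" "v x = 0"
        by (auto simp: valuation_ring_def valuation_ideal_def)
      then have i: "inv x \<in> carrier K - {\<zero>}" "inv x \<otimes> x = \<one>"
        using field_Units by (auto simp: Units_inv_Units)
      then have "v (inv x) = 0" using val_mult[OF i(1) x'(1)] x'(2) val_one by simp
      then have "inv x \<in> ?O" using i(1) by (auto simp: valuation_ring_def)
      then have "\<one> \<in> J" using J.I_l_closed[of x "inv x"] x(1) i(2) by simp
      then show ?thesis using J.one_imp_carrier by simp
    qed (use J(2) in auto)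
  qed
  then show ?thesis
    unfolding residue_field_def by (rule maximalideal.quotient_is_field[OF _ cring])
qed

end

theory Submission
  imports Defs
begin

text \<open>
  Let \<open>L\<close> be an algebraic closure of \<open>E\<close>, let \<open>K\<close> be the image of \<open>E\<close> in \<open>L\<close>, and let \<open>\<pi>\<close> be a uniformizer.
  For \<open>\<alpha>\<^sup>n = \<pi>\<close>, the field \<open>K(\<alpha>)\<close> is totally ramified of degree \<open>n\<close>, so \<open>v\<close> extends uniquely to it and the
  residue field does not grow.

  If \<open>E\<close> is quasi-finite, every finite extension lies in a cyclic one, so there is only one field of each
  degree, namely \<open>K(\<alpha>)\<close>. Hence \<open>v\<close> is henselian, and a root of a polynomial that is nonconstant modulo the
  maximal ideal has a residue, which is already in \<open>\<kappa>\<^sub>v\<close>. The \<open>p\<close>-th roots of \<open>\<pi>\<close> and of \<open>\<pi> u\<close>, for a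
  unit \<open>u\<close>, generate the same field; comparing how a generator of the Galois group acts on them shows
  that \<open>u\<close> is a \<open>p\<close>-th power in \<open>K\<close>. In residue characteristic \<open>p\<close> this fails for \<open>u = 1 + \<pi>\<close>: if
  \<open>\<gamma>\<^sup>p = 1 + \<pi>\<close>, then both factors of \<open>\<pi> = (\<gamma> - 1)(1 + \<gamma> + \<dots> + \<gamma>\<^sup>p\<^sup>-\<^sup>1)\<close> have positive value.

  Conversely, if \<open>v\<close> is henselian, its extension to \<open>L\<close> is invariant under conjugation. As residue
  fields do not grow and the residue characteristic is 0, averaging the conjugates of an element of \<open>L\<close> shows
  that a finite extension has no proper immediate extension and contains every unit of \<open>L\<close> with a power in it.
  So every finite extension is some \<open>K(\<alpha>)\<close>, which is cyclic because \<open>K\<close> contains the roots of unity.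
\<close>

section \<open>Roots and conjugates\<close>

text \<open>The two directions need different substitutes for Galois theory. Cyclicity enters
  through one datum per finite subfield: an endomorphism \<sigma> whose fixed field is exactly
  \<open>K\<close>. What the Galois correspondence would say about powers of \<sigma> comes from
  traces weighted by a polynomial that vanishes at all conjugates of an element but itself. This
  puts the fixed elements into the span of a list of known length, and a comparison of dimensions
  finishes the argument.

  In the converse direction every positive integer is a unit of the valuation ring. The list of
  roots of a minimal polynomial, taken with multiplicity, then suffices: its sum lies in the base
  field and can be divided by its length. The same idea, applied to elements with equal residues,
  yields both facts used there, about immediate extensions and about roots of units.

  The valuation on \<open>K(\<alpha>)\<close> is constructed by hand. The exponents
  \<open>0, ..., n - 1\<close> of \<alpha> give values that differ modulo the values of
  \<open>K\<close>, so nothing cancels in a sum of such terms.\<close>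

lemma (in cring) synthetic_division:
  assumes H: "subring H R" and c: "c \<in> H" and p: "set p \<subseteq> H"
  obtains q where "length q = length p - 1" "set q \<subseteq> H" "q \<noteq> [] \<Longrightarrow> hd q = hd p"
    "length p \<ge> 3 \<Longrightarrow> q ! 1 = p ! 1 \<oplus> hd p \<otimes> c"
    "length p = 2 \<Longrightarrow> eval p c = p ! 1 \<oplus> hd p \<otimes> c"
    "\<And>x. x \<in> carrier R \<Longrightarrow> eval p x = (x \<ominus> c) \<otimes> eval q x \<oplus> eval p c"
proof -
  note sub = subringE[OF H]
  \<comment> \<open>The subring \<open>H\<close> will also be a valuation ring, hence the claim
    \<open>set q \<subseteq> H\<close>. The clauses on index 1 follow the coefficient below the
    leading one, as Vieta's formula for the sum of the roots requires. For
    \<open>length p = 2\<close> the quotient has no such entry, and the remainder takes its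
    place.\<close>
  have "\<exists>q. length q = length p - 1 \<and> set q \<subseteq> H \<and> (q \<noteq> [] \<longrightarrow> hd q = hd p) \<and>
    (length p \<ge> 3 \<longrightarrow> q ! 1 = p ! 1 \<oplus> hd p \<otimes> c) \<and>
    (length p = 2 \<longrightarrow> eval p c = p ! 1 \<oplus> hd p \<otimes> c) \<and>
    (\<forall>x\<in>carrier R. eval p x = (x \<ominus> c) \<otimes> eval q x \<oplus> eval p c)"
    using p
  proof (induction p rule: rev_induct)
    case Nil
    have "c \<in> carrier R" using sub(1) c by auto
    then show ?case by (auto intro!: exI[of _ "[]"])
  next
    case (snoc a p)
    then have a: "a \<in> H" "a \<in> carrier R" and p: "set p \<subseteq> H" "set p \<subseteq> carrier R"
      and c': "c \<in> carrier R" using sub(1) c by auto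
    obtain q where q: "length q = length p - 1" "set q \<subseteq> H" "q \<noteq> [] \<Longrightarrow> hd q = hd p"
      "length p \<ge> 3 \<Longrightarrow> q ! 1 = p ! 1 \<oplus> hd p \<otimes> c"
      "length p = 2 \<Longrightarrow> eval p c = p ! 1 \<oplus> hd p \<otimes> c"
      "\<And>x. x \<in> carrier R \<Longrightarrow> eval p x = (x \<ominus> c) \<otimes> eval q x \<oplus> eval p c"
      using snoc.IH[OF p(1)] by blast
    have e: "eval (p @ [a]) x = eval p x \<otimes> x \<oplus> a" if "x \<in> carrier R" for x
      using eval_append_aux[OF p(2) a(2) that] .
    have epc: "eval p c \<in> H"
    proof -
      have "eval p c \<in> H" if "set p \<subseteq> H" for p
        using that
      proof (induction p)
        case (Cons b p)
        have "c [^] n \<in> H" for n :: nat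
          by (induction n) (use c sub in auto)
        then show ?case using Cons sub by auto
      qed (use sub in auto)
      then show ?thesis using p(1) .
    qed
    show ?case
    proof (cases "p = []")
      case True
      then show ?thesis using a c' by (auto intro!: exI[of _ "[]"])
    next
      case False
      have qc: "set q \<subseteq> carrier R" using q(2) sub(1) by auto
      have ec: "eval p c \<in> carrier R" using epc sub(1) by auto
      \<comment> \<open>Horner's scheme: the remainder of \<open>p\<close> becomes the last
        coefficient of the quotient of \<open>p @ [a]\<close>.\<close>
      let ?q = "q @ [eval p c]"
      have 1: "length ?q = length (p @ [a]) - 1" using False q(1) by (cases p) auto
      have 2: "set ?q \<subseteq> H" using q(2) epc by auto
      have 3: "hd ?q = hd (p @ [a])"
      proof (cases "q = []")
        case True
        then have "length p = 1" using q(1) False by (cases p) auto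
        then obtain b where "p = [b]" by (cases p) auto
        then show ?thesis using True p(2) by auto
      next
        case False2: False
        then show ?thesis using q(3) False by (simp add: hd_append)
      qed
      have 4: "?q ! 1 = (p @ [a]) ! 1 \<oplus> hd (p @ [a]) \<otimes> c" if "length (p @ [a]) \<ge> 3"
      proof (cases "length p = 2")
        case True
        then show ?thesis using q(1,5) False by (auto simp: nth_append hd_append)
      next
        case False2: False
        then have "length p \<ge> 3" using that by auto
        then show ?thesis using q(1,4) False by (auto simp: nth_append hd_append)
      qed
      have 5: "eval (p @ [a]) c = (p @ [a]) ! 1 \<oplus> hd (p @ [a]) \<otimes> c" if l: "length (p @ [a]) = 2"
      proof -
        obtain b where b: "p = [b]" using l by (cases p) auto
        then show ?thesis using e[OF c'] a p(2) c' by (simp add: a_comm)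
      qed
      have 6: "eval (p @ [a]) x = (x \<ominus> c) \<otimes> eval ?q x \<oplus> eval (p @ [a]) c" if x: "x \<in> carrier R" for x
      proof -
        have eq: "eval q x \<in> carrier R" using eval_in_carrier[OF qc x] .
        have "eval ?q x = eval q x \<otimes> x \<oplus> eval p c" using eval_append_aux[OF qc ec x] .
        moreover have "eval (p @ [a]) x = ((x \<ominus> c) \<otimes> eval q x \<oplus> eval p c) \<otimes> x \<oplus> a"
          using e[OF x] q(6)[OF x] by simp
        moreover have "eval (p @ [a]) c = eval p c \<otimes> c \<oplus> a" using e[OF c'] .
        moreover have "((x \<ominus> c) \<otimes> Q \<oplus> P) \<otimes> x \<oplus> a = (x \<ominus> c) \<otimes> (Q \<otimes> x \<oplus> P) \<oplus> (P \<otimes> c \<oplus> a)"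
          if "Q \<in> carrier R" "P \<in> carrier R" for P Q
          using that x c' a by algebra
        ultimately show ?thesis using eq ec by simp
      qed
      show ?thesis using 1 2 3 4 5 6 by (intro exI[of _ ?q]) blast
    qed
  qed
  then show ?thesis using that by blast
qed

lemma (in domain) card_roots_le_degree:
  assumes "finite S" "S \<subseteq> carrier R" "set p \<subseteq> carrier R" "p \<noteq> []" "hd p \<noteq> \<zero>"
    and "\<And>x. x \<in> S \<Longrightarrow> eval p x = \<zero>"
  shows "card S < length p"
  using assms
proof (induction S arbitrary: p)
  case (insert c S)
  then have c: "c \<in> carrier R" by simp
  obtain q where q: "length q = length p - 1" "set q \<subseteq> carrier R" "q \<noteq> [] \<Longrightarrow> hd q = hd p"
    "\<And>x. x \<in> carrier R \<Longrightarrow> eval p x = (x \<ominus> c) \<otimes> eval q x \<oplus> eval p c"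
    by (rule synthetic_division[OF carrier_is_subring c insert.prems(2)]) blast
  have "q \<noteq> []"
  proof
    assume "q = []"
    then have "length p = 1" using q(1) insert.prems(3) by (cases p) auto
    then obtain b where "p = [b]" by (cases p) auto
    then show False using insert.prems(2,4) insert.prems(5)[of c] by auto
  qed
  moreover have "eval q x = \<zero>" if x: "x \<in> S" for x
  proof -
    have xc: "x \<in> carrier R" "x \<noteq> c" using insert x by auto
    have "(x \<ominus> c) \<otimes> eval q x = \<zero>"
      using q(4)[OF xc(1)] insert.prems(5)[of x] insert.prems(5)[of c] x xc c eval_in_carrier[OF q(2) xc(1)] by auto
    then show ?thesis using integral[of "x \<ominus> c" "eval q x"] xc c eval_in_carrier[OF q(2) xc(1)] by auto
  qed
  ultimately have "card S < length q"
    using insert.IH[of q] insert.prems q by auto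
  then show ?case using insert q by auto
qed auto

lemma (in algebraically_closed) ex_root:
  assumes "set p \<subseteq> carrier L" "length p \<ge> 2" "hd p \<noteq> \<zero>"
  obtains x where "x \<in> carrier L" "eval p x = \<zero>"
proof -
  have p: "p \<in> carrier (poly_ring L)"
    using assms unfolding sym[OF univ_poly_carrier] polynomial_def by auto
  have "size (roots p) = degree p" using roots_over_carrier[OF p] unfolding splitted_def .
  then have "roots p \<noteq> {#}" using assms(2) by auto
  then obtain x where "x \<in># roots p" by blast
  then show ?thesis using that roots_mem_iff_is_root[OF p] unfolding is_root_def by blast
qed

text \<open>Roots are split off one at a time and kept in a list, so they count with multiplicity
  and inseparable polynomials are covered. Only the sum of the roots has to be tracked through the
  induction; their product is found by evaluating at 0.\<close>

lemma (in algebraically_closed) monic_splits: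
  assumes "set p \<subseteq> carrier L" "length p = Suc d" "hd p = \<one>"
  shows "\<exists>zs. length zs = d \<and> set zs \<subseteq> carrier L \<and>
    (\<forall>x\<in>carrier L. eval p x = foldr (\<lambda>z a. (x \<ominus> z) \<otimes> a) zs \<one>) \<and>
    (d > 0 \<longrightarrow> p ! 1 = \<ominus> (foldr (\<oplus>) zs \<zero>))"
  using assms
proof (induction d arbitrary: p)
  case 0
  then obtain b where "p = [b]" by (cases p) auto
  then show ?case using 0 by (auto intro!: exI[of _ "[]"])
next
  case (Suc d)
  obtain z where z: "z \<in> carrier L" "eval p z = \<zero>"
    using ex_root[of p] Suc.prems by auto
  obtain q where q: "length q = length p - 1" "set q \<subseteq> carrier L" "q \<noteq> [] \<Longrightarrow> hd q = hd p"
    "length p \<ge> 3 \<Longrightarrow> q ! 1 = p ! 1 \<oplus> hd p \<otimes> z"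
    "length p = 2 \<Longrightarrow> eval p z = p ! 1 \<oplus> hd p \<otimes> z"
    "\<And>x. x \<in> carrier L \<Longrightarrow> eval p x = (x \<ominus> z) \<otimes> eval q x \<oplus> eval p z"
    by (rule synthetic_division[OF carrier_is_subring z(1) Suc.prems(1)]) blast
  have "length q = Suc d" "hd q = \<one>" using q(1,3) Suc.prems by (cases q; auto)+
  then obtain zs where zs: "length zs = d" "set zs \<subseteq> carrier L"
    "\<And>x. x \<in> carrier L \<Longrightarrow> eval q x = foldr (\<lambda>z a. (x \<ominus> z) \<otimes> a) zs \<one>"
    "d > 0 \<Longrightarrow> q ! 1 = \<ominus> (foldr (\<oplus>) zs \<zero>)"
    using Suc.IH[of q] q(2) by blast
  have s: "foldr (\<oplus>) zs \<zero> \<in> carrier L" using zs(2) by (induction zs) auto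
  have p1: "p ! 1 \<in> carrier L" using Suc.prems by (auto simp: subset_iff)
  have sum: "p ! 1 = \<ominus> (foldr (\<oplus>) (z # zs) \<zero>)"
  proof (cases "d = 0")
    case True
    then have "p ! 1 \<oplus> z = \<zero>" using q(5) Suc.prems z by auto
    then show ?thesis using True zs(1) z p1 minus_equality[of "p ! 1" z] by auto
  next
    case False
    then have e: "\<ominus> (foldr (\<oplus>) zs \<zero>) = p ! 1 \<oplus> z" using q(4) zs(4) Suc.prems z by auto
    have "p ! 1 = (p ! 1 \<oplus> z) \<ominus> z" using p1 z(1) by algebra
    also have "\<dots> = \<ominus> (z \<oplus> foldr (\<oplus>) zs \<zero>)" using e[symmetric] s z(1) by (simp, algebra)
    finally show ?thesis by simp
  qed
  have "eval p x = foldr (\<lambda>z a. (x \<ominus> z) \<otimes> a) (z # zs) \<one>" if "x \<in> carrier L" for x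
    using q(6)[OF that] z zs(3)[OF that] eval_in_carrier[OF q(2) that] that by simp
  then show ?case using sum zs(1,2) z(1) by (intro exI[of _ "z # zs"]) auto
qed


lemma (in domain) Irr_props:
  assumes F: "subfield F R" and z: "z \<in> carrier R" "(algebraic over F) z"
  shows "set (Irr F z) \<subseteq> F" "hd (Irr F z) = \<one>" "length (Irr F z) = Suc (degree (Irr F z))"
    "degree (Irr F z) > 0" "eval (Irr F z) z = \<zero>"
proof -
  note I = IrrE[OF F z]
  show "set (Irr F z) \<subseteq> F" "hd (Irr F z) = \<one>" "eval (Irr F z) z = \<zero>"
    using I unfolding sym[OF univ_poly_carrier] polynomial_def by auto
  show d: "degree (Irr F z) > 0"
    using pirreducible_degree[OF F I(1,2)] by simp
  then show "length (Irr F z) = Suc (degree (Irr F z))" by simp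
qed

lemma (in ring) foldr_add_closed:
  "set zs \<subseteq> carrier R \<Longrightarrow> foldr (\<oplus>) zs \<zero> \<in> carrier R"
  by (induction zs) auto

lemma (in domain) eval_in_subring:
  assumes "subring H R" "set p \<subseteq> H" "x \<in> H"
  shows "eval p x \<in> H"
proof -
  have "x [^] n \<in> H" for n :: nat
    by (induction n) (use assms(3) subringE[OF assms(1)] in auto)
  then show ?thesis using assms(2)
    by (induction p) (use subringE[OF assms(1)] in auto)
qed

text \<open>A replacement for trace and norm: up to sign, the sum of the roots is the second
  coefficient of the minimal polynomial, and the product of the negated roots is the constant
  one.\<close>

lemma (in algebraically_closed) conjugate_list:
  assumes F: "subfield F L" and z: "z \<in> carrier L" "(algebraic over F) z"
  obtains zs where "length zs = degree (Irr F z)" "set zs \<subseteq> carrier L" "zs \<noteq> []"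
    "\<forall>z'\<in>set zs. eval (Irr F z) z' = \<zero>"
    "foldr (\<oplus>) zs \<zero> \<in> F" "foldr (\<lambda>z a. (\<ominus> z) \<otimes> a) zs \<one> \<in> F"
proof -
  note sub = subringE[OF subfieldE(1)[OF F]]
  note I = Irr_props[OF F z]
  have Ic: "set (Irr F z) \<subseteq> carrier L" using I(1) sub(1) by auto
  obtain zs where zs: "length zs = degree (Irr F z)" "set zs \<subseteq> carrier L"
    "\<And>x. x \<in> carrier L \<Longrightarrow> eval (Irr F z) x = foldr (\<lambda>z a. (x \<ominus> z) \<otimes> a) zs \<one>"
    "Irr F z ! 1 = \<ominus> (foldr (\<oplus>) zs \<zero>)"
    using monic_splits[OF Ic I(3,2)] I(4) by blast
  have prod0: "foldr (\<lambda>z a. (x \<ominus> z) \<otimes> a) zs \<one> \<in> carrier L \<and> (x \<in> set zs \<longrightarrow> foldr (\<lambda>z a. (x \<ominus> z) \<otimes> a) zs \<one> = \<zero>)"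
    if "set zs \<subseteq> carrier L" "x \<in> carrier L" for x zs
    using that by (induction zs) (auto simp: a_minus_def r_neg)
  have sum: "foldr (\<oplus>) zs \<zero> \<in> F"
  proof -
    have "Irr F z ! 1 \<in> F" using I(1,3,4) nth_mem[of 1 "Irr F z"] by (auto simp: subset_iff)
    then have "\<ominus> (Irr F z ! 1) \<in> F" using sub by auto
    then show ?thesis using zs(4) foldr_add_closed[OF zs(2)] by simp
  qed
  have "foldr (\<lambda>z a. (\<zero> \<ominus> z) \<otimes> a) zs \<one> = foldr (\<lambda>z a. (\<ominus> z) \<otimes> a) zs \<one>"
    using zs(2) by (induction zs) (auto simp: minus_eq)
  then have "foldr (\<lambda>z a. (\<ominus> z) \<otimes> a) zs \<one> \<in> F"
    using eval_in_subring[OF subfieldE(1)[OF F] I(1) sub(2)] zs(3)[of \<zero>] by simp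
  then show ?thesis
    using that[OF zs(1,2)] sum zs(1,2,3) I(4) prod0 by (metis length_greater_0_conv subsetD)
qed

lemma (in domain) eval_conjugate:
  assumes F: "subfield F R" and z: "z \<in> carrier R" "(algebraic over F) z"
    and z': "z' \<in> carrier R" "eval (Irr F z) z' = \<zero>" and p: "set p \<subseteq> F" "eval p z = \<zero>"
  shows "eval p z' = \<zero>"
proof -
  have pc: "set p \<subseteq> carrier R" using p(1) subfieldE(3)[OF F] by auto
  have "normalize p \<in> carrier (F[X])"
    using normalize_gives_polynomial[OF p(1)] univ_poly_carrier by blast
  moreover have "eval (normalize p) z = \<zero>" using eval_normalize[OF pc z(1)] p(2) by simp
  ultimately have "Irr F z pdivides normalize p" by (rule Irr_minimal[OF F z])
  then have "eval (normalize p) z' = \<zero>"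
    using pdivides_imp_root_sharing[OF carrier_polynomial_shell[OF subfieldE(1)[OF F] IrrE(1)[OF F z]] _ z'(1)] z'(2)
    by blast
  then show ?thesis using eval_normalize[OF pc z'(1)] by simp
qed

text \<open>The map sends \<open>eval p z\<close> to \<open>eval p z'\<close> for a chosen
  \<open>p\<close>, and \<open>eval_conjugate\<close> makes the choice irrelevant. Its target is all
  of \<open>R\<close>, because \<open>z'\<close> may lie outside the simple extension.\<close>

lemma (in domain) conjugate_hom:
  assumes F: "subfield F R" and z: "z \<in> carrier R" "(algebraic over F) z"
    and z': "z' \<in> carrier R" "eval (Irr F z) z' = \<zero>"
  obtains \<phi> where "\<phi> \<in> ring_hom (R\<lparr>carrier := simple_extension F z\<rparr>) R"
    "\<And>c. c \<in> F \<Longrightarrow> \<phi> c = c" "\<phi> z = z'"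
    "\<And>p. set p \<subseteq> F \<Longrightarrow> \<phi> (eval p z) = eval p z'"
proof -
  have Fr: "subring F R" and Fc: "F \<subseteq> carrier R" using subfieldE[OF F] by auto
  note sub = subringE[OF Fr]
  have eq: "simple_extension F z = (\<lambda>p. eval p z) ` carrier (F[X])"
    using simple_extension_as_eval_img[OF Fc z(1)] .
  have car: "set p \<subseteq> F" if "p \<in> carrier (F[X])" for p
    using that unfolding sym[OF univ_poly_carrier] polynomial_def by auto
  define \<phi> where "\<phi> y = eval (SOME p. p \<in> carrier (F[X]) \<and> eval p z = y) z'" for y
  interpret U: ring "F[X]" using univ_poly_is_ring[OF Fr] .
  interpret h: ring_hom_ring "F[X]" R "\<lambda>p. eval p z" using eval_ring_hom[OF Fr z(1)] .
  interpret h': ring_hom_ring "F[X]" R "\<lambda>p. eval p z'" using eval_ring_hom[OF Fr z'(1)] .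
  have wd: "eval p z' = eval q z'"
    if pq: "p \<in> carrier (F[X])" "q \<in> carrier (F[X])" "eval p z = eval q z" for p q
  proof -
    have "eval (p \<ominus>\<^bsub>F[X]\<^esub> q) z = \<zero>" using pq by (simp add: a_minus_def r_neg)
    then have "eval (p \<ominus>\<^bsub>F[X]\<^esub> q) z' = \<zero>"
      using eval_conjugate[OF F z z' car] pq by auto
    then have "eval p z' \<ominus> eval q z' = \<zero>" using pq by (simp add: a_minus_def)
    then show ?thesis using pq by simp
  qed
  have val: "\<phi> (eval p z) = eval p z'" if "p \<in> carrier (F[X])" for p
    unfolding \<phi>_def using that by (intro wd) (rule someI2[of _ p]; simp)+
  have vals: "\<phi> (eval p z) = eval p z'" if "set p \<subseteq> F" for p
  proof -
    have "normalize p \<in> carrier (F[X])"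
      using normalize_gives_polynomial[OF that] univ_poly_carrier by blast
    moreover have "set p \<subseteq> carrier R" using that Fc by auto
    ultimately show ?thesis using val[of "normalize p"] eval_normalize z z' by simp
  qed
  show ?thesis
  proof (rule that[of \<phi>])
    show "\<phi> c = c" if "c \<in> F" for c
      using vals[of "[c]"] that z z' Fc by auto
    show "\<phi> z = z'"
      using vals[of "[\<one>, \<zero>]"] sub z z' by auto
    show "\<phi> \<in> ring_hom (R\<lparr>carrier := simple_extension F z\<rparr>) R"
    proof (rule ring_hom_memI)
      show "\<phi> \<one>\<^bsub>R\<lparr>carrier := simple_extension F z\<rparr>\<^esub> = \<one>"
        using vals[of "[\<one>]"] sub z z' by auto
    next
      fix x assume "x \<in> carrier (R\<lparr>carrier := simple_extension F z\<rparr>)"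
      then obtain p where "p \<in> carrier (F[X])" "x = eval p z" using eq by auto
      then show "\<phi> x \<in> carrier R" using val by simp
    next
      fix x y assume "x \<in> carrier (R\<lparr>carrier := simple_extension F z\<rparr>)"
        "y \<in> carrier (R\<lparr>carrier := simple_extension F z\<rparr>)"
      then obtain p q where pq: "p \<in> carrier (F[X])" "x = eval p z" "q \<in> carrier (F[X])" "y = eval q z"
        using eq by auto
      show "\<phi> (x \<otimes>\<^bsub>R\<lparr>carrier := simple_extension F z\<rparr>\<^esub> y) = \<phi> x \<otimes> \<phi> y"
        using val[of "p \<otimes>\<^bsub>F[X]\<^esub> q"] val[of p] val[of q] pq by simp
      show "\<phi> (x \<oplus>\<^bsub>R\<lparr>carrier := simple_extension F z\<rparr>\<^esub> y) = \<phi> x \<oplus> \<phi> y"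
        using val[of "p \<oplus>\<^bsub>F[X]\<^esub> q"] val[of p] val[of q] pq by simp
    qed
  qed (use vals in auto)
qed

section \<open>Fields generated by a cyclic orbit\<close>

lemma (in ring) independent_length_le_spanning:
  assumes K: "subfield K R" and Us: "set Us \<subseteq> carrier R"
    and Vs: "independent K Vs" "set Vs \<subseteq> Span K Us"
  shows "length Vs \<le> length Us"
proof -
  have "\<exists>Ws. independent K Ws \<and> Span K Ws = Span K Us \<and> length Ws \<le> length Us"
    using Us
  proof (induction Us)
    case (Cons u Us)
    then obtain Ws where Ws: "independent K Ws" "Span K Ws = Span K Us" "length Ws \<le> length Us"
      by auto
    have u: "u \<in> carrier R" "set Us \<subseteq> carrier R" using Cons.prems by auto
    show ?case
    proof (cases "u \<in> Span K Us")
      case True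
      have "Span K (u # Us) \<subseteq> Span K Us"
        using mono_Span_subset[OF K, of "u # Us" Us] True Span_base_incl[OF K u(2)] u(2) by auto
      then show ?thesis
        using Ws mono_Span[OF K u(2,1)] by (intro exI[of _ Ws]) auto
    next
      case False
      then have "independent K (u # Ws)" using Ws u by (intro li_Cons) auto
      then show ?thesis using Ws by (intro exI[of _ "u # Ws"]) auto
    qed
  qed auto
  then obtain Ws where Ws: "independent K Ws" "Span K Ws = Span K Us" "length Ws \<le> length Us"
    by blast
  then show ?thesis using independent_length_le[OF K Vs(1) Ws(1)] Vs(2) by simp
qed

lemma (in ring) dimension_mono:
  assumes K: "subfield K R" and "dimension m K A" "dimension n K B" "A \<subseteq> B"
  shows "m \<le> n" "m = n \<Longrightarrow> A = B"
proof -
  obtain Vs where Vs: "independent K Vs" "length Vs = m" "Span K Vs = A" "set Vs \<subseteq> carrier R"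
    using exists_base[OF K assms(2)] by blast
  have "set Vs \<subseteq> B" using Span_base_incl[OF K Vs(4)] Vs(3) assms(4) by auto
  then show "m \<le> n" "m = n \<Longrightarrow> A = B"
    using independent_length_le_dimension[OF K assms(3) Vs(1)]
      independent_length_eq_dimension[OF K assms(3) Vs(1)] Vs by auto
qed

lemma (in ring) finite_dimension_larger_base:
  assumes K: "subfield K R" and K': "subfield K' R" and F: "subfield F R"
    and "K \<subseteq> K'" "K' \<subseteq> F" "finite_dimension K F"
  shows "finite_dimension K' F"
proof -
  obtain n where "dimension n K F" using assms(6) by auto
  then obtain Us where Us: "set Us \<subseteq> carrier R" "Span K Us = F"
    using exists_base[OF K] by blast
  have "F \<subseteq> Span K' Us"
    unfolding Us(2)[symmetric] Span_eq_combine_set[OF K Us(1)] Span_eq_combine_set[OF K' Us(1)]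
    using assms(4) by blast
  moreover have "subalgebra K' F R"
    using subring.axioms(1)[OF subfieldE(1)[OF F]] subringE(6)[OF subfieldE(1)[OF F]] assms(5)
    unfolding subalgebra_def subalgebra_axioms_def by auto
  ultimately show ?thesis
    using subalbegra_incl_imp_finite_dimension[OF K' Span_finite_dimension[OF K' Us(1)]] by blast
qed

lemma (in domain) degree_Irr_dvd:
  assumes K: "subfield K R" and F: "subfield F R" and KF: "K \<subseteq> F" and n: "dimension n K F"
    and x: "x \<in> F"
  shows "degree (Irr K x) dvd n"
proof -
  have fin: "finite_dimension K F" using finite_dimensionI[OF n] .
  have xc: "x \<in> carrier R" using x subfieldE(3)[OF F] by auto
  have alg: "(algebraic over K) x"
    using finite_dimension_imp_algebraic[OF K subfieldE(1)[OF F] fin x] .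
  let ?K = "simple_extension K x"
  have K': "subfield ?K R" using simple_extension_is_subfield[OF K xc] alg by simp
  have incl: "?K \<subseteq> F" using simple_extension_subring_incl[OF subfieldE(1)[OF F] KF x] .
  have "finite_dimension ?K F"
    using finite_dimension_larger_base[OF K K' F _ incl fin]
      simple_extension_incl[OF subfieldE(3)[OF K] xc] by simp
  then obtain m where "dimension m ?K F" by auto
  then have "dimension (degree (Irr K x) * m) K F"
    using telescopic_base[OF K K' dimension_simple_extension[OF K xc alg]] by blast
  then show ?thesis using dimension_is_inj[OF K n] by auto
qed

text \<open>Multiply the factors \<open>X - c\<close>. The exact length matters in
  \<open>orbit\<close>, where the coefficients themselves become a spanning list.\<close>

lemma (in domain) ex_poly_with_roots:
  assumes H: "subring H R" and "set xs \<subseteq> H" "x \<in> H" "x \<notin> set xs"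
  shows "\<exists>g. set g \<subseteq> H \<and> length g = Suc (length xs) \<and> (\<forall>z\<in>set xs. eval g z = \<zero>) \<and> eval g x \<noteq> \<zero>"
proof -
  note sub = subringE[OF H]
  have "\<exists>g. polynomial H g \<and> g \<noteq> [] \<and> degree g = length xs \<and> (\<forall>z\<in>set xs. eval g z = \<zero>) \<and> eval g x \<noteq> \<zero>"
    using assms(2,4)
  proof (induction xs)
    case Nil
    have "polynomial H [\<one>]" using one_is_polynomial[OF H] .
    then show ?case using sub assms(3) by (intro exI[of _ "[\<one>]"]) auto
  next
    case (Cons c xs)
    then obtain g where g: "polynomial H g" "g \<noteq> []" "degree g = length xs"
      "\<And>z. z \<in> set xs \<Longrightarrow> eval g z = \<zero>" "eval g x \<noteq> \<zero>" by auto
    have gc: "set g \<subseteq> carrier R" using polynomial_in_carrier[OF H g(1)] .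
    have c: "c \<in> H" "c \<in> carrier R" "x \<in> carrier R" "x \<noteq> c" "set xs \<subseteq> carrier R"
      using Cons.prems sub(1) assms(3) by auto
    have l: "polynomial H [\<one>, \<ominus> c]" using c sub unfolding polynomial_def by auto
    have lc: "set [\<one>, \<ominus> c] \<subseteq> carrier R" using c by auto
    define h where "h = poly_mult [\<one>, \<ominus> c] g"
    have p: "polynomial H h" using poly_mult_closed[OF H l g(1)] by (simp only: h_def)
    have d: "degree h = Suc (length xs)" using poly_mult_degree_eq[OF H l g(1)] g(2,3)
      by (cases g) (auto simp: h_def simp del: poly_mult.simps)
    have ev: "eval h z = (z \<oplus> \<ominus> c) \<otimes> eval g z" if "z \<in> carrier R" for z
      using eval_poly_mult[OF lc gc that] that c by (simp add: h_def del: poly_mult.simps)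
    have "eval h c = \<zero>" using ev[OF c(2)] eval_in_carrier[OF gc c(2)] c by (simp add: r_neg)
    moreover have "eval h z = \<zero>" if "z \<in> set xs" for z
      using ev[of z] g(4)[OF that] that c by auto
    moreover have "x \<oplus> \<ominus> c \<noteq> \<zero>" using r_right_minus_eq[of x c] c by (simp add: minus_eq)
    then have "eval h x \<noteq> \<zero>" using ev[OF c(3)] g(5) eval_in_carrier[OF gc c(3)] c
      integral[of "x \<oplus> \<ominus> c" "eval g x"] by auto
    moreover have "h \<noteq> []" using d by auto
    ultimately show ?case using p d by (intro exI[of _ h]) auto
  qed
  then show ?thesis using polynomial_incl by (metis Suc_diff_1 length_greater_0_conv)
qed

text \<open>A generator of a cyclic Galois group fixes precisely the base field. This property is
  all that is kept of the group; \<open>orbit\<close> then does the work of the Galois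
  correspondence.\<close>

locale field_aut = field R for R (structure) +
  fixes K N \<sigma>
  assumes K: "subfield K R" and N: "subfield N R" and KN: "K \<subseteq> N"
    and aut: "\<sigma> \<in> ring_hom (R\<lparr>carrier := N\<rparr>) (R\<lparr>carrier := N\<rparr>)"
    and fixed: "\<And>x. x \<in> N \<Longrightarrow> \<sigma> x = x \<longleftrightarrow> x \<in> K"
begin

lemma N_closed [simp]: "x \<in> N \<Longrightarrow> x \<in> carrier R"
  using subfieldE(3)[OF N] by auto

lemmas N_sub [simp, intro] = subringE(2,3,5,6,7)[OF subfieldE(1)[OF N]]

lemma aut_closed [simp, intro]: "x \<in> N \<Longrightarrow> \<sigma> x \<in> N"
  using ring_hom_closed[OF aut] by simp

lemma aut_mult [simp]: "\<lbrakk> x \<in> N; y \<in> N \<rbrakk> \<Longrightarrow> \<sigma> (x \<otimes> y) = \<sigma> x \<otimes> \<sigma> y"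
  using ring_hom_mult[OF aut] by simp

lemma aut_add [simp]: "\<lbrakk> x \<in> N; y \<in> N \<rbrakk> \<Longrightarrow> \<sigma> (x \<oplus> y) = \<sigma> x \<oplus> \<sigma> y"
  using ring_hom_add[OF aut] by simp

lemma aut_fix: "x \<in> K \<Longrightarrow> \<sigma> x = x"
  using fixed KN by auto

lemma aut_0 [simp]: "\<sigma> \<zero> = \<zero>" and aut_1 [simp]: "\<sigma> \<one> = \<one>"
  using aut_fix subringE(2,3)[OF subfieldE(1)[OF K]] by auto

lemma aut_neg [simp]: "x \<in> N \<Longrightarrow> \<sigma> (\<ominus> x) = \<ominus> \<sigma> x"
  by (metis N_closed N_sub(3) aut_0 aut_add aut_closed l_neg minus_equality)

lemma aut_inj: assumes "x \<in> N" "y \<in> N" "\<sigma> x = \<sigma> y" shows "x = y"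
proof -
  have "\<sigma> (x \<ominus> y) = \<zero>" using assms by (simp add: minus_eq r_neg)
  moreover have "\<sigma> a \<noteq> \<zero>" if "a \<in> N - {\<zero>}" for a
  proof
    assume "\<sigma> a = \<zero>"
    note i = subfield_m_inv[OF N that]
    have "\<sigma> (a \<otimes> inv a) = \<zero>" using aut_mult[of a "inv a"] \<open>\<sigma> a = \<zero>\<close> that i(1) by auto
    then show False unfolding i(2) by simp
  qed
  moreover have "x \<ominus> y \<in> N" using assms by (simp add: minus_eq)
  ultimately have "x \<ominus> y = \<zero>" by blast
  then show ?thesis using assms by simp
qed

lemma iter_closed [simp, intro]: "x \<in> N \<Longrightarrow> (\<sigma> ^^ j) x \<in> N"
  by (induction j) auto

lemma iter_mult [simp]: "\<lbrakk> x \<in> N; y \<in> N \<rbrakk> \<Longrightarrow> (\<sigma> ^^ j) (x \<otimes> y) = (\<sigma> ^^ j) x \<otimes> (\<sigma> ^^ j) y"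
  by (induction j) auto

lemma iter_add [simp]: "\<lbrakk> x \<in> N; y \<in> N \<rbrakk> \<Longrightarrow> (\<sigma> ^^ j) (x \<oplus> y) = (\<sigma> ^^ j) x \<oplus> (\<sigma> ^^ j) y"
  by (induction j) auto

lemma iter_fix [simp]: "x \<in> K \<Longrightarrow> (\<sigma> ^^ j) x = x"
  by (induction j) (auto simp: aut_fix)

lemma iter_inj: "\<lbrakk> x \<in> N; y \<in> N; (\<sigma> ^^ j) x = (\<sigma> ^^ j) y \<rbrakk> \<Longrightarrow> x = y"
  by (induction j) (auto dest: aut_inj[rotated 2])

lemma N_pow [simp, intro]: "x \<in> N \<Longrightarrow> x [^] (n :: nat) \<in> N"
  by (induction n) auto

lemma iter_pow [simp]: "x \<in> N \<Longrightarrow> (\<sigma> ^^ j) (x [^] (n :: nat)) = (\<sigma> ^^ j) x [^] n"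
proof (induction n)
  case 0
  then show ?case using iter_fix subringE(3)[OF subfieldE(1)[OF K]] by simp
qed simp

lemma iter_eval:
  assumes "set p \<subseteq> K" "x \<in> N"
  shows "(\<sigma> ^^ j) (eval p x) = eval p ((\<sigma> ^^ j) x)"
  using assms(1)
proof (induction p)
  case Nil
  then show ?case using iter_fix subringE(2)[OF subfieldE(1)[OF K]] by simp
next
  case (Cons a p)
  have "eval p x \<in> N" using eval_in_subring[OF subfieldE(1)[OF N], of p x] Cons KN assms(2) by auto
  then show ?case using Cons KN assms(2) by (auto simp: subset_iff)
qed

lemma iter_mult_period:
  assumes "x \<in> N" "(\<sigma> ^^ s) x = x" shows "(\<sigma> ^^ (s * k)) x = x"
  by (induction k) (use assms in \<open>auto simp: funpow_add\<close>)

text \<open>Applying \<sigma> shifts the sum by one index, and the periodicity of \<open>y\<close>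
  closes the cycle. Here \<open>s\<close> may be any period of \<open>y\<close>, not just the least
  one.\<close>

lemma trace_in_base:
  assumes y: "y \<in> N" "(\<sigma> ^^ s) y = y"
  shows "(\<Oplus>j\<in>{..<s}. (\<sigma> ^^ j) y) \<in> K"
proof -
  have cl: "(\<Oplus>j\<in>{..<s}. (\<sigma> ^^ j) y) \<in> N" for s
    by (induction s) (use y in \<open>auto simp: lessThan_Suc\<close>)
  have "\<sigma> (\<Oplus>j\<in>{..<s}. (\<sigma> ^^ j) y) \<oplus> y = (\<Oplus>j\<in>{..<s}. (\<sigma> ^^ j) y) \<oplus> (\<sigma> ^^ s) y" for s
  proof (induction s)
    case (Suc s)
    let ?S = "\<Oplus>j\<in>{..<s}. (\<sigma> ^^ j) y" and ?T = "(\<sigma> ^^ s) y"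
    have c: "?S \<in> N" "?T \<in> N" "\<sigma> ?S \<in> N" "\<sigma> ?T \<in> N" using cl y by auto
    have S: "(\<Oplus>j\<in>{..<Suc s}. (\<sigma> ^^ j) y) = ?T \<oplus> ?S" using y by (simp add: lessThan_Suc)
    have "\<sigma> (?T \<oplus> ?S) \<oplus> y = \<sigma> ?T \<oplus> (\<sigma> ?S \<oplus> y)" using c y(1) by (simp add: a_assoc)
    also have "\<dots> = \<sigma> ?T \<oplus> (?S \<oplus> ?T)" using Suc by simp
    also have "\<dots> = ?T \<oplus> ?S \<oplus> \<sigma> ?T" using c by (simp add: a_ac)
    finally show ?case using S by simp
  qed simp
  then have "\<sigma> (\<Oplus>j\<in>{..<s}. (\<sigma> ^^ j) y) = (\<Oplus>j\<in>{..<s}. (\<sigma> ^^ j) y)"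
    using cl[of s] y by (metis N_closed aut_closed add.r_cancel)
  then show ?thesis using fixed cl by auto
qed

text \<open>For \<open>y\<close> fixed by the \<open>s\<close>-th power of the automorphism, and \<open>g\<close> vanishing at the conjugates
  of \<open>x\<close> other than \<open>x\<close>, the sum below is \<open>y g(x)\<close> on one hand, and on the other hand it is a
  combination of the coefficients of \<open>g\<close> with traces as weights.\<close>

lemma weighted_sum_eq_combine:
  assumes x: "x \<in> N" and y: "y \<in> N" and g: "set g \<subseteq> N"
  shows "(\<Oplus>j\<in>{..<s}. (\<sigma> ^^ j) y \<otimes> eval g ((\<sigma> ^^ j) x)) =
    combine (map (\<lambda>i. \<Oplus>j\<in>{..<s}. (\<sigma> ^^ j) (y \<otimes> x [^] i)) (rev [0..<length g])) g"
  using g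
proof (induction g)
  case Nil
  have "(\<Oplus>j\<in>{..<s}. (\<sigma> ^^ j) y \<otimes> \<zero>) = (\<Oplus>j\<in>{..<s}. \<zero>)"
    using y by (intro finsum_cong') auto
  then show ?case by simp
next
  case (Cons a g)
  then have a: "a \<in> N" and g: "set g \<subseteq> N" by auto
  have e: "eval g ((\<sigma> ^^ j) x) \<in> N" for j
    using eval_in_subring[OF subfieldE(1)[OF N] g] x by simp
  let ?m = "length g"
  have "(\<Oplus>j\<in>{..<s}. (\<sigma> ^^ j) y \<otimes> eval (a # g) ((\<sigma> ^^ j) x)) =
    (\<Oplus>j\<in>{..<s}. (\<sigma> ^^ j) (y \<otimes> x [^] ?m) \<otimes> a \<oplus> (\<sigma> ^^ j) y \<otimes> eval g ((\<sigma> ^^ j) x))"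
    using x y a e by (intro finsum_cong') (auto simp: r_distr m_ac)
  also have "\<dots> = (\<Oplus>j\<in>{..<s}. (\<sigma> ^^ j) (y \<otimes> x [^] ?m) \<otimes> a)
    \<oplus> (\<Oplus>j\<in>{..<s}. (\<sigma> ^^ j) y \<otimes> eval g ((\<sigma> ^^ j) x))"
    using x y a e by (intro finsum_addf) auto
  also have "(\<Oplus>j\<in>{..<s}. (\<sigma> ^^ j) (y \<otimes> x [^] ?m) \<otimes> a) = (\<Oplus>j\<in>{..<s}. (\<sigma> ^^ j) (y \<otimes> x [^] ?m)) \<otimes> a"
    using x y a by (intro finsum_ldistr[symmetric]) auto
  finally show ?case using Cons.IH[OF g] by simp
qed

text \<open>Let \<open>t\<close> be the least period of \<open>x\<close>. Its \<open>t\<close>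
  distinct conjugates are roots of the minimal polynomial, so \<open>t \<le> s\<close>. Conversely,
  the elements fixed by the \<open>t\<close>-th power of \<sigma> lie in the span of
  \<open>t\<close> elements and include \<open>simple_extension K x\<close>, which has dimension
  \<open>s\<close>. Thus \<open>s = t\<close>, and the span equals the simple extension.\<close>

lemma orbit:
  assumes x: "x \<in> N" and alg: "(algebraic over K) x"
  defines "s \<equiv> degree (Irr K x)"
  shows "(\<sigma> ^^ s) x = x" "inj_on (\<lambda>j. (\<sigma> ^^ j) x) {..<s}"
    "\<And>y. \<lbrakk> y \<in> N; (\<sigma> ^^ s) y = y \<rbrakk> \<Longrightarrow> y \<in> simple_extension K x"
proof -
  note I = Irr_props[OF K N_closed[OF x] alg]
  have Ic: "set (Irr K x) \<subseteq> carrier R" using I(1) subfieldE(3)[OF K] by auto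
  have root: "eval (Irr K x) ((\<sigma> ^^ j) x) = \<zero>" for j
    using iter_eval[OF I(1) x, of j] I(5) iter_fix[of \<zero>] subringE(2)[OF subfieldE(1)[OF K]] by simp
  have bound: "t \<le> s" if "inj_on (\<lambda>j. (\<sigma> ^^ j) x) {..<t}" for t
  proof -
    have "card ((\<lambda>j. (\<sigma> ^^ j) x) ` {..<t}) < length (Irr K x)"
      using Ic root x I by (intro card_roots_le_degree) auto
    then show ?thesis using card_image[OF that] I(3) by (simp add: s_def)
  qed
  have "\<exists>t>0. (\<sigma> ^^ t) x = x"
  proof -
    \<comment> \<open>Otherwise a polynomial of degree \<open>s\<close> would have
      \<open>s + 1\<close> distinct roots.\<close>
    have "\<not> inj_on (\<lambda>j. (\<sigma> ^^ j) x) {..<Suc s}" using bound[of "Suc s"] by auto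
    then obtain i j where ij: "i < j" "(\<sigma> ^^ i) x = (\<sigma> ^^ j) x"
      unfolding inj_on_def by (metis linorder_neqE_nat)
    have "(\<sigma> ^^ j) x = (\<sigma> ^^ i) ((\<sigma> ^^ (j - i)) x)"
      using ij(1) funpow_add[of i "j - i" \<sigma>] by simp
    then have "(\<sigma> ^^ (j - i)) x = x" using iter_inj[of x "(\<sigma> ^^ (j - i)) x" i] ij x by simp
    then show ?thesis using ij by (intro exI[of _ "j - i"]) auto
  qed
  define t where "t = (LEAST t. t > 0 \<and> (\<sigma> ^^ t) x = x)"
  have t: "t > 0" "(\<sigma> ^^ t) x = x" and min: "\<And>j. \<lbrakk> 0 < j; j < t \<rbrakk> \<Longrightarrow> (\<sigma> ^^ j) x \<noteq> x"
    using LeastI_ex[OF \<open>\<exists>t>0. (\<sigma> ^^ t) x = x\<close>] not_less_Least[of _ "\<lambda>t. t > 0 \<and> (\<sigma> ^^ t) x = x"]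
    by (auto simp: t_def)
  have injt: "inj_on (\<lambda>j. (\<sigma> ^^ j) x) {..<t}"
  proof (rule linorder_inj_onI)
    fix i j assume ij: "i < j" "i \<in> {..<t}" "j \<in> {..<t}"
    show "(\<sigma> ^^ i) x \<noteq> (\<sigma> ^^ j) x"
    proof
      assume e: "(\<sigma> ^^ i) x = (\<sigma> ^^ j) x"
      have "(\<sigma> ^^ j) x = (\<sigma> ^^ i) ((\<sigma> ^^ (j - i)) x)"
        using ij(1) funpow_add[of i "j - i" \<sigma>] by simp
      then have "(\<sigma> ^^ (j - i)) x = x" using iter_inj[of x "(\<sigma> ^^ (j - i)) x" i] e x by simp
      moreover have "j - i < t" "0 < j - i" using ij by auto
      ultimately show False using min by blast
    qed
  qed auto
  have "x \<notin> set (map (\<lambda>j. (\<sigma> ^^ j) x) [1..<t])"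
    using min by (auto simp: Suc_le_eq) metis
  then obtain g where g: "set g \<subseteq> N" "length g = t" "eval g x \<noteq> \<zero>"
    "\<And>j. \<lbrakk> 0 < j; j < t \<rbrakk> \<Longrightarrow> eval g ((\<sigma> ^^ j) x) = \<zero>"
    using ex_poly_with_roots[OF subfieldE(1)[OF N], of "map (\<lambda>j. (\<sigma> ^^ j) x) [1..<t]" x] x t(1)
    by (auto simp: image_subset_iff Suc_le_eq)
  have gx: "eval g x \<in> N - {\<zero>}" using eval_in_subring[OF subfieldE(1)[OF N] g(1) x] g(3) by simp
  note i = subfield_m_inv[OF N gx]
  \<comment> \<open>The traces express \<open>y\<close> times \<open>eval g x\<close> by the
    coefficients of \<open>g\<close>; dividing these coefficients by \<open>eval g x\<close> gives a
    list, independent of \<open>y\<close>, that spans all fixed elements.\<close>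
  define Us where "Us = map (\<lambda>u. u \<otimes> inv (eval g x)) g"
  have gc: "set g \<subseteq> carrier R" using g(1) by auto
  have Us: "set Us \<subseteq> carrier R" "length Us = t" using gc i(1) g(2) by (auto simp: Us_def)
  have span: "y \<in> Span K Us" if y: "y \<in> N" "(\<sigma> ^^ t) y = y" for y
  proof -
    define Ks where "Ks = map (\<lambda>i. \<Oplus>j\<in>{..<t}. (\<sigma> ^^ j) (y \<otimes> x [^] i)) (rev [0..<length g])"
    have Ks: "set Ks \<subseteq> K"
    proof -
      have "(\<Oplus>j\<in>{..<t}. (\<sigma> ^^ j) (y \<otimes> x [^] i)) \<in> K" for i :: nat
        by (rule trace_in_base) (use y x t(2) in auto)
      then show ?thesis unfolding Ks_def by auto
    qed
    \<comment> \<open>Only the summand for \<open>j = 0\<close> survives, by the choice of the roots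
      of \<open>g\<close>.\<close>
    have "(\<Oplus>j\<in>{..<t}. (\<sigma> ^^ j) y \<otimes> eval g ((\<sigma> ^^ j) x)) =
      (\<Oplus>j\<in>{..<t}. if j = 0 then y \<otimes> eval g x else \<zero>)"
      using y x gx g(4) by (intro finsum_cong') auto
    also have "\<dots> = y \<otimes> eval g x"
      using finsum_singleton[of 0 "{..<t}" "\<lambda>_. y \<otimes> eval g x"] t(1) y gx by auto
    finally have "y \<otimes> eval g x = combine Ks g"
      using weighted_sum_eq_combine[OF x y(1) g(1), of t] by (simp add: Ks_def)
    then have "y = combine Ks g \<otimes> inv (eval g x)"
      using i gx y(1) by (metis DiffD1 N_closed m_assoc r_one)
    also have "\<dots> = combine Ks Us"
      unfolding Us_def using Ks subfieldE(3)[OF K] gc i(1) by (intro combine_l_distr) auto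
    finally show ?thesis using Span_eq_combine_set[OF K Us(1)] Ks by auto
  qed
  have fix_ext: "y \<in> N \<and> (\<sigma> ^^ t) y = y" if "y \<in> simple_extension K x" for y
  proof -
    obtain p where p: "p \<in> carrier (K[X])" "y = eval p x"
      using \<open>y \<in> simple_extension K x\<close> simple_extension_as_eval_img[OF subfieldE(3)[OF K] N_closed[OF x]] by auto
    then have pK: "set p \<subseteq> K" unfolding sym[OF univ_poly_carrier] polynomial_def by auto
    then show ?thesis
      using iter_eval[OF pK x, of t] t(2) p(2) eval_in_subring[OF subfieldE(1)[OF N] _ x, of p] KN by auto
  qed
  note dim = dimension_simple_extension[OF K N_closed[OF x] alg]
  obtain Vs where Vs: "independent K Vs" "length Vs = s" "Span K Vs = simple_extension K x" "set Vs \<subseteq> carrier R"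
    using exists_base[OF K dim] by (auto simp: s_def)
  have VU: "set Vs \<subseteq> Span K Us"
    using Span_base_incl[OF K Vs(4)] Vs(3) fix_ext span by blast
  have st: "s = t"
    using independent_length_le_spanning[OF K Us(1) Vs(1) VU] Us(2) Vs(2) bound[OF injt] by simp
  obtain m where m: "dimension m K (Span K Us)" using Span_finite_dimension[OF K Us(1)] by auto
  have "m \<le> t"
  proof -
    obtain Ws where Ws: "independent K Ws" "length Ws = m" "Span K Ws = Span K Us" "set Ws \<subseteq> carrier R"
      using exists_base[OF K m] by auto
    then show ?thesis
      using independent_length_le_spanning[OF K Us(1) Ws(1)] Span_base_incl[OF K Ws(4)] Us(2) by simp
  qed
  moreover have "simple_extension K x \<subseteq> Span K Us" using fix_ext span by blast
  ultimately have "simple_extension K x = Span K Us"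
    using dimension_mono[OF K dim m] st by (auto simp: s_def)
  then show "(\<sigma> ^^ s) x = x" "inj_on (\<lambda>j. (\<sigma> ^^ j) x) {..<s}"
    "\<And>y. \<lbrakk> y \<in> N; (\<sigma> ^^ s) y = y \<rbrakk> \<Longrightarrow> y \<in> simple_extension K x"
    using st t injt span by auto
qed

text \<open>By \<open>orbit\<close> the degree of an element is a period of it, and that degree
  divides \<open>n\<close>.\<close>

lemma iter_dimension_fix:
  assumes F: "subfield F R" "K \<subseteq> F" "F \<subseteq> N" and n: "dimension n K F" and x: "x \<in> F"
  shows "(\<sigma> ^^ n) x = x"
proof -
  have xN: "x \<in> N" using x F by auto
  have "(algebraic over K) x"
    using finite_dimension_imp_algebraic[OF K subfieldE(1)[OF F(1)] finite_dimensionI[OF n] x] .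
  then show ?thesis
    using orbit(1)[OF xN] degree_Irr_dvd[OF K F(1,2) n x] iter_mult_period[OF xN] by (auto elim!: dvdE)
qed

end

section \<open>Roots of unity and valuations on subfields\<close>

lemma (in monoid) pow_gcd_eq_one:
  assumes x: "x \<in> carrier G" and "x [^] (a :: nat) = \<one>" "x [^] (b :: nat) = \<one>"
  shows "x [^] gcd a b = \<one>"
proof (cases "a = 0")
  case False
  then obtain s t where st: "a * s = b * t + gcd a b" using bezout_nat by blast
  have "x [^] (a * s) = \<one>" "x [^] (b * t) = \<one>"
    using assms by (metis nat_pow_pow nat_pow_one)+
  then show ?thesis using st x nat_pow_mult[OF x, of "b * t" "gcd a b"] by simp
qed (use assms in simp)

lemma (in monoid) prime_pow_eq_one_iff:
  assumes x: "x \<in> carrier G" "x \<noteq> \<one>" and p: "Factorial_Ring.prime p" "x [^] p = \<one>"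
  shows "x [^] i = \<one> \<longleftrightarrow> p dvd (i :: nat)"
proof
  assume "x [^] i = \<one>"
  then have "x [^] gcd p i = \<one>" using pow_gcd_eq_one[OF x(1) p(2)] by simp
  then show "p dvd i" using x p(1) by (metis coprime_iff_gcd_eq_1 nat_pow_eone prime_imp_coprime)
next
  assume "p dvd i"
  then show "x [^] i = \<one>" using x p by (metis dvdE nat_pow_pow nat_pow_one)
qed


lemma (in domain) pow_nonzero:
  "\<lbrakk> x \<in> carrier R; x \<noteq> \<zero> \<rbrakk> \<Longrightarrow> x [^] (n :: nat) \<noteq> \<zero>"
  by (induction n) (auto simp: integral_iff)

lemma (in field) pow_inj_on_order:
  assumes x: "x \<in> carrier R" and ord: "\<And>i :: nat. x [^] i = \<one> \<longleftrightarrow> n dvd i"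
  shows "inj_on (\<lambda>i :: nat. x [^] i) {..<n}"
proof (rule linorder_inj_onI)
  fix i j :: nat assume ij: "i < j" "i \<in> {..<n}" "j \<in> {..<n}"
  have "x [^] n = \<one>" using ord[of n] by simp
  then have x0: "x \<noteq> \<zero>" using ij by (auto simp: nat_pow_zero)
  show "x [^] i \<noteq> x [^] j"
  proof
    assume e: "x [^] i = x [^] j"
    have c: "x [^] i \<in> carrier R" "x [^] i \<noteq> \<zero>" using x x0 pow_nonzero by auto
    have "x [^] i \<otimes> x [^] (j - i) = x [^] i \<otimes> \<one>"
      using e ij(1) nat_pow_mult[OF x, of i "j - i"] c by simp
    then have "x [^] (j - i) = \<one>" using c x m_lcancel by blast
    then show False using ord[of "j - i"] ij by (auto dest: dvd_imp_le)
  qed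
qed auto

text \<open>The polynomial \<open>X^n - a\<close>, for positive \<open>n\<close>. The constant term
  is appended at the end so that \<open>eval_append_aux\<close> reduces evaluation to a
  monomial.\<close>

definition (in ring) X_pow_minus :: "nat \<Rightarrow> 'a \<Rightarrow> 'a list"
  where "X_pow_minus n a = (\<one> # replicate (n - 1) \<zero>) @ [\<ominus> a]"

lemma (in cring) X_pow_minus_props:
  assumes "n > 0" "a \<in> carrier R"
  shows "length (X_pow_minus n a) = Suc n" "hd (X_pow_minus n a) = \<one>"
    "set (X_pow_minus n a) \<subseteq> carrier R"
    "x \<in> carrier R \<Longrightarrow> eval (X_pow_minus n a) x = x [^] n \<ominus> a"
    "subring H R \<Longrightarrow> a \<in> H \<Longrightarrow> set (X_pow_minus n a) \<subseteq> H"
proof -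
  show "length (X_pow_minus n a) = Suc n" "hd (X_pow_minus n a) = \<one>"
    "set (X_pow_minus n a) \<subseteq> carrier R"
    using assms by (auto simp: X_pow_minus_def)
  show "set (X_pow_minus n a) \<subseteq> H" if "subring H R" "a \<in> H"
    using that subringE[OF that(1)] by (auto simp: X_pow_minus_def)
  assume x: "x \<in> carrier R"
  have "set (monom \<one> (n - 1)) \<subseteq> carrier R" by (auto simp: monom_def)
  then have "eval (X_pow_minus n a) x = eval (monom \<one> (n - 1)) x \<otimes> x \<oplus> \<ominus> a"
    unfolding X_pow_minus_def using eval_append_aux[of "monom \<one> (n - 1)" "\<ominus> a" x] assms x
    by (simp add: monom_def)
  also have "\<dots> = x [^] Suc (n - 1) \<oplus> \<ominus> a" using eval_monom[of \<one> x "n - 1"] x by simp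
  finally show "eval (X_pow_minus n a) x = x [^] n \<ominus> a" using assms by (simp add: minus_eq)
qed

lemma (in algebraically_closed) ex_nth_root:
  assumes "n > 0" "a \<in> carrier L"
  obtains r where "r \<in> carrier L" "r [^] (n :: nat) = a"
proof -
  note X = X_pow_minus_props[OF assms]
  obtain r where "r \<in> carrier L" "eval (X_pow_minus n a) r = \<zero>"
    using ex_root[of "X_pow_minus n a"] X(1,2,3) assms(1) by auto
  then show ?thesis using that X(4) assms(2) by auto
qed

text \<open>As a coefficient list, \<open>replicate n \<one>\<close> is
  \<open>1 + X + ... + X^(n-1)\<close>. Its value at 1 is the integer \<open>n\<close>, which is how
  roots of unity become linked to the characteristic.\<close>

lemma (in cring) geometric_eval:
  assumes "x \<in> carrier R"
  shows "(x \<ominus> \<one>) \<otimes> eval (replicate n \<one>) x = x [^] n \<ominus> \<one>"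
proof (induction n)
  case (Suc n)
  have e: "eval (replicate n \<one>) x \<in> carrier R" using eval_in_carrier[of "replicate n \<one>" x] assms
    by (metis insert_subset one_closed set_replicate_conv_if subsetI empty_iff list.set(1))
  have "(x \<ominus> \<one>) \<otimes> eval (replicate (Suc n) \<one>) x = (x \<ominus> \<one>) \<otimes> x [^] n \<oplus> (x \<ominus> \<one>) \<otimes> eval (replicate n \<one>) x"
    using assms e by (simp add: r_distr minus_eq)
  also have "\<dots> = (x \<ominus> \<one>) \<otimes> x [^] n \<oplus> (x [^] n \<ominus> \<one>)" using Suc by simp
  also have "\<dots> = x [^] n \<otimes> x \<ominus> \<one>"
  proof -
    have "(x \<ominus> \<one>) \<otimes> y \<oplus> (y \<ominus> \<one>) = y \<otimes> x \<ominus> \<one>" if "y \<in> carrier R" for y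
      using assms that by algebra
    then show ?thesis using assms by simp
  qed
  finally show ?case by simp
qed (use assms in \<open>simp add: minus_eq r_neg\<close>)

lemma (in cring) eval_replicate_one:
  "eval (replicate n \<one>) \<one> = [n] \<cdot> \<one>"
  by (induction n) (auto simp: a_comm)

text \<open>The root is built one prime factor at a time, from a primitive \<open>m\<close>-th root
  for \<open>n = p * m\<close>. If \<open>p\<close> divides \<open>m\<close>, a \<open>p\<close>-th
  root of it has order \<open>n\<close>. Otherwise it is multiplied by a root of
  \<open>1 + X + ... + X^(p-1)\<close>; this root differs from 1 because \<open>p\<close> is not
  zero in the field, so it has order \<open>p\<close>.\<close>

lemma (in algebraically_closed) ex_primitive_root:
  assumes char0: "\<And>n :: nat. n > 0 \<Longrightarrow> [n] \<cdot> \<one> \<noteq> \<zero>" and "n > 0"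
  obtains \<zeta> where "\<zeta> \<in> carrier L" "\<And>i :: nat. \<zeta> [^] i = \<one> \<longleftrightarrow> n dvd i"
proof -
  have "\<exists>\<zeta>\<in>carrier L. \<forall>i :: nat. \<zeta> [^] i = \<one> \<longleftrightarrow> n dvd i"
    using assms(2)
  proof (induction n rule: less_induct)
    case (less n)
    show ?case
    proof (cases "n = 1")
      case False
      then obtain p where p: "Factorial_Ring.prime p" "p dvd n" using prime_factor_nat by blast
      then obtain m where n: "n = p * m" by auto
      have m: "m > 0" "m < n" using n less.prems p prime_gt_1_nat[OF p(1)] by auto
      then obtain \<omega> where w: "\<omega> \<in> carrier L" "\<And>i :: nat. \<omega> [^] i = \<one> \<longleftrightarrow> m dvd i"
        using less.IH[of m] by auto
      show ?thesis
      proof (cases "p dvd m")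
        case True
        obtain r where r: "r \<in> carrier L" "r [^] p = \<omega>"
          using ex_nth_root[OF _ w(1)] p(1) prime_gt_0_nat by blast
        have rp: "\<omega> [^] k = r [^] (p * k)" for k :: nat using r by (simp add: nat_pow_pow[symmetric])
        have "n dvd i" if "r [^] i = \<one>" for i
        proof -
          have "\<omega> [^] i = (r [^] i) [^] p" using rp[of i] r by (simp add: nat_pow_pow mult.commute)
          then have "m dvd i" using w(2) that by simp
          then obtain j where j: "i = m * j" by auto
          obtain l where l: "m = p * l" using True by auto
          have "\<omega> [^] (l * j) = \<one>" using rp[of "l * j"] that j l by (simp add: mult.assoc)
          then have "m dvd l * j" using w(2) by simp
          then have "p dvd j" using l m by auto
          then show ?thesis using j n by auto
        qed
        moreover have "r [^] i = \<one>" if d: "n dvd i" for i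
        proof -
          obtain k where "i = n * k" using d by (rule dvdE)
          then have "i = p * (m * k)" using n by simp
          then show ?thesis using rp[of "m * k"] w(2)[of "m * k"] by simp
        qed
        ultimately show ?thesis using r(1) by blast
      next
        case False
        have p1: "p > 1" using prime_gt_1_nat[OF p(1)] .
        have "hd (replicate p \<one>) = \<one>" using p1 by (cases p) auto
        then obtain \<xi> where x: "\<xi> \<in> carrier L" "eval (replicate p \<one>) \<xi> = \<zero>"
          using ex_root[of "replicate p \<one>"] p1 by auto
        have x1: "\<xi> \<noteq> \<one>" using x(2) eval_replicate_one[of p] char0[of p] p1 by auto
        have "\<xi> [^] p \<ominus> \<one> = \<zero>" using geometric_eval[OF x(1), of p] x by (simp add: minus_eq)
        then have xp: "\<xi> [^] p = \<one>" using x by simp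
        note X = prime_pow_eq_one_iff[OF x(1) x1 p(1) xp]
        have cop: "coprime p m" using False p(1) by (simp add: prime_imp_coprime)
        have "n dvd i" if e: "(\<omega> \<otimes> \<xi>) [^] i = \<one>" for i
        proof -
          have e': "\<omega> [^] (i * k) \<otimes> \<xi> [^] (i * k) = \<one>" for k
            using e w(1) x(1) by (metis nat_pow_distrib nat_pow_pow nat_pow_one m_closed)
          have "\<omega> [^] (i * p) = \<one>" using e'[of p] X[of "i * p"] w(1) by simp
          then have "m dvd i" using w(2) cop by (metis coprime_commute coprime_dvd_mult_left_iff)
          moreover have "\<xi> [^] (i * m) = \<one>" using e'[of m] w(2)[of "i * m"] x(1) by simp
          then have "p dvd i" using X cop by (metis coprime_dvd_mult_left_iff)
          ultimately show ?thesis using n cop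
            by (metis coprime_dvd_mult_right_iff dvdE mult_dvd_mono dvd_refl mult.commute)
        qed
        moreover have "(\<omega> \<otimes> \<xi>) [^] i = \<one>" if "n dvd i" for i
          using that n w x X[of i] by (auto simp: nat_pow_distrib)
        ultimately show ?thesis using w(1) x(1) by blast
      qed
    qed (auto intro!: bexI[of _ \<one>])
  qed
  then show ?thesis using that by blast
qed

text \<open>Valuations on subfields use the operations of one ambient field, so different subfields
  can be compared without changing the ring. The values lie in an ordered ring, in which multiples
  of values can be written as products with \<open>of_nat\<close> and \<open>of_int\<close>.\<close>

locale field_val = field R for R (structure) +
  fixes F and w :: "'a \<Rightarrow> 'g :: linordered_idom"
  assumes F: "subfield F R"
    and val_mult: "\<lbrakk> x \<in> F - {\<zero>}; y \<in> F - {\<zero>} \<rbrakk> \<Longrightarrow> w (x \<otimes> y) = w x + w y"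
    and val_add: "\<lbrakk> x \<in> F - {\<zero>}; y \<in> F - {\<zero>}; x \<oplus> y \<noteq> \<zero> \<rbrakk> \<Longrightarrow> min (w x) (w y) \<le> w (x \<oplus> y)"
begin

lemma F_carrier: "x \<in> F \<Longrightarrow> x \<in> carrier R"
  using subfieldE(3)[OF F] by auto

lemmas F_sub = subringE(2,3,5,6,7)[OF subfieldE(1)[OF F]]

lemma F_minus: "\<lbrakk> x \<in> F; y \<in> F \<rbrakk> \<Longrightarrow> x \<ominus> y \<in> F"
  using F_sub by (simp add: minus_eq)

lemma F_pow: "x \<in> F \<Longrightarrow> x [^] (n :: nat) \<in> F"
  by (induction n) (use F_sub in auto)

lemma F_pow_nz: "x \<in> F - {\<zero>} \<Longrightarrow> x [^] (n :: nat) \<in> F - {\<zero>}"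
  using F_pow F_carrier pow_nonzero by auto

lemma F_mult_nz: "\<lbrakk> x \<in> F - {\<zero>}; y \<in> F - {\<zero>} \<rbrakk> \<Longrightarrow> x \<otimes> y \<in> F - {\<zero>}"
  using F_sub F_carrier integral_iff by auto

lemma F_inv_nz: "x \<in> F - {\<zero>} \<Longrightarrow> inv x \<in> F - {\<zero>}"
  using subfield_m_inv(1)[OF F] by auto

lemma val_one: "w \<one> = 0"
  using val_mult[of \<one> \<one>] F_sub by simp

lemma val_pow: "x \<in> F - {\<zero>} \<Longrightarrow> w (x [^] n) = of_nat n * w x"
proof (induction n)
  case (Suc n)
  then show ?case using val_mult[OF F_pow_nz[of x n], of x] by (simp add: algebra_simps)
qed (simp add: val_one)

lemma val_inv: "x \<in> F - {\<zero>} \<Longrightarrow> w (inv x) = - w x"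
  using val_mult[of x "inv x"] F_inv_nz[of x] subfield_m_inv(2)[OF F, of x] val_one by (simp add: eq_neg_iff_add_eq_0)

lemma val_neg: assumes "x \<in> F - {\<zero>}" shows "\<ominus> x \<in> F - {\<zero>}" "w (\<ominus> x) = w x"
proof -
  have xc: "x \<in> carrier R" using assms F_carrier by auto
  show *: "\<ominus> x \<in> F - {\<zero>}" using assms F_sub xc minus_minus[of x] by auto
  have "(\<ominus> x) [^] (2 :: nat) = x [^] (2 :: nat)"
    using xc by (auto simp: numeral_2_eq_2 l_minus r_minus)
  then have "2 * w (\<ominus> x) = 2 * w x" using val_pow[OF *, of 2] val_pow[OF assms, of 2] by simp
  then show "w (\<ominus> x) = w x" by simp
qed

text \<open>\<open>ge 0\<close> is the valuation ring and \<open>gt 0\<close> its maximal ideal.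
  Zero belongs to every such set, as if its value were infinite.\<close>

definition ge :: "'g \<Rightarrow> 'a set" where "ge t = {x \<in> F. x = \<zero> \<or> t \<le> w x}"
definition gt :: "'g \<Rightarrow> 'a set" where "gt t = {x \<in> F. x = \<zero> \<or> t < w x}"

lemma geI: "x \<in> F \<Longrightarrow> (x \<noteq> \<zero> \<Longrightarrow> t \<le> w x) \<Longrightarrow> x \<in> ge t"
  and gtI: "x \<in> F \<Longrightarrow> (x \<noteq> \<zero> \<Longrightarrow> t < w x) \<Longrightarrow> x \<in> gt t"
  by (auto simp: ge_def gt_def)

lemma geD: "x \<in> ge t \<Longrightarrow> x \<in> F" "x \<in> ge t \<Longrightarrow> x \<noteq> \<zero> \<Longrightarrow> t \<le> w x"
  and gtD: "x \<in> gt t \<Longrightarrow> x \<in> F" "x \<in> gt t \<Longrightarrow> x \<noteq> \<zero> \<Longrightarrow> t < w x"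
  by (auto simp: ge_def gt_def)

lemma zero_ge: "\<zero> \<in> ge t" and zero_gt: "\<zero> \<in> gt t" and one_ge: "\<one> \<in> ge 0" and one_not_gt: "\<one> \<notin> gt 0"
  using F_sub val_one by (auto simp: ge_def gt_def)

lemma gt_ge: "x \<in> gt t \<Longrightarrow> x \<in> ge t" and ge_mono: "x \<in> ge s \<Longrightarrow> t \<le> s \<Longrightarrow> x \<in> ge t"
  and ge_gt: "x \<in> ge s \<Longrightarrow> t < s \<Longrightarrow> x \<in> gt t"
  by (auto simp: ge_def gt_def)

lemma ge_add: assumes "x \<in> ge t" "y \<in> ge t" shows "x \<oplus> y \<in> ge t"
proof (cases "x = \<zero> \<or> y = \<zero> \<or> x \<oplus> y = \<zero>")
  case True
  then show ?thesis using assms F_carrier zero_ge geD(1) by auto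
next
  case False
  then have "min (w x) (w y) \<le> w (x \<oplus> y)" using val_add[of x y] assms geD(1) by auto
  then show ?thesis using assms False F_sub by (auto simp: ge_def min_def split: if_splits)
qed

lemma gt_add: assumes "x \<in> gt t" "y \<in> gt t" shows "x \<oplus> y \<in> gt t"
proof (cases "x = \<zero> \<or> y = \<zero> \<or> x \<oplus> y = \<zero>")
  case True
  then show ?thesis using assms F_carrier zero_gt gtD(1) by auto
next
  case False
  then have "min (w x) (w y) \<le> w (x \<oplus> y)" using val_add[of x y] assms gtD(1) by auto
  then show ?thesis using assms False F_sub by (auto simp: gt_def min_def split: if_splits)
qed

lemma ge_neg: "x \<in> ge t \<Longrightarrow> \<ominus> x \<in> ge t" and gt_neg: "x \<in> gt t \<Longrightarrow> \<ominus> x \<in> gt t"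
  using val_neg[of x] by (cases "x = \<zero>"; auto simp: ge_def gt_def)+

lemma ge_minus: "x \<in> ge t \<Longrightarrow> y \<in> ge t \<Longrightarrow> x \<ominus> y \<in> ge t"
  and gt_minus: "x \<in> gt t \<Longrightarrow> y \<in> gt t \<Longrightarrow> x \<ominus> y \<in> gt t"
  by (simp_all add: minus_eq ge_add gt_add ge_neg gt_neg)

lemma ge_mult: assumes "x \<in> ge s" "y \<in> ge t" shows "x \<otimes> y \<in> ge (s + t)"
proof (cases "x = \<zero> \<or> y = \<zero>")
  case True
  then show ?thesis using assms F_carrier zero_ge geD(1) geD(1) by auto
next
  case False
  then have "w (x \<otimes> y) = w x + w y" using val_mult assms geD(1) geD(1) by auto
  moreover have "s + t \<le> w x + w y"
    using add_mono[of s "w x" t "w y"] geD(2)[OF assms(1)] geD(2)[OF assms(2)] False by auto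
  ultimately show ?thesis
    using assms geD(1) geD(1) F_sub(4) by (intro geI) auto
qed

lemma gt_mult_ge: assumes "x \<in> gt s" "y \<in> ge t" shows "x \<otimes> y \<in> gt (s + t)"
proof (cases "x = \<zero> \<or> y = \<zero>")
  case True
  then show ?thesis using assms F_carrier zero_gt gtD(1) geD(1) by auto
next
  case False
  then have "w (x \<otimes> y) = w x + w y" using val_mult assms gtD(1) geD(1) by auto
  moreover have "s + t < w x + w y"
    using add_less_le_mono[of s "w x" t "w y"] gtD(2)[OF assms(1)] geD(2)[OF assms(2)] False by auto
  ultimately show ?thesis
    using assms gtD(1) geD(1) F_sub(4) by (intro gtI) auto
qed

lemma ge_mult_gt: assumes "x \<in> ge s" "y \<in> gt t" shows "x \<otimes> y \<in> gt (s + t)"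
proof (cases "x = \<zero> \<or> y = \<zero>")
  case True
  then show ?thesis using assms F_carrier zero_gt geD(1) gtD(1) by auto
next
  case False
  then have "w (x \<otimes> y) = w x + w y" using val_mult assms geD(1) gtD(1) by auto
  moreover have "s + t < w x + w y"
    using add_le_less_mono[of s "w x" t "w y"] geD(2)[OF assms(1)] gtD(2)[OF assms(2)] False by auto
  ultimately show ?thesis
    using assms geD(1) gtD(1) F_sub(4) by (intro gtI) auto
qed

lemma ge0_subring: "subring (ge 0) R"
proof (rule subringI)
  show "ge 0 \<subseteq> carrier R" using F_carrier by (auto simp: ge_def)
qed (use one_ge ge_neg ge_add ge_mult[of _ 0 _ 0] in auto)

lemma gt0_mult: "x \<in> gt 0 \<Longrightarrow> y \<in> ge 0 \<Longrightarrow> x \<otimes> y \<in> gt 0" "x \<in> ge 0 \<Longrightarrow> y \<in> gt 0 \<Longrightarrow> x \<otimes> y \<in> gt 0"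
  using gt_mult_ge[of x 0 y 0] ge_mult_gt[of x 0 y 0] by auto

lemma val_close:
  assumes y: "y \<in> F - {\<zero>}" and d: "x \<ominus> y \<in> gt (w y)" and x: "x \<in> F"
  shows "x \<in> F - {\<zero>}" "w x = w y"
proof -
  have c: "x \<in> carrier R" "y \<in> carrier R" using x y F_carrier by auto
  have nz: "x \<noteq> \<zero>"
  proof
    assume "x = \<zero>"
    then have "\<ominus> y \<in> gt (w y)" using d c by (simp add: minus_eq)
    then show False using val_neg[OF y] gtD[of "\<ominus> y" "w y"] by auto
  qed
  show "x \<in> F - {\<zero>}" using nz x by simp
  have "x = (x \<ominus> y) \<oplus> y" "y = x \<ominus> (x \<ominus> y)" using c by algebra+
  have "x \<ominus> y \<in> ge (w y)" "y \<in> ge (w y)" using d gt_ge y by (auto simp: ge_def)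
  then have "x \<in> ge (w y)" using ge_add \<open>x = (x \<ominus> y) \<oplus> y\<close> by metis
  then have 1: "w y \<le> w x" using nz geD by auto
  show "w x = w y"
  proof (rule ccontr)
    assume "w x \<noteq> w y"
    then have "x \<in> gt (w y)" using 1 x nz by (auto simp: gt_def)
    then have "y \<in> gt (w y)" using gt_minus[OF _ d] \<open>y = x \<ominus> (x \<ominus> y)\<close> by metis
    then show False using y gtD(2) by auto
  qed
qed

lemma eval_ge0: "\<lbrakk> set p \<subseteq> ge 0; x \<in> ge 0 \<rbrakk> \<Longrightarrow> eval p x \<in> ge 0"
  using eval_in_subring[OF ge0_subring] .

lemma nat_ge0: "[(n :: nat)] \<cdot> \<one> \<in> ge 0"
  by (induction n) (use zero_ge one_ge ge_add in auto)

text \<open>Dividing \<open>p\<close> by \<open>X - y\<close> gives a quotient that again has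
  coefficients in the valuation ring.\<close>

lemma eval_cong_ge0:
  assumes "set p \<subseteq> ge 0" "x \<in> ge 0" "y \<in> ge 0" "x \<ominus> y \<in> gt 0"
  shows "eval p x \<ominus> eval p y \<in> gt 0"
proof -
  obtain q where q: "set q \<subseteq> ge 0" "\<And>x. x \<in> carrier R \<Longrightarrow> eval p x = (x \<ominus> y) \<otimes> eval q x \<oplus> eval p y"
    by (rule synthetic_division[OF ge0_subring assms(3,1)]) blast
  have "eval q x \<in> ge 0" using eval_ge0 q(1) assms by auto
  then have "(x \<ominus> y) \<otimes> eval q x \<in> gt 0" using gt0_mult assms(4) by auto
  moreover have "eval p x \<ominus> eval p y = (x \<ominus> y) \<otimes> eval q x"
  proof -
    have "a \<oplus> b \<ominus> b = a" if "a \<in> carrier R" "b \<in> carrier R" for a b using that by algebra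
    then show ?thesis
      using q(2)[of x] F_carrier geD(1)[OF eval_ge0[OF assms(1,3)]]
        gtD(1)[OF \<open>(x \<ominus> y) \<otimes> eval q x \<in> gt 0\<close>] assms(2) geD(1)[of x] by metis
  qed
  ultimately show ?thesis by simp
qed

end

lemma (in field) valuation_iff_field_val:
  fixes w :: "'a \<Rightarrow> 'g :: linordered_idom"
  assumes F: "subfield F R"
  shows "valuation (R\<lparr>carrier := F\<rparr>) w \<longleftrightarrow> field_val R F w"
  using subfield_iff(2)[OF F] F field_axioms
  by (auto simp: valuation_def valuation_axioms_def field_val_def field_val_axioms_def)

section \<open>Adjoining a root of a uniformizer\<close>

lemma (in domain) degree_Irr_le:
  assumes F: "subfield F R" and z: "z \<in> carrier R" "(algebraic over F) z"
    and p: "set p \<subseteq> F" "p \<noteq> []" "hd p \<noteq> \<zero>" "eval p z = \<zero>"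
  shows "degree (Irr F z) \<le> degree p"
proof -
  have "p \<in> carrier (F[X])" using p unfolding sym[OF univ_poly_carrier] polynomial_def by auto
  then show ?thesis
    using pdivides_imp_degree_le[OF subfieldE(1)[OF F] IrrE(1)[OF F z] _ p(2) Irr_minimal[OF F z _ p(4)]]
    by blast
qed

section \<open>Finite subfields of an algebraic closure\<close>

locale valued_closure = algebraically_closed L for L (structure) +
  fixes K and v :: "'a \<Rightarrow> int"
  assumes alg: "x \<in> carrier L \<Longrightarrow> (algebraic over K) x"
    and V: "field_val L K v"
    and value_group: "v ` (K - {\<zero>}) = UNIV"

sublocale valued_closure \<subseteq> V: field_val L K v
  by (rule V)

context valued_closure
begin

definition extension_on :: "'a set \<Rightarrow> ('a \<Rightarrow> rat) \<Rightarrow> bool"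
  where "extension_on F w \<longleftrightarrow> field_val L F w \<and> (\<forall>c\<in>K - {\<zero>}. w c = of_int (v c))"

definition finite_subfield :: "'a set \<Rightarrow> bool"
  where "finite_subfield F \<longleftrightarrow> subfield F L \<and> K \<subseteq> F \<and> finite_dimension K F"

lemma algebraic_over: "subfield F L \<Longrightarrow> K \<subseteq> F \<Longrightarrow> x \<in> carrier L \<Longrightarrow> (algebraic over F) x"
  using alg algebraic_mono[of K F x] by (simp add: over_def)

lemma finite_subfield_adjoin:
  assumes "finite_subfield F" "x \<in> carrier L"
  shows "finite_subfield (simple_extension F x)" "F \<subseteq> simple_extension F x" "x \<in> simple_extension F x"
proof -
  have F: "subfield F L" "K \<subseteq> F" "finite_dimension K F" using assms by (auto simp: finite_subfield_def)
  note a = algebraic_over[OF F(1,2) assms(2)]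
  show incl: "F \<subseteq> simple_extension F x" "x \<in> simple_extension F x"
    using simple_extension_incl[OF subfieldE(3)[OF F(1)] assms(2)]
      simple_extension_mem[OF subfieldE(1)[OF F(1)] assms(2)] by auto
  have "finite_dimension K (simple_extension F x)"
    using telescopic_base_dim(1)[OF V.F F(1,3)] finite_dimension_simple_extension[OF F(1) assms(2)] a by blast
  then show "finite_subfield (simple_extension F x)"
    using incl F simple_extension_is_subfield[OF F(1) assms(2)] a by (auto simp: finite_subfield_def)
qed

lemma finite_subfield_base: "finite_subfield K"
  using V.F dimension_one[OF V.F] finite_dimensionI by (auto simp: finite_subfield_def)

lemma conjugate_pow:
  assumes F: "subfield F L" "K \<subseteq> F" and z: "z \<in> carrier L" "n > 0" "z [^] (n :: nat) \<in> F"
    and z': "z' \<in> carrier L" "eval (Irr F z) z' = \<zero>"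
  shows "z' [^] n = z [^] n"
proof -
  note X = X_pow_minus_props[OF z(2) nat_pow_closed[OF z(1), of n]]
  have "eval (X_pow_minus n (z [^] n)) z' = \<zero>"
    using eval_conjugate[OF F(1) z(1) algebraic_over[OF F z(1)] z' X(5)[OF subfieldE(1)[OF F(1)] z(3)]]
      X(4)[OF z(1)] z(1) by (simp add: minus_eq r_neg)
  then show ?thesis using X(4)[OF z'(1)] z(1) z'(1) by simp
qed

end

section \<open>Total ramification of a root of a uniformizer\<close>

locale uniformizer_root = valued_closure +
  fixes \<pi> \<alpha> n
  assumes pi: "\<pi> \<in> K - {\<zero>}" "v \<pi> = 1" and n: "n > (0 :: nat)"
    and al: "\<alpha> \<in> carrier L" "\<alpha> [^] n = \<pi>"
begin

text \<open>The product of the conjugates of \<open>\<alpha>\<close> lies in \<open>K\<close>, and its \<open>2n\<close>-th power is \<open>\<pi>\<close> to the power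
  twice the degree of \<open>\<alpha>\<close>.\<close>

lemma degree_Irr: "degree (Irr K \<alpha>) = n"
proof (rule antisym)
  note a = alg[OF al(1)]
  have pc: "\<pi> \<in> carrier L" using pi V.F_carrier by auto
  note X = X_pow_minus_props[OF n pc]
  have "eval (X_pow_minus n \<pi>) \<alpha> = \<zero>" using X(4)[OF al(1)] al pc by (simp add: minus_eq r_neg)
  moreover have "X_pow_minus n \<pi> \<noteq> []" using X(1) by auto
  ultimately show "degree (Irr K \<alpha>) \<le> n"
    using degree_Irr_le[OF V.F al(1) a X(5)[OF subfieldE(1)[OF V.F]]] pi X(1,2) by auto
  obtain zs where zs: "length zs = degree (Irr K \<alpha>)" "set zs \<subseteq> carrier L" "zs \<noteq> []"
    "\<forall>z'\<in>set zs. eval (Irr K \<alpha>) z' = \<zero>"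
    "foldr (\<oplus>) zs \<zero> \<in> K" "foldr (\<lambda>z a. (\<ominus> z) \<otimes> a) zs \<one> \<in> K"
    by (rule conjugate_list[OF V.F al(1) a])
  \<comment> \<open>The factor 2 in the exponent removes the signs in the product of the negated
    conjugates.\<close>
  have pw: "(\<ominus> z) [^] (2 * n) = \<pi> [^] (2 :: nat)" if "z \<in> set zs" for z
  proof -
    have zc: "z \<in> carrier L" using that zs(2) by auto
    have "z [^] n = \<pi>"
      using conjugate_pow[OF V.F _ al(1) n _ zc bspec[OF zs(4) that]] al pi by auto
    moreover have "(\<ominus> z) [^] (2 :: nat) = z [^] (2 :: nat)"
      using zc by (auto simp: numeral_2_eq_2 l_minus r_minus)
    then have "(\<ominus> z) [^] (2 * n) = (z [^] n) [^] (2 :: nat)"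
      using zc by (metis a_inv_closed mult.commute nat_pow_pow)
    ultimately show ?thesis by simp
  qed
  define c where "c = foldr (\<lambda>z a. (\<ominus> z) \<otimes> a) zs \<one>"
  have "foldr (\<lambda>z a. (\<ominus> z) \<otimes> a) zs \<one> \<in> carrier L \<and>
    (foldr (\<lambda>z a. (\<ominus> z) \<otimes> a) zs \<one>) [^] (2 * n) = \<pi> [^] (2 * length zs)"
    using zs(2) pw
  proof (induction zs)
    case (Cons z zs)
    let ?P = "foldr (\<lambda>z a. (\<ominus> z) \<otimes> a) zs \<one>"
    have IH: "?P \<in> carrier L" "?P [^] (2 * n) = \<pi> [^] (2 * length zs)" and zc: "z \<in> carrier L"
      using Cons by auto
    have "((\<ominus> z) \<otimes> ?P) [^] (2 * n) = \<pi> [^] (2 :: nat) \<otimes> \<pi> [^] (2 * length zs)"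
      using nat_pow_distrib[of "\<ominus> z" ?P "2 * n"] IH zc Cons.prems(2)[of z] by simp
    also have "\<dots> = \<pi> [^] (2 * length (z # zs))" using nat_pow_mult[OF pc] by simp
    finally show ?case using IH zc by simp
  qed simp
  then have c: "c \<in> K" "c \<in> carrier L" "c [^] (2 * n) = \<pi> [^] (2 * length zs)"
    using zs(6) V.F_carrier by (auto simp: c_def)
  have "\<pi> [^] (2 * length zs) \<noteq> \<zero>" using pow_nonzero[OF pc] pi by auto
  then have "c \<in> K - {\<zero>}" using c n by (auto simp: nat_pow_zero)
  \<comment> \<open>Since \<open>v c\<close> is an integer, comparing values shows that
    \<open>n\<close> divides the number of conjugates, which is the degree.\<close>
  then have "of_nat (2 * n) * v c = of_nat (2 * length zs) * v \<pi>"
    using V.val_pow[of c "2 * n"] V.val_pow[OF pi(1), of "2 * length zs"] c(3) by simp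
  then have "int n * v c = int (length zs)" using pi(2) by simp
  then have "int n dvd int (length zs)" by (metis dvd_triv_left)
  then have "n dvd length zs" by simp
  then show "n \<le> degree (Irr K \<alpha>)" using zs(1,3) by (metis dvd_imp_le length_greater_0_conv)
qed

abbreviation "F \<equiv> simple_extension K \<alpha>"
text \<open>\<open>A\<close> plays the role of the valuation ring of \<open>F\<close>, and \<alpha>
  that of its uniformizer, before any valuation on \<open>F\<close> is available.\<close>

abbreviation "A \<equiv> simple_extension (V.ge 0) \<alpha>"

lemma alpha_nz: "\<alpha> \<noteq> \<zero>"
  using al pi n by (auto simp: nat_pow_zero)

lemma F_finite: "finite_subfield F" "K \<subseteq> F" "\<alpha> \<in> F" "dimension n K F" "subfield F L"
  using finite_subfield_adjoin[OF finite_subfield_base al(1)]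
    dimension_simple_extension[OF V.F al(1) alg[OF al(1)]] degree_Irr
  by (auto simp: finite_subfield_def)

lemma A_sub: "subring A L" "V.ge 0 \<subseteq> A" "\<alpha> \<in> A"
  using simple_extension_is_subring[OF V.ge0_subring al(1)] simple_extension_mem[OF V.ge0_subring al(1)]
    simple_extension_incl[OF subringE(1)[OF V.ge0_subring] al(1)] by auto

lemmas A_closed = subringE(2,3,5,6,7)[OF A_sub(1)]

lemma A_carrier: "x \<in> A \<Longrightarrow> x \<in> carrier L"
  using subringE(1)[OF A_sub(1)] by auto

lemma A_pow: "\<alpha> [^] (i :: nat) \<in> A"
  by (induction i) (use A_closed A_sub in auto)

lemma A_in_F: "A \<subseteq> F"
  using mono_simple_extension[of "V.ge 0" K \<alpha>] V.geD(1) by auto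

text \<open>By Horner's scheme: multiplication by \<alpha> turns the leading coefficient
  \<open>d\<close> into \<open>d\<close> times \<open>\<alpha>^n = \<pi>\<close>, and the constant
  term absorbs this. With exactly \<open>n\<close> coefficients, linear independence of the powers
  of \<alpha> can be applied.\<close>

lemma A_reduced:
  assumes "a \<in> A"
  obtains cs where "set cs \<subseteq> V.ge 0" "length cs = n" "a = eval cs \<alpha>"
proof -
  note O = V.ge0_subring
  note Os = subringE[OF O]
  obtain p where p: "p \<in> carrier ((V.ge 0)[X])" "a = eval p \<alpha>"
    using assms simple_extension_as_eval_img[OF Os(1) al(1)] by auto
  have "set p \<subseteq> V.ge 0" using p(1) unfolding sym[OF univ_poly_carrier] polynomial_def by auto
  then have "\<exists>cs. set cs \<subseteq> V.ge 0 \<and> length cs = n \<and> eval p \<alpha> = eval cs \<alpha>"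
  proof (induction p rule: rev_induct)
    case Nil
    have "eval (replicate n \<zero>) \<alpha> = \<zero>" using eval_replicate[of "[]" \<alpha> n] al by simp
    then show ?case using Os by (intro exI[of _ "replicate n \<zero>"]) auto
  next
    case (snoc b p)
    then have b: "b \<in> V.ge 0" "b \<in> carrier L" and pO: "set p \<subseteq> V.ge 0" "set p \<subseteq> carrier L"
      using Os(1) by auto
    obtain cs where cs: "set cs \<subseteq> V.ge 0" "length cs = n" "eval p \<alpha> = eval cs \<alpha>"
      using snoc.IH[OF pO(1)] by auto
    obtain d cs' where ds: "cs = d # cs'" using cs(2) n by (cases cs) auto
    have d: "d \<in> V.ge 0" "d \<in> carrier L" "set cs' \<subseteq> V.ge 0" "set cs' \<subseteq> carrier L"
      using cs(1) ds Os(1) by auto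
    have pO': "\<pi> \<in> V.ge 0" "\<pi> \<in> carrier L" using pi V.F_carrier by (auto simp: V.ge_def)
    have dp: "d \<otimes> \<pi> \<oplus> b \<in> V.ge 0" using d b pO' Os by auto
    have an: "\<alpha> [^] length cs' \<otimes> \<alpha> = \<pi>" using al(2) cs(2) ds by (metis length_Cons nat_pow_Suc)
    have e: "eval cs' \<alpha> \<in> carrier L" using eval_in_carrier[OF d(4) al(1)] .
    have "eval (p @ [b]) \<alpha> = (d \<otimes> \<alpha> [^] length cs' \<oplus> eval cs' \<alpha>) \<otimes> \<alpha> \<oplus> b"
      using eval_append_aux[OF pO(2) b(2) al(1)] cs(3) ds by simp
    also have "\<dots> = eval cs' \<alpha> \<otimes> \<alpha> \<oplus> (d \<otimes> (\<alpha> [^] length cs' \<otimes> \<alpha>) \<oplus> b)"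
    proof -
      have "(d \<otimes> y \<oplus> e) \<otimes> \<alpha> \<oplus> b = e \<otimes> \<alpha> \<oplus> (d \<otimes> (y \<otimes> \<alpha>) \<oplus> b)" if "y \<in> carrier L" "e \<in> carrier L" for y e
        using that d(2) b(2) al(1) by algebra
      then show ?thesis using e al(1) by simp
    qed
    also have "\<dots> = eval (cs' @ [d \<otimes> \<pi> \<oplus> b]) \<alpha>"
      using eval_append_aux[OF d(4) _ al(1)] dp Os(1) an by auto
    finally show ?case
      using d(3) dp cs(2) ds by (intro exI[of _ "cs' @ [d \<otimes> \<pi> \<oplus> b]"]) auto
  qed
  then show ?thesis using that p(2) by auto
qed

lemma eval_eq_0:
  assumes "set cs \<subseteq> K" "length cs = n" "eval cs \<alpha> = \<zero>"
  shows "set cs \<subseteq> {\<zero>}"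
proof -
  have ind: "independent K (exp_base \<alpha> n)"
    using exp_base_independent[OF V.F al(1) alg[OF al(1)]] degree_Irr by simp
  have l: "length (exp_base \<alpha> n) = n" by (simp add: exp_base_def)
  show ?thesis
    using independent_imp_trivial_combine[OF V.F ind assms(1)] combine_eq_eval[of cs \<alpha>] assms l by simp
qed

text \<open>If \<alpha> times \<open>a\<close> is in \<open>K\<close>, its constant term shows that
  it is a multiple of \<pi> by an element of the valuation ring, so it has positive value.\<close>

lemma unit_not_multiple:
  assumes c: "c \<in> K - {\<zero>}" "v c = 0" and a: "a \<in> A"
  shows "c \<noteq> \<alpha> \<otimes> a"
proof
  assume eq: "c = \<alpha> \<otimes> a"
  obtain cs where cs: "set cs \<subseteq> V.ge 0" "length cs = n" "a = eval cs \<alpha>" using A_reduced[OF a] .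
  obtain d cs' where ds: "cs = d # cs'" using cs(2) n by (cases cs) auto
  have d: "d \<in> V.ge 0" "d \<in> K" "d \<in> carrier L" "set cs' \<subseteq> K" "set cs' \<subseteq> carrier L"
    using cs(1) ds V.geD(1) V.F_carrier by auto
  have an: "\<alpha> [^] length cs' \<otimes> \<alpha> = \<pi>" using al(2) cs(2) ds by (metis length_Cons nat_pow_Suc)
  have e: "eval cs' \<alpha> \<in> carrier L" using eval_in_carrier[OF d(5) al(1)] .
  have pc: "\<pi> \<in> K" "\<pi> \<in> carrier L" using pi V.F_carrier by auto
  have cc: "c \<in> K" "c \<in> carrier L" using c V.F_carrier by auto
  have dp: "d \<otimes> \<pi> \<ominus> c \<in> K" using d pc cc V.F_sub V.F_minus by auto
  have "c = \<alpha> \<otimes> (d \<otimes> \<alpha> [^] length cs' \<oplus> eval cs' \<alpha>)" using eq cs(3) ds by simp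
  also have "\<dots> = eval cs' \<alpha> \<otimes> \<alpha> \<oplus> d \<otimes> (\<alpha> [^] length cs' \<otimes> \<alpha>)"
  proof -
    have "\<alpha> \<otimes> (d \<otimes> y \<oplus> e) = e \<otimes> \<alpha> \<oplus> d \<otimes> (y \<otimes> \<alpha>)" if "y \<in> carrier L" "e \<in> carrier L" for y e
      using that d(3) al(1) by algebra
    then show ?thesis using e al(1) by simp
  qed
  finally have ce: "c = eval cs' \<alpha> \<otimes> \<alpha> \<oplus> d \<otimes> \<pi>" using an by simp
  have "eval (cs' @ [d \<otimes> \<pi> \<ominus> c]) \<alpha> = eval cs' \<alpha> \<otimes> \<alpha> \<oplus> (d \<otimes> \<pi> \<ominus> c)"
    using eval_append_aux[OF d(5) _ al(1)] dp V.F_carrier by blast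
  also have "\<dots> = (eval cs' \<alpha> \<otimes> \<alpha> \<oplus> d \<otimes> \<pi>) \<ominus> c"
  proof -
    have "x \<oplus> (y \<ominus> c) = (x \<oplus> y) \<ominus> c" if "x \<in> carrier L" "y \<in> carrier L" for x y
      using that cc(2) by algebra
    then show ?thesis using e al(1) d pc by simp
  qed
  also have "\<dots> = \<zero>" using ce cc by (metis a_minus_def r_neg)
  finally have "set (cs' @ [d \<otimes> \<pi> \<ominus> c]) \<subseteq> {\<zero>}"
    using eval_eq_0[of "cs' @ [d \<otimes> \<pi> \<ominus> c]"] dp d(4) cs(2) ds by auto
  then have "c = d \<otimes> \<pi>" using d pc cc by auto
  moreover have "\<pi> \<in> V.gt 0" using pi by (auto simp: V.gt_def)
  ultimately have "c \<in> V.gt 0" using V.gt0_mult d(1) by auto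
  then show False using c V.gtD(2)[of c 0] by auto
qed

text \<open>The elements of \<open>A\<close> with a unit of the valuation ring of \<open>K\<close>
  as residue. In place of inverses, three properties are used: \<open>U\<close> is closed under
  products, absorbs multiples of \<alpha>, and contains no multiple of \<alpha>.\<close>

definition U :: "'a set" where "U = {c \<oplus> \<alpha> \<otimes> a | c a. c \<in> K - {\<zero>} \<and> v c = 0 \<and> a \<in> A}"

lemma U_A: "u \<in> U \<Longrightarrow> u \<in> A"
proof -
  assume "u \<in> U"
  then obtain c a where "u = c \<oplus> \<alpha> \<otimes> a" "c \<in> V.ge 0" "a \<in> A" by (auto simp: U_def V.ge_def)
  then show ?thesis using A_closed A_sub by auto
qed

lemma U_not_multiple: assumes "u \<in> U" "a \<in> A" shows "u \<noteq> \<alpha> \<otimes> a"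
proof
  assume eq: "u = \<alpha> \<otimes> a"
  obtain c b where c: "u = c \<oplus> \<alpha> \<otimes> b" "c \<in> K - {\<zero>}" "v c = 0" "b \<in> A"
    using assms by (auto simp: U_def)
  have car: "c \<in> carrier L" "a \<in> carrier L" "b \<in> carrier L" using c assms V.F_carrier A_carrier by auto
  have "c = \<alpha> \<otimes> (a \<ominus> b)"
  proof -
    have "c = (c \<oplus> \<alpha> \<otimes> b) \<ominus> \<alpha> \<otimes> b" using car al(1) by algebra
    also have "\<dots> = \<alpha> \<otimes> a \<ominus> \<alpha> \<otimes> b" using eq c by simp
    also have "\<dots> = \<alpha> \<otimes> (a \<ominus> b)" using car al(1) by algebra
    finally show ?thesis .
  qed
  then show False
    using unit_not_multiple[OF c(2,3), of "a \<ominus> b"] A_closed assms(2) c(4) by (auto simp: minus_eq)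
qed

lemma U_mult: assumes "u \<in> U" "u' \<in> U" shows "u \<otimes> u' \<in> U"
proof -
  obtain c b where c: "u = c \<oplus> \<alpha> \<otimes> b" "c \<in> K - {\<zero>}" "v c = 0" "b \<in> A"
    using assms(1) by (auto simp: U_def)
  obtain c' b' where c': "u' = c' \<oplus> \<alpha> \<otimes> b'" "c' \<in> K - {\<zero>}" "v c' = 0" "b' \<in> A"
    using assms(2) by (auto simp: U_def)
  have car: "c \<in> carrier L" "b \<in> carrier L" "c' \<in> carrier L" "b' \<in> carrier L"
    using c c' V.F_carrier A_carrier by auto
  have "c \<in> A" "c' \<in> A" using c c' A_sub(2) by (auto simp: V.ge_def)
  then have "c \<otimes> b' \<oplus> b \<otimes> c' \<oplus> \<alpha> \<otimes> (b \<otimes> b') \<in> A" using c c' A_closed A_sub by auto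
  moreover have "u \<otimes> u' = c \<otimes> c' \<oplus> \<alpha> \<otimes> (c \<otimes> b' \<oplus> b \<otimes> c' \<oplus> \<alpha> \<otimes> (b \<otimes> b'))"
    unfolding c(1) c'(1) using car al(1) by algebra
  moreover have "c \<otimes> c' \<in> K - {\<zero>}" "v (c \<otimes> c') = 0"
    using V.F_mult_nz V.val_mult c c' by auto
  ultimately show ?thesis unfolding U_def by blast
qed

lemma U_add: assumes "u \<in> U" "a \<in> A" shows "u \<oplus> \<alpha> \<otimes> a \<in> U"
proof -
  obtain c b where c: "u = c \<oplus> \<alpha> \<otimes> b" "c \<in> K - {\<zero>}" "v c = 0" "b \<in> A"
    using assms(1) by (auto simp: U_def)
  have car: "c \<in> carrier L" "b \<in> carrier L" "a \<in> carrier L" using c assms V.F_carrier A_carrier by auto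
  have "u \<oplus> \<alpha> \<otimes> a = c \<oplus> \<alpha> \<otimes> (b \<oplus> a)" unfolding c(1) using car al(1) by algebra
  moreover have "b \<oplus> a \<in> A" using c(4) assms(2) A_closed by auto
  ultimately show ?thesis using c(2,3) unfolding U_def by blast
qed

lemma unit_in_U: assumes "c \<in> K - {\<zero>}" "v c = 0" shows "c \<in> U"
proof -
  have "c = c \<oplus> \<alpha> \<otimes> \<zero>" using assms V.F_carrier al(1) by auto
  then show ?thesis using assms A_closed(1) unfolding U_def by blast
qed

text \<open>The equation \<open>x = \<alpha>\<^sup>k u\<close>, written without inverses.\<close>

definition order :: "'a \<Rightarrow> int \<Rightarrow> bool"
  where "order x k \<longleftrightarrow> (\<exists>s t :: nat. \<exists>u\<in>U. \<alpha> [^] s \<otimes> x = \<alpha> [^] t \<otimes> u \<and> k = int t - int s)"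

lemma orderI: "u \<in> U \<Longrightarrow> \<alpha> [^] s \<otimes> x = \<alpha> [^] (t :: nat) \<otimes> u \<Longrightarrow> order x (int t - int s)"
  unfolding order_def by blast

lemma orderE:
  assumes "order x k"
  obtains s t :: nat and u where "u \<in> U" "u \<in> A" "u \<in> carrier L"
    "\<alpha> [^] s \<otimes> x = \<alpha> [^] t \<otimes> u" "k = int t - int s"
  using assms U_A A_carrier unfolding order_def by blast

lemma alpha_pow_cancel:
  assumes "x \<in> carrier L" "y \<in> carrier L" "\<alpha> [^] (s :: nat) \<otimes> x = \<alpha> [^] s \<otimes> y"
  shows "x = y"
  using assms m_lcancel[OF pow_nonzero[OF al(1) alpha_nz, of s]] al(1) by auto

text \<open>With negative \<open>k\<close>, cancelling a power of \<alpha> would exhibit an element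
  of \<open>U\<close> as a multiple of \<alpha> in \<open>A\<close>.\<close>

lemma order_A_nonneg:
  assumes a: "a \<in> A" and k: "order a k"
  shows "0 \<le> k"
proof (rule ccontr)
  assume "\<not> 0 \<le> k"
  obtain s t :: nat and u where u: "u \<in> U" "u \<in> A" "u \<in> carrier L"
    "\<alpha> [^] s \<otimes> a = \<alpha> [^] t \<otimes> u" "k = int t - int s" using orderE[OF k] .
  have ac: "a \<in> carrier L" using A_carrier[OF a] .
  have st: "s = t + Suc (s - t - 1)" using u(5) \<open>\<not> 0 \<le> k\<close> by simp
  have "\<alpha> [^] s = \<alpha> [^] t \<otimes> (\<alpha> \<otimes> \<alpha> [^] (s - t - 1))"
    using st nat_pow_mult[OF al(1), of t "Suc (s - t - 1)"] al(1) by (simp add: m_comm)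
  then have "\<alpha> [^] t \<otimes> (\<alpha> \<otimes> (\<alpha> [^] (s - t - 1) \<otimes> a)) = \<alpha> [^] t \<otimes> u"
    using u(4) ac al(1) by (simp add: m_assoc)
  then have "\<alpha> \<otimes> (\<alpha> [^] (s - t - 1) \<otimes> a) = u"
    using alpha_pow_cancel ac al(1) u(3) by auto
  moreover have "\<alpha> [^] (s - t - 1) \<otimes> a \<in> A" using A_pow a A_closed by auto
  ultimately show False using U_not_multiple[OF u(1)] by metis
qed

lemma order_mult:
  assumes k: "order x k" and l: "order y l" and xy: "x \<in> carrier L" "y \<in> carrier L"
  shows "order (x \<otimes> y) (k + l)"
proof -
  obtain s t :: nat and u where u: "u \<in> U" "u \<in> A" "u \<in> carrier L"
    "\<alpha> [^] s \<otimes> x = \<alpha> [^] t \<otimes> u" "k = int t - int s" using orderE[OF k] .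
  obtain s' t' :: nat and u' where u': "u' \<in> U" "u' \<in> A" "u' \<in> carrier L"
    "\<alpha> [^] s' \<otimes> y = \<alpha> [^] t' \<otimes> u'" "l = int t' - int s'" using orderE[OF l] .
  have "\<alpha> [^] (s + s') \<otimes> (x \<otimes> y) = (\<alpha> [^] s \<otimes> x) \<otimes> (\<alpha> [^] s' \<otimes> y)"
    using xy al(1) by (simp add: nat_pow_mult[symmetric] m_ac)
  also have "\<dots> = \<alpha> [^] (t + t') \<otimes> (u \<otimes> u')"
    using u(3,4) u'(3,4) al(1) by (simp add: nat_pow_mult[symmetric] m_ac)
  finally have "order (x \<otimes> y) (int (t + t') - int (s + s'))"
    using orderI[OF U_mult[OF u(1) u'(1)]] by blast
  moreover have "int (t + t') - int (s + s') = k + l" using u(5) u'(5) by simp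
  ultimately show ?thesis by simp
qed

lemma order_alpha_pow: "order (\<alpha> [^] (i :: nat)) (int i)"
proof -
  have "\<one> \<in> U" using unit_in_U V.val_one V.F_sub by auto
  then show ?thesis using orderI[of \<one> 0 "\<alpha> [^] i" i] al(1) by simp
qed

text \<open>A unit times the \<open>v c\<close>-th power of \<open>\<pi> = \<alpha>^n\<close> gives
  \<open>c\<close>. Exponents are natural numbers, so the sign of \<open>v c\<close> decides on
  which side the power is written.\<close>

lemma order_base:
  assumes c: "c \<in> K - {\<zero>}"
  shows "order c (int n * v c)"
proof -
  have pn: "\<pi> [^] (j :: nat) \<in> K - {\<zero>}" "v (\<pi> [^] j) = int j" "\<pi> [^] j = \<alpha> [^] (n * j)" for j
    using V.F_pow_nz[OF pi(1)] V.val_pow[OF pi(1)] pi(2) al by (simp_all add: nat_pow_pow[symmetric])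
  have cc: "c \<in> carrier L" using c V.F_carrier by auto
  show ?thesis
  proof (cases "0 \<le> v c")
    case True
    let ?j = "nat (v c)" let ?u = "c \<otimes> inv (\<pi> [^] ?j)"
    have i: "inv (\<pi> [^] ?j) \<in> K - {\<zero>}" "v (inv (\<pi> [^] ?j)) = - int ?j" "inv (\<pi> [^] ?j) \<otimes> \<pi> [^] ?j = \<one>"
      using V.F_inv_nz[OF pn(1)] V.val_inv[OF pn(1)] pn(2) subfield_m_inv(3)[OF V.F pn(1)] by auto
    have "?u \<in> U" using unit_in_U V.F_mult_nz[OF c i(1)] V.val_mult[OF c i(1)] i(2) True by simp
    moreover have "\<alpha> [^] (0 :: nat) \<otimes> c = \<alpha> [^] (n * ?j) \<otimes> ?u"
    proof -
      have "a \<otimes> (c \<otimes> b) = c \<otimes> (b \<otimes> a)" if "a \<in> carrier L" "b \<in> carrier L" for a b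
        using that cc by algebra
      then show ?thesis using pn(3)[of ?j] i V.F_carrier cc al(1) by simp
    qed
    ultimately have "order c (int (n * ?j) - int 0)" by (rule orderI)
    then show ?thesis using True by simp
  next
    case False
    let ?j = "nat (- v c)" let ?u = "c \<otimes> \<pi> [^] ?j"
    have "v ?u = 0" using V.val_mult[OF c pn(1)[of ?j]] pn(2)[of ?j] False by simp
    then have "?u \<in> U" using unit_in_U[OF V.F_mult_nz[OF c pn(1)]] by blast
    moreover have "\<alpha> [^] (n * ?j) \<otimes> c = \<alpha> [^] (0 :: nat) \<otimes> ?u"
      using pn(3)[of ?j] cc al(1) by (simp add: m_comm)
    ultimately have "order c (int 0 - int (n * ?j))" by (rule orderI)
    then show ?thesis using False by simp
  qed
qed

lemma order_add_less:
  assumes k: "order x k" and l: "order y l" and xy: "x \<in> carrier L" "y \<in> carrier L" and "k < l"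
  shows "order (x \<oplus> y) k"
proof -
  obtain s t :: nat and u where u: "u \<in> U" "u \<in> A" "u \<in> carrier L"
    "\<alpha> [^] s \<otimes> x = \<alpha> [^] t \<otimes> u" "k = int t - int s" using orderE[OF k] .
  obtain s' t' :: nat and u' where u': "u' \<in> U" "u' \<in> A" "u' \<in> carrier L"
    "\<alpha> [^] s' \<otimes> y = \<alpha> [^] t' \<otimes> u'" "l = int t' - int s'" using orderE[OF l] .
  \<comment> \<open>Here \<open>Suc d = l - k\<close>: over a common power of \<alpha> the second
    summand keeps at least one factor \<alpha>, which \<open>U_add\<close> absorbs.\<close>
  define d where "d = t' + s - (t + s') - 1"
  have d: "t' + s = (t + s') + Suc d" using \<open>k < l\<close> u(5) u'(5) by (simp add: d_def)
  have "\<alpha> [^] (s + s') \<otimes> (x \<oplus> y) = \<alpha> [^] s' \<otimes> (\<alpha> [^] s \<otimes> x) \<oplus> \<alpha> [^] s \<otimes> (\<alpha> [^] s' \<otimes> y)"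
    using xy al(1) by (simp add: nat_pow_mult[symmetric] m_ac r_distr)
  also have "\<dots> = \<alpha> [^] (t + s') \<otimes> u \<oplus> \<alpha> [^] (t' + s) \<otimes> u'"
    using u(3,4) u'(3,4) al(1) by (simp add: nat_pow_mult[symmetric] m_ac)
  also have "\<dots> = \<alpha> [^] (t + s') \<otimes> u \<oplus> \<alpha> [^] (t + s') \<otimes> (\<alpha> \<otimes> (\<alpha> [^] d \<otimes> u'))"
    unfolding d using u(3) u'(3) al(1) by (simp add: nat_pow_mult[symmetric] m_ac)
  also have "\<dots> = \<alpha> [^] (t + s') \<otimes> (u \<oplus> \<alpha> \<otimes> (\<alpha> [^] d \<otimes> u'))"
    using u(3) u'(3) al(1) by (simp add: r_distr)
  finally have "order (x \<oplus> y) (int (t + s') - int (s + s'))"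
    using orderI[OF U_add[OF u(1) A_closed(4)[OF A_pow u'(2)]]] by metis
  then show ?thesis using u(5) by simp
qed

text \<open>For \<open>k < l\<close>, equating the two representations of \<open>x\<close> would
  give the element \<open>u'\<close> of \<open>A\<close> the negative order
  \<open>k - l\<close>.\<close>

lemma order_unique:
  assumes k: "order x k" and l: "order x l" and x: "x \<in> carrier L"
  shows "k = l"
proof -
  have False if kl: "k < l" "order x k" "order x l" for k l
  proof -
    obtain s t :: nat and u where u: "u \<in> U" "u \<in> A" "u \<in> carrier L"
      "\<alpha> [^] s \<otimes> x = \<alpha> [^] t \<otimes> u" "k = int t - int s" using orderE[OF kl(2)] .
    obtain s' t' :: nat and u' where u': "u' \<in> U" "u' \<in> A" "u' \<in> carrier L"
      "\<alpha> [^] s' \<otimes> x = \<alpha> [^] t' \<otimes> u'" "l = int t' - int s'" using orderE[OF kl(3)] .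
    have "\<alpha> [^] (t' + s) \<otimes> u' = \<alpha> [^] s \<otimes> (\<alpha> [^] s' \<otimes> x)"
      using u'(3,4) al(1) by (simp add: nat_pow_mult[symmetric] m_ac)
    also have "\<dots> = \<alpha> [^] s' \<otimes> (\<alpha> [^] s \<otimes> x)" using x al(1) by (simp add: m_lcomm)
    also have "\<dots> = \<alpha> [^] (t + s') \<otimes> u"
      using u(3,4) al(1) by (simp add: nat_pow_mult[symmetric] m_ac)
    finally have "order u' (int (t + s') - int (t' + s))"
      by (rule orderI[OF u(1)])
    then have "0 \<le> int (t + s') - int (t' + s)" by (rule order_A_nonneg[OF u'(2)])
    then show False using kl(1) u(5) u'(5) by simp
  qed
  then show ?thesis using k l by (metis linorder_neqE)
qed

text \<open>The terms of the polynomial have exponents below \<open>n\<close>, so their orders are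
  distinct modulo \<open>n\<close>. The smallest order therefore occurs once, and no cancellation is
  possible.\<close>

lemma order_eval:
  assumes "set p \<subseteq> K" "length p \<le> n" "eval p \<alpha> \<noteq> \<zero>"
  shows "\<exists>i<length p. \<exists>c\<in>K - {\<zero>}. order (eval p \<alpha>) (int n * v c + int i)"
  using assms
proof (induction p)
  case (Cons a p)
  then have a: "a \<in> K" "a \<in> carrier L" and p: "set p \<subseteq> K" "set p \<subseteq> carrier L" "length p < n"
    using V.F_carrier by auto
  let ?t = "a \<otimes> \<alpha> [^] length p"
  have e: "eval p \<alpha> \<in> carrier L" using eval_in_carrier[OF p(2) al(1)] .
  have tc: "?t \<in> carrier L" using a al by simp
  have ev: "eval (a # p) \<alpha> = ?t \<oplus> eval p \<alpha>" by simp
  have t: "order ?t (int n * v a + int (length p))" if "a \<noteq> \<zero>"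
    using order_mult[OF order_base order_alpha_pow, of a "length p"] a al that by simp
  show ?case
  proof (cases "eval p \<alpha> = \<zero>")
    case True
    then have "a \<noteq> \<zero>" using Cons.prems(3) al by auto
    then show ?thesis using True t tc a by (auto simp del: eval.simps simp: ev)
  next
    case False
    then obtain i c where i: "i < length p" "c \<in> K - {\<zero>}" "order (eval p \<alpha>) (int n * v c + int i)"
      using Cons.IH[OF p(1)] p(3) by auto
    show ?thesis
    proof (cases "a = \<zero>")
      case True
      then have "eval (a # p) \<alpha> = eval p \<alpha>" using e al by simp
      then show ?thesis using i by (auto simp del: eval.simps intro: less_SucI)
    next
      case a0: False
      have "int n * v a + int (length p) \<noteq> int n * v c + int i"
      proof
        assume "int n * v a + int (length p) = int n * v c + int i"
        then have "(int n * v a + int (length p)) mod int n = (int n * v c + int i) mod int n" by simp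
        then show False using i(1) p(3) by simp
      qed
      then consider "int n * v a + int (length p) < int n * v c + int i"
        | "int n * v c + int i < int n * v a + int (length p)" by linarith
      then show ?thesis
      proof cases
        case 1
        then show ?thesis
          using order_add_less[OF t[OF a0] i(3) tc e] a a0 unfolding ev by auto
      next
        case 2
        then have "order (?t \<oplus> eval p \<alpha>) (int n * v c + int i)"
          using order_add_less[OF i(3) t[OF a0] e tc] a_comm[OF e tc] by simp
        then show ?thesis using i unfolding ev by (auto intro: less_SucI)
      qed
    qed
  qed
qed simp

lemma order_exists:
  assumes "x \<in> F - {\<zero>}"
  obtains i c where "i < n" "c \<in> K - {\<zero>}" "order x (int n * v c + int i)"
proof -
  have "F = (\<lambda>p. eval p \<alpha>) ` {p \<in> carrier (K[X]). length p \<le> n}"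
    using Span_exp_base[OF V.F al(1) alg[OF al(1)]] Span_eq_eval_img[OF V.F al(1)] degree_Irr by simp
  then obtain p where p: "p \<in> carrier (K[X])" "length p \<le> n" "x = eval p \<alpha>" using assms by auto
  then have "set p \<subseteq> K" unfolding sym[OF univ_poly_carrier] polynomial_def by auto
  then show ?thesis using order_eval[OF _ p(2)] p assms that by (metis DiffD2 order_less_le_trans singletonI)
qed

section \<open>The unique extension of the valuation to the totally ramified field\<close>

lemma F_carrier: "x \<in> F \<Longrightarrow> x \<in> carrier L"
  using subfieldE(3)[OF F_finite(5)] by auto

definition w :: "'a \<Rightarrow> rat"
  where "w x = of_int (THE k. order x k) / of_nat n"

lemma w_eq: "order x k \<Longrightarrow> x \<in> carrier L \<Longrightarrow> w x = of_int k / of_nat n"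
  unfolding w_def using order_unique by (subst the_equality) auto

lemma field_val_w: "field_val L F w"
proof (rule field_val.intro[OF field_axioms field_val_axioms.intro])
  show "subfield F L" using F_finite(5) .
next
  fix x y assume xy: "x \<in> F - {\<zero>}" "y \<in> F - {\<zero>}"
  then have c: "x \<in> carrier L" "y \<in> carrier L" using F_carrier by auto
  obtain k l where k: "order x k" "order y l" using order_exists xy by metis
  show "w (x \<otimes> y) = w x + w y"
    using w_eq[OF order_mult[OF k c]] w_eq[OF k(1)] w_eq[OF k(2)] c by (simp add: add_divide_distrib)
  assume nz: "x \<oplus> y \<noteq> \<zero>"
  have s: "x \<oplus> y \<in> F - {\<zero>}" "x \<oplus> y \<in> carrier L"
    using nz xy c subringE(7)[OF subfieldE(1)[OF F_finite(5)]] by auto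
  then obtain m where m: "order (x \<oplus> y) m" using order_exists by metis
  have *: "k \<le> m" if xy: "x \<in> carrier L" "y \<in> carrier L" "order x k" "order y l" "k \<le> l" "order (x \<oplus> y) m" for x y k l m
  proof (cases "k < l")
    case True
    then show ?thesis using order_unique[OF that(6) order_add_less[OF that(3,4,1,2)]] xy by simp
  next
    case False
    \<comment> \<open>For equal orders the sum of \<open>u\<close> and \<open>u'\<close> may leave
      \<open>U\<close>, but it stays in \<open>A\<close>, where orders are nonnegative.\<close>
    obtain s t :: nat and u where u: "u \<in> U" "u \<in> A" "u \<in> carrier L"
      "\<alpha> [^] s \<otimes> x = \<alpha> [^] t \<otimes> u" "k = int t - int s" using orderE[OF xy(3)] .
    obtain s' t' :: nat and u' where u': "u' \<in> U" "u' \<in> A" "u' \<in> carrier L"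
      "\<alpha> [^] s' \<otimes> y = \<alpha> [^] t' \<otimes> u'" "l = int t' - int s'" using orderE[OF xy(4)] .
    have tt: "t' + s = t + s'" using False xy(5) u(5) u'(5) by simp
    have eq: "\<alpha> [^] (s + s') \<otimes> (x \<oplus> y) = \<alpha> [^] s' \<otimes> (\<alpha> [^] s \<otimes> x) \<oplus> \<alpha> [^] s \<otimes> (\<alpha> [^] s' \<otimes> y)"
      using xy al(1) by (simp add: nat_pow_mult[symmetric] m_ac r_distr)
    also have "\<dots> = \<alpha> [^] (t + s') \<otimes> u \<oplus> \<alpha> [^] (t' + s) \<otimes> u'"
      using u(3,4) u'(3,4) al(1) by (simp add: nat_pow_mult[symmetric] m_ac)
    also have "\<dots> = \<alpha> [^] (t + s') \<otimes> (u \<oplus> u')"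
      using u(3) u'(3) al(1) unfolding tt by (simp add: r_distr)
    finally have e: "\<alpha> [^] (s + s') \<otimes> (x \<oplus> y) = \<alpha> [^] (t + s') \<otimes> (u \<oplus> u')" .
    obtain a b :: nat and z where z: "z \<in> U" "z \<in> A" "z \<in> carrier L"
      "\<alpha> [^] a \<otimes> (x \<oplus> y) = \<alpha> [^] b \<otimes> z" "m = int b - int a" using orderE[OF xy(6)] .
    have "\<alpha> [^] (a + (t + s')) \<otimes> (u \<oplus> u') = \<alpha> [^] a \<otimes> (\<alpha> [^] (s + s') \<otimes> (x \<oplus> y))"
      unfolding e using u(3) u'(3) al(1) by (simp add: nat_pow_mult[symmetric] m_assoc)
    also have "\<dots> = \<alpha> [^] (s + s') \<otimes> (\<alpha> [^] a \<otimes> (x \<oplus> y))" using xy al(1) by (simp add: m_lcomm)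
    also have "\<dots> = \<alpha> [^] (s + s' + b) \<otimes> z"
      unfolding z(4) using z(3) al(1) by (simp add: nat_pow_mult[symmetric] m_assoc)
    finally have "order (u \<oplus> u') (int (s + s' + b) - int (a + (t + s')))"
      by (rule orderI[OF z(1)])
    then have "0 \<le> int (s + s' + b) - int (a + (t + s'))"
      by (rule order_A_nonneg[OF A_closed(5)[OF u(2) u'(2)]])
    then show ?thesis using u(5) z(5) by simp
  qed
  have "min k l \<le> m"
    using *[OF c k _ m] *[OF c(2,1) k(2,1) _, of m] m a_comm[OF c] by (cases "k \<le> l") auto
  then have "of_int (min k l) / of_nat n \<le> (of_int m / of_nat n :: rat)"
    by (intro divide_right_mono) auto
  moreover have "of_int (min k l) / of_nat n = min (of_int k / of_nat n) (of_int l / of_nat n :: rat)"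
    using n by (auto simp: min_def divide_right_mono divide_le_cancel)
  ultimately show "min (w x) (w y) \<le> w (x \<oplus> y)"
    using w_eq[OF m s(2)] w_eq[OF k(1)] w_eq[OF k(2)] c by simp
qed

lemma extension_w: "extension_on F w"
  unfolding extension_on_def using field_val_w w_eq[OF order_base] V.F_carrier n by auto

text \<open>The relation \<open>\<alpha>^n = \<pi>\<close> forces the value \<open>1 / n\<close> on
  \<alpha>. Hence \<open>A\<close> lies in the valuation ring of \<open>w'\<close> and the elements
  of \<open>U\<close> have value 0, so the representation by \<open>order\<close> determines
  \<open>w'\<close>.\<close>

lemma extension_unique:
  assumes w': "extension_on F w'" and x: "x \<in> F - {\<zero>}"
  shows "w' x = w x"
proof -
  interpret W: field_val L F w' using w' by (simp add: extension_on_def)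
  have ext: "\<And>c. c \<in> K - {\<zero>} \<Longrightarrow> w' c = of_int (v c)" using w' by (simp add: extension_on_def)
  have aF: "\<alpha> \<in> F - {\<zero>}" using F_finite(3) alpha_nz by simp
  have "of_nat n * w' \<alpha> = 1" using W.val_pow[OF aF, of n] al(2) ext[OF pi(1)] pi(2) by simp
  then have wa: "w' \<alpha> = 1 / of_nat n" using n by (simp add: field_simps)
  have O: "V.ge 0 \<subseteq> W.ge 0"
  proof
    fix c assume c: "c \<in> V.ge 0"
    then have "0 \<le> w' c" if "c \<noteq> \<zero>"
      using ext[of c] that V.geD[OF c] by simp
    then show "c \<in> W.ge 0" using V.geD(1)[OF c] F_finite(2) W.geI by auto
  qed
  have "\<alpha> \<in> W.ge 0" using aF wa by (auto simp: W.ge_def)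
  then have A: "A \<subseteq> W.ge 0" using simple_extension_subring_incl[OF W.ge0_subring O] by simp
  have u0: "u \<in> F - {\<zero>} \<and> w' u = 0" if "u \<in> U" for u
  proof -
    obtain c a where c: "u = c \<oplus> \<alpha> \<otimes> a" "c \<in> K - {\<zero>}" "v c = 0" "a \<in> A"
      using \<open>u \<in> U\<close> by (auto simp: U_def)
    have car: "c \<in> carrier L" "a \<in> carrier L" using c V.F_carrier A_carrier by auto
    have cF: "c \<in> F - {\<zero>}" "w' c = 0" using c F_finite(2) ext by auto
    have "u \<in> F" using \<open>u \<in> U\<close> U_A A_in_F by auto
    moreover have "\<alpha> \<in> W.gt 0" using aF wa n by (auto simp: W.gt_def)
    then have "\<alpha> \<otimes> a \<in> W.gt 0" using A c(4) W.gt0_mult by auto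
    moreover have "u \<ominus> c = \<alpha> \<otimes> a" unfolding c(1) using car al(1) by algebra
    ultimately show ?thesis using W.val_close[OF cF(1), of u] cF(2) by simp
  qed
  obtain k where k: "order x k" using order_exists[OF x] by metis
  obtain s t :: nat and u where u: "u \<in> U" "u \<in> A" "u \<in> carrier L"
    "\<alpha> [^] s \<otimes> x = \<alpha> [^] t \<otimes> u" "k = int t - int s" using orderE[OF k] .
  have "w' (\<alpha> [^] s \<otimes> x) = of_nat s * w' \<alpha> + w' x"
    using W.val_mult[OF W.F_pow_nz[OF aF] x] W.val_pow[OF aF] by simp
  moreover have "w' (\<alpha> [^] t \<otimes> u) = of_nat t * w' \<alpha>"
    using W.val_mult[OF W.F_pow_nz[OF aF], of u t] W.val_pow[OF aF] u0[OF u(1)] by simp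
  ultimately have "w' x = (of_nat t - of_nat s) * w' \<alpha>" using u(4) by (simp add: algebra_simps)
  then show ?thesis using w_eq[OF k] x F_carrier wa u(5) by auto
qed

text \<open>An element of value 0 lies in \<open>U\<close>, and the definition of \<open>U\<close>
  displays a representative of its residue in \<open>K\<close>.\<close>

lemma residue_trivial:
  assumes x: "x \<in> F" "x \<noteq> \<zero> \<Longrightarrow> 0 \<le> w x"
  obtains c where "c \<in> V.ge 0" "x \<ominus> c = \<zero> \<or> 0 < w (x \<ominus> c)"
proof (cases "x = \<zero> \<or> 0 < w x")
  case True
  then show ?thesis using that[of \<zero>] V.zero_ge x F_carrier by (auto simp: minus_eq)
next
  case False
  then have "w x = 0" "x \<in> F - {\<zero>}" using x by auto
  then obtain k where k: "order x k" using order_exists by metis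
  have xc: "x \<in> carrier L" using x F_carrier by auto
  have "k = 0" using w_eq[OF k xc] \<open>w x = 0\<close> n by simp
  obtain s t :: nat and u where u: "u \<in> U" "u \<in> A" "u \<in> carrier L"
    "\<alpha> [^] s \<otimes> x = \<alpha> [^] t \<otimes> u" "k = int t - int s" using orderE[OF k] .
  have "x = u" using alpha_pow_cancel[OF xc u(3), of s] u(4,5) \<open>k = 0\<close> by simp
  then obtain c a where c: "x = c \<oplus> \<alpha> \<otimes> a" "c \<in> K - {\<zero>}" "v c = 0" "a \<in> A"
    using u(1) by (auto simp: U_def)
  have car: "c \<in> carrier L" "a \<in> carrier L" using c V.F_carrier A_carrier by auto
  have e: "x \<ominus> c = \<alpha> \<otimes> a" unfolding c(1) using car al(1) by algebra
  have "\<alpha> \<otimes> a = \<zero> \<or> 0 < w (\<alpha> \<otimes> a)"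
  proof (cases "a = \<zero>")
    case False
    interpret W: field_val L F w by (rule field_val_w)
    have aF: "a \<in> F - {\<zero>}" "\<alpha> \<in> F - {\<zero>}" using c(4) A_in_F False F_finite(3) alpha_nz by auto
    obtain l where l: "order a l" using order_exists[OF aF(1)] by metis
    have "w a \<ge> 0" using w_eq[OF l car(2)] order_A_nonneg[OF c(4) l] by simp
    moreover have "w \<alpha> = 1 / of_nat n" using w_eq[OF order_alpha_pow[of 1]] al(1) by simp
    ultimately have "w (\<alpha> \<otimes> a) > 0" using W.val_mult[OF aF(2,1)] n by (simp add: add_pos_nonneg)
    then show ?thesis ..
  qed (use al in simp)
  then show ?thesis using that[of c] c e by (auto simp: V.ge_def)
qed

end

section \<open>Residue fields\<close>

context field_val
begin

abbreviation "\<kappa> \<equiv> residue_field (R\<lparr>carrier := F\<rparr>) w"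

text \<open>This hides the cosets of the quotient ring: later arguments see only a surjective
  homomorphism with kernel \<open>gt 0\<close> onto a field.\<close>

lemma residue_hom:
  obtains \<theta> where "ring_hom_ring (R\<lparr>carrier := ge 0\<rparr>) \<kappa> \<theta>" "field \<kappa>"
    "\<theta> ` ge 0 = carrier \<kappa>" "\<And>x. x \<in> ge 0 \<Longrightarrow> \<theta> x = \<zero>\<^bsub>\<kappa>\<^esub> \<longleftrightarrow> x \<in> gt 0"
proof -
  let ?O = "R\<lparr>carrier := ge 0\<rparr>"
  have O: "valuation_ring (R\<lparr>carrier := F\<rparr>) w = ge 0" "valuation_ideal (R\<lparr>carrier := F\<rparr>) w = gt 0"
    by (auto simp: valuation_ring_def valuation_ideal_def ge_def gt_def)
  have k: "\<kappa> = ?O Quot gt 0" unfolding residue_field_def O by simp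
  note sub = subringE[OF ge0_subring]
  interpret O: cring ?O
    using subcring_iff[OF sub(1)] subcringI'[OF ge0_subring] by simp
  have sg: "gt 0 \<subseteq> ge 0" using gt_ge by auto
  have minus_O: "\<ominus>\<^bsub>?O\<^esub> x = \<ominus> x" if "x \<in> ge 0" for x
    using O.minus_equality[of "\<ominus> x" x] that sub l_neg by auto
  interpret I: ideal "gt 0" ?O
  proof (rule idealI[OF O.ring_axioms])
    show "subgroup (gt 0) (add_monoid ?O)"
    proof (rule O.add.subgroupI)
      show "gt 0 \<noteq> {}" using zero_gt by auto
      show "\<ominus>\<^bsub>?O\<^esub> x \<in> gt 0" if "x \<in> gt 0" for x
        using minus_O[of x] that gt_ge gt_neg by metis
    qed (use sg gt_add in auto)
  qed (use gt0_mult in auto)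
  have hom: "ring_hom_ring ?O \<kappa> ((+>\<^bsub>?O\<^esub>) (gt 0))" unfolding k by (rule I.rcos_ring_hom_ring)
  have f: "field \<kappa>"
    using valuation.residue_field_is_field valuation_iff_field_val[OF F] field_val_axioms by blast
  have "(+>\<^bsub>?O\<^esub>) (gt 0) ` ge 0 = carrier \<kappa>"
    unfolding k FactRing_def A_RCOSETS_def' by auto
  moreover have "gt 0 +>\<^bsub>?O\<^esub> x = \<zero>\<^bsub>\<kappa>\<^esub> \<longleftrightarrow> x \<in> gt 0" if "x \<in> ge 0" for x
    unfolding k using that I.rcos_const_imp_mem[of x] I.a_rcos_const[of x] by (auto simp: FactRing_def)
  ultimately show ?thesis using that[OF hom f] by blast
qed

text \<open>Polynomials over the residue field are lifted coefficient by coefficient. The condition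
  \<open>hd p \<notin> gt 0\<close> keeps the leading coefficient nonzero after reduction.\<close>

lemma residue_algebraically_closed:
  "algebraically_closed \<kappa> \<longleftrightarrow>
    (\<forall>p. set p \<subseteq> ge 0 \<and> length p \<ge> 2 \<and> hd p \<notin> gt 0 \<longrightarrow> (\<exists>c\<in>ge 0. eval p c \<in> gt 0))"
proof -
  obtain \<theta> where hom: "ring_hom_ring (R\<lparr>carrier := ge 0\<rparr>) \<kappa> \<theta>" and f: "field \<kappa>"
    and img: "\<theta> ` ge 0 = carrier \<kappa>" and ker: "\<And>x. x \<in> ge 0 \<Longrightarrow> \<theta> x = \<zero>\<^bsub>\<kappa>\<^esub> \<longleftrightarrow> x \<in> gt 0"
    by (rule residue_hom) blast
  interpret k: field \<kappa> by (rule f)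
  interpret h: ring_hom_ring "R\<lparr>carrier := ge 0\<rparr>" \<kappa> \<theta> by (rule hom)
  have ev: "\<theta> (eval p c) = k.eval (map \<theta> p) (\<theta> c)" if "set p \<subseteq> ge 0" "c \<in> ge 0" for p c
    using h.eval_hom'[of c p] that eval_consistent[OF ge0_subring] by simp
  show ?thesis
  proof (intro iffI allI impI)
    fix p assume ac: "algebraically_closed \<kappa>"
      and p: "set p \<subseteq> ge 0 \<and> length p \<ge> 2 \<and> hd p \<notin> gt 0"
    have "hd p \<in> ge 0" using p by (cases p) auto
    then have "hd (map \<theta> p) \<noteq> \<zero>\<^bsub>\<kappa>\<^esub>" using p ker by (cases p) auto
    moreover have "set (map \<theta> p) \<subseteq> carrier \<kappa>" using p img by auto
    ultimately obtain y where y: "y \<in> carrier \<kappa>" "k.eval (map \<theta> p) y = \<zero>\<^bsub>\<kappa>\<^esub>"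
      using algebraically_closed.ex_root[OF ac, of "map \<theta> p"] p by auto
    then obtain c where c: "c \<in> ge 0" "y = \<theta> c" using img by (metis imageE)
    then show "\<exists>c\<in>ge 0. eval p c \<in> gt 0"
      using ev[of p c] ker[OF eval_ge0[of p c]] y p by auto
  next
    assume *: "\<forall>p. set p \<subseteq> ge 0 \<and> length p \<ge> 2 \<and> hd p \<notin> gt 0 \<longrightarrow> (\<exists>c\<in>ge 0. eval p c \<in> gt 0)"
    show "algebraically_closed \<kappa>"
    proof (rule k.algebraically_closedI)
      fix p assume p: "p \<in> carrier (poly_ring \<kappa>)" "degree p > 1"
      then have ps: "set p \<subseteq> \<theta> ` ge 0" "hd p \<noteq> \<zero>\<^bsub>\<kappa>\<^esub>"
        unfolding sym[OF univ_poly_carrier] polynomial_def img by auto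
      define q where "q = map (inv_into (ge 0) \<theta>) p"
      have q: "set q \<subseteq> ge 0" "map \<theta> q = p"
        using ps(1) by (auto simp: q_def inv_into_into f_inv_into_f intro!: map_idI)
      have l: "length q \<ge> 2" using p by (simp add: q_def)
      then have "hd q \<in> ge 0" "\<theta> (hd q) = hd p" using q by (cases q; auto)+
      then have "hd q \<notin> gt 0" using ker ps(2) by auto
      then obtain c where c: "c \<in> ge 0" "eval q c \<in> gt 0" using * q l by blast
      then have "k.eval p (\<theta> c) = \<zero>\<^bsub>\<kappa>\<^esub>"
        using ev[OF q(1) c(1)] q(2) ker[OF gt_ge[OF c(2)]] by simp
      then show "\<exists>x\<in>carrier \<kappa>. k.eval p x = \<zero>\<^bsub>\<kappa>\<^esub>" using c(1) img by auto
    qed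
  qed
qed

lemma residue_characteristic:
  "characteristic \<kappa> = 0 \<longleftrightarrow> (\<forall>n :: nat. n > 0 \<longrightarrow> [n] \<cdot> \<one> \<notin> gt 0)"
proof -
  obtain \<theta> where hom: "ring_hom_ring (R\<lparr>carrier := ge 0\<rparr>) \<kappa> \<theta>" and f: "field \<kappa>"
    and img: "\<theta> ` ge 0 = carrier \<kappa>" and ker: "\<And>x. x \<in> ge 0 \<Longrightarrow> \<theta> x = \<zero>\<^bsub>\<kappa>\<^esub> \<longleftrightarrow> x \<in> gt 0"
    by (rule residue_hom) blast
  interpret k: field \<kappa> by (rule f)
  interpret h: ring_hom_ring "R\<lparr>carrier := ge 0\<rparr>" \<kappa> \<theta> by (rule hom)
  have "\<theta> ([n] \<cdot> \<one>) = [n] \<cdot>\<^bsub>\<kappa>\<^esub> \<one>\<^bsub>\<kappa>\<^esub>" for n :: nat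
  proof (induction n)
    case 0
    then show ?case using h.hom_zero by simp
  next
    case (Suc n)
    then show ?case using h.hom_add[of "[n] \<cdot> \<one>" \<one>] h.hom_one nat_ge0[of n] one_ge by simp
  qed
  then show ?thesis
    unfolding characteristic_def Gcd_0_iff using ker[OF nat_ge0] by auto
qed

text \<open>At an element of negative value the leading term would have strictly smaller value than
  all the others together, so the sum could not vanish.\<close>

lemma integral_root:
  assumes p: "set p \<subseteq> ge 0" "p \<noteq> []" "hd p \<noteq> \<zero>" "w (hd p) = 0" and x: "x \<in> F" "eval p x = \<zero>"
  shows "x \<in> ge 0"
proof (rule ccontr)
  assume "x \<notin> ge 0"
  then have xw: "x \<in> F - {\<zero>}" "w x < 0" using x by (auto simp: ge_def)
  \<comment> \<open>As \<open>w x\<close> is negative, the highest exponent gives the lowest bound.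
    The empty list fits in because zero lies in every \<open>ge\<close>.\<close>
  have bound: "eval q x \<in> ge ((of_nat (length q) - 1) * w x)" if "set q \<subseteq> ge 0" for q
    using that
  proof (induction q)
    case (Cons b q)
    have 1: "x [^] length q \<in> ge (of_nat (length q) * w x)"
      using F_pow_nz[OF xw(1)] val_pow[OF xw(1)] by (auto simp: ge_def)
    have "b \<otimes> x [^] length q \<in> ge (of_nat (length q) * w x)"
      using ge_mult[OF _ 1, of b 0] Cons.prems by simp
    moreover have "eval q x \<in> ge (of_nat (length q) * w x)"
      using ge_mono[of "eval q x" "(of_nat (length q) - 1) * w x"] Cons xw(2)
      by (simp add: algebra_simps)
    ultimately show ?case using ge_add by simp
  qed (simp add: zero_ge)
  obtain a q where aq: "p = a # q" using p(2) by (cases p) auto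
  let ?t = "a \<otimes> x [^] length q"
  have a: "a \<in> F - {\<zero>}" "w a = 0" "set q \<subseteq> ge 0" using p aq geD(1) by auto
  have t: "?t \<in> F - {\<zero>}" "w ?t = of_nat (length q) * w x"
    using F_mult_nz[OF a(1) F_pow_nz[OF xw(1)]] val_mult[OF a(1) F_pow_nz[OF xw(1)]] val_pow[OF xw(1)] a(2)
    by auto
  have e: "eval q x \<in> gt (of_nat (length q) * w x)"
    using ge_gt[OF bound[OF a(3)]] xw(2) by (simp add: algebra_simps)
  have "?t \<oplus> eval q x = \<zero>" using x(2) aq by simp
  then have "\<ominus> (eval q x) = ?t" using minus_equality t e gtD(1) F_carrier by auto
  then have "?t \<in> gt (of_nat (length q) * w x)" using gt_neg[OF e] by simp
  then show False using gtD(2)[of ?t] t by auto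
qed

end

text \<open>Otherwise \<open>X^n - 1\<close> would have \<open>n + 1\<close> roots.\<close>

lemma (in field) ex_primitive_power:
  assumes z: "\<zeta> \<in> carrier R" "\<And>i :: nat. \<zeta> [^] i = \<one> \<longleftrightarrow> n dvd i" and n: "n > 0"
    and x: "x \<in> carrier R" "x [^] n = \<one>"
  obtains k where "k < n" "x = \<zeta> [^] k"
proof -
  have "x \<in> (\<lambda>i. \<zeta> [^] i) ` {..<n}"
  proof (rule ccontr)
    assume nin: "x \<notin> (\<lambda>i. \<zeta> [^] i) ` {..<n}"
    note X = X_pow_minus_props[OF n one_closed]
    let ?S = "insert x ((\<lambda>i. \<zeta> [^] i) ` {..<n})"
    have r: "y [^] n = \<one>" "y \<in> carrier R" if "y \<in> ?S" for y
    proof -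
      show "y \<in> carrier R" using that x z by auto
      show "y [^] n = \<one>"
      proof (cases "y = x")
        case False
        then obtain i :: nat where "y = \<zeta> [^] i" using \<open>y \<in> ?S\<close> by auto
        then show ?thesis using z(1) z(2)[of "i * n"] by (simp add: nat_pow_pow)
      qed (use x in simp)
    qed
    have "card ?S < length (X_pow_minus n \<one>)"
    proof (rule card_roots_le_degree)
      show "eval (X_pow_minus n \<one>) y = \<zero>" if "y \<in> ?S" for y
        using r[OF that] X(4) by (simp add: minus_eq r_neg)
      show "X_pow_minus n \<one> \<noteq> []" using X(1) by auto
    qed (use r X in auto)
    moreover have "card ?S = Suc n" using nin card_image[OF pow_inj_on_order[OF z]] by simp
    ultimately show False using X(1) by simp
  qed
  then show ?thesis using that by auto
qed

text \<open>Some \<open>x \<noteq> \<one>\<close> would have order \<open>p\<close>. Its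
  \<open>p\<close> distinct powers, including 1 because \<open>p\<close> is zero in the field, would
  all be roots of \<open>1 + X + ... + X^(p-1)\<close>, which has degree
  \<open>p - 1\<close>.\<close>

lemma (in field) root_of_unity_char_p:
  assumes p: "Factorial_Ring.prime p" "[p] \<cdot> \<one> = \<zero>" and x: "x \<in> carrier R" "x [^] (p :: nat) = \<one>"
  shows "x = \<one>"
proof (rule ccontr)
  assume x1: "x \<noteq> \<one>"
  note ord = prime_pow_eq_one_iff[OF x(1) x1 p(1) x(2)]
  let ?S = "(\<lambda>i :: nat. x [^] i) ` {..<p}"
  have p0: "p > 0" using prime_gt_0_nat[OF p(1)] .
  have "card ?S < length (replicate p \<one>)"
  proof (rule card_roots_le_degree)
    show "eval (replicate p \<one>) y = \<zero>" if y: "y \<in> ?S" for y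
    proof (cases "y = \<one>")
      case True
      then show ?thesis using eval_replicate_one p(2) by simp
    next
      case False
      have yc: "y \<in> carrier R" using y x by auto
      obtain i :: nat where "y = x [^] i" using y by auto
      then have "y [^] p = \<one>" using x ord[of "i * p"] by (simp add: nat_pow_pow)
      then have e: "(y \<ominus> \<one>) \<otimes> eval (replicate p \<one>) y = \<zero>"
        using geometric_eval[OF yc] by (simp add: minus_eq r_neg)
      moreover have "eval (replicate p \<one>) y \<in> carrier R" using eval_in_carrier[OF _ yc, of "replicate p \<one>"] by (simp add: set_replicate_conv_if)
      ultimately show ?thesis using integral[OF e] yc False by simp
    qed
    show "hd (replicate p \<one>) \<noteq> \<zero>" using p0 by (cases p) auto
  qed (use x p0 in auto)
  then show False using card_image[OF pow_inj_on_order[OF x(1) ord]] by simp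
qed

section \<open>Valuations on quasi-finite fields\<close>

context valued_closure
begin

lemma uniformizer_rootI:
  "\<lbrakk> \<pi> \<in> K - {\<zero>}; v \<pi> = 1; n > 0; \<alpha> \<in> carrier L; \<alpha> [^] n = \<pi> \<rbrakk> \<Longrightarrow> uniformizer_root L K v \<pi> \<alpha> n"
  by (intro uniformizer_root.intro uniformizer_root_axioms.intro valued_closure_axioms)

lemma ex_uniformizer: obtains \<pi> where "\<pi> \<in> K - {\<zero>}" "v \<pi> = 1"
proof -
  have "1 \<in> v ` (K - {\<zero>})" unfolding value_group by simp
  then show ?thesis using that by (metis imageE)
qed

lemma finite_subfield_dimension:
  assumes "finite_subfield F"
  obtains n where "n > 0" "dimension n K F"
proof -
  obtain n where n: "dimension n K F" using assms by (auto simp: finite_subfield_def)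
  have "n \<noteq> 0"
  proof
    assume "n = 0"
    then have "F = {\<zero>}" using dimension_zero[OF V.F] n by simp
    then show False using assms V.F_sub(2) by (auto simp: finite_subfield_def)
  qed
  then show ?thesis using that n by auto
qed

end

text \<open>The maps for different \<open>F\<close> are not assumed compatible, so each argument has
  to take place in one finite subfield that contains all elements concerned.\<close>

locale quasi_finite_closure = valued_closure +
  assumes ex_aut: "finite_subfield F \<Longrightarrow> \<exists>\<sigma>. field_aut L K F \<sigma>"
begin

text \<open>A generator \<open>\<sigma>\<close> of the Galois group of the compositum \<open>N = F(\<alpha>)\<close> satisfies
  \<open>\<sigma>\<^sup>n = 1\<close> on \<open>F\<close>, and the fixed elements of \<open>\<sigma>\<^sup>n\<close> in \<open>N\<close> are those of \<open>K(\<alpha>)\<close>.\<close>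

lemma finite_subfield_eq_simple_extension:
  assumes F: "finite_subfield F" "dimension n K F"
    and pi: "\<pi> \<in> K - {\<zero>}" "v \<pi> = 1" and al: "\<alpha> \<in> carrier L" "\<alpha> [^] n = \<pi>" and n: "n > 0"
  shows "F = simple_extension K \<alpha>"
proof -
  interpret U: uniformizer_root L K v \<pi> \<alpha> n by (rule uniformizer_rootI[OF pi n al])
  let ?N = "simple_extension F \<alpha>"
  note N = finite_subfield_adjoin[OF F(1) al(1)]
  obtain \<sigma> where \<sigma>: "field_aut L K ?N \<sigma>" using ex_aut[OF N(1)] by blast
  interpret S: field_aut L K ?N \<sigma> by (rule \<sigma>)
  have FF: "subfield F L" "K \<subseteq> F" using F(1) by (auto simp: finite_subfield_def)
  have "F \<subseteq> simple_extension K \<alpha>"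
  proof
    fix y assume y: "y \<in> F"
    have "(\<sigma> ^^ n) y = y" using S.iter_dimension_fix[OF FF N(2) F(2) y] .
    then show "y \<in> simple_extension K \<alpha>"
      using S.orbit(3)[OF N(3) alg[OF al(1)]] U.degree_Irr y N(2) by auto
  qed
  then show ?thesis using dimension_mono(2)[OF V.F F(2) U.F_finite(4)] by simp
qed

lemma finite_subfield_uniformizer_root:
  assumes F: "finite_subfield F"
  obtains \<pi> \<alpha> n where "uniformizer_root L K v \<pi> \<alpha> n" "F = simple_extension K \<alpha>"
proof -
  obtain n where n: "n > 0" "dimension n K F" using finite_subfield_dimension[OF F] .
  obtain \<pi> where pi: "\<pi> \<in> K - {\<zero>}" "v \<pi> = 1" by (rule ex_uniformizer)
  obtain \<alpha> where al: "\<alpha> \<in> carrier L" "\<alpha> [^] n = \<pi>"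
    using ex_nth_root[OF n(1), of \<pi>] pi V.F_carrier by auto
  show ?thesis
    using that[OF uniformizer_rootI[OF pi n(1) al]] finite_subfield_eq_simple_extension[OF F n(2) pi al n(1)]
    by simp
qed

lemma unique_extension:
  assumes F: "finite_subfield F"
  shows "\<exists>w. extension_on F w \<and> (\<forall>w'. extension_on F w' \<longrightarrow> (\<forall>x\<in>F - {\<zero>}. w' x = w x))"
proof -
  obtain \<pi> \<alpha> n where U: "uniformizer_root L K v \<pi> \<alpha> n" and Fe: "F = simple_extension K \<alpha>"
    using finite_subfield_uniformizer_root[OF F] .
  interpret U: uniformizer_root L K v \<pi> \<alpha> n by (rule U)
  show ?thesis using U.extension_w U.extension_unique unfolding Fe by blast
qed

text \<open>The leading coefficient is a unit, which makes a root of \<open>p\<close> integral.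
  Replacing the root by an element of \<open>K\<close> with the same residue changes the value of
  \<open>p\<close> only modulo the maximal ideal.\<close>

lemma residue_root:
  assumes p: "set p \<subseteq> V.ge 0" "length p \<ge> 2" "hd p \<notin> V.gt 0"
  shows "\<exists>c\<in>V.ge 0. eval p c \<in> V.gt 0"
proof -
  have pc: "set p \<subseteq> carrier L" using p(1) V.geD(1) V.F_carrier by auto
  have "hd p \<in> V.ge 0" using p(1,2) by (cases p) auto
  then have h: "hd p \<in> K - {\<zero>}" "v (hd p) = 0"
    using p(3) V.geD[of "hd p" 0] V.gtI[of "hd p" 0] V.zero_gt by (auto simp: order.order_iff_strict)
  obtain x where x: "x \<in> carrier L" "eval p x = \<zero>" using ex_root[OF pc p(2)] h(1) by auto
  obtain \<pi> \<alpha> n where U: "uniformizer_root L K v \<pi> \<alpha> n" and Fe: "simple_extension K x = simple_extension K \<alpha>"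
    using finite_subfield_uniformizer_root[OF finite_subfield_adjoin(1)[OF finite_subfield_base x(1)]] .
  interpret U: uniformizer_root L K v \<pi> \<alpha> n by (rule U)
  interpret W: field_val L U.F U.w by (rule U.field_val_w)
  have xF: "x \<in> U.F" using finite_subfield_adjoin(3)[OF finite_subfield_base x(1)] Fe by simp
  have ext: "c \<in> K \<Longrightarrow> c \<noteq> \<zero> \<Longrightarrow> U.w c = of_int (v c)" for c
    using U.extension_w by (simp add: extension_on_def)
  have O: "V.ge 0 \<subseteq> W.ge 0"
  proof
    fix c assume c: "c \<in> V.ge 0"
    show "c \<in> W.ge 0"
      using V.geD[OF c] ext[of c] U.F_finite(2) by (intro W.geI) auto
  qed
  have x0: "x \<in> W.ge 0"
  proof (rule W.integral_root[OF _ _ _ _ xF x(2)])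
    show "set p \<subseteq> W.ge 0" using p(1) O by blast
  qed (use p h ext in auto)
  obtain c where c: "c \<in> V.ge 0" "x \<ominus> c = \<zero> \<or> 0 < U.w (x \<ominus> c)"
    by (rule U.residue_trivial[OF xF W.geD(2)[OF x0]])
  have cW: "c \<in> W.ge 0" using c(1) O by auto
  have "x \<ominus> c \<in> W.gt 0"
    using c(2) W.F_minus[OF xF W.geD(1)[OF cW]] by (auto simp: W.gt_def)
  then have d: "eval p x \<ominus> eval p c \<in> W.gt 0"
    using W.eval_cong_ge0[OF _ x0 cW] p(1) O by auto
  have e: "eval p c \<in> V.ge 0" using V.eval_ge0[OF p(1) c(1)] .
  then have ec: "eval p c \<in> carrier L" using V.geD(1) V.F_carrier by auto
  have "eval p c \<in> W.gt 0" using W.gt_neg[OF d] x(2) ec by (simp add: minus_eq)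
  then have "eval p c \<in> V.gt 0"
    using W.gtD(2)[of "eval p c" 0] V.geD(1)[OF e] ext[of "eval p c"] by (intro V.gtI) auto
  then show ?thesis using c(1) by blast
qed

text \<open>On the common field generated by \<alpha> and \<beta>, \<sigma> multiplies \<alpha> by a
  root of unity \<zeta> of order \<open>p\<close>, and \<beta> by some power
  \<open>\<zeta>^k\<close>. The quotient \<delta> of \<beta> by \<open>\<alpha>^k\<close> is thus
  fixed and lies in \<open>K\<close>. Integrality of its value forces \<open>k = 1\<close>, and then
  the \<open>p\<close>-th power of \<delta> is \<open>u\<close>.\<close>

lemma uniformizer_p_th_power:
  assumes p: "Factorial_Ring.prime p" and pi: "\<pi> \<in> K - {\<zero>}" "v \<pi> = 1"
    and u: "u \<in> K - {\<zero>}" "v u = 0"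
  obtains \<gamma> where "\<gamma> \<in> K" "\<gamma> [^] (p :: nat) = u"
proof -
  have p1: "p > 1" and p0: "p > 0" using prime_gt_1_nat[OF p] by auto
  have car: "\<pi> \<in> carrier L" "u \<in> carrier L" using pi u V.F_carrier by auto
  obtain \<alpha> where al: "\<alpha> \<in> carrier L" "\<alpha> [^] p = \<pi>" using ex_nth_root[OF p0 car(1)] .
  obtain \<beta> where be: "\<beta> \<in> carrier L" "\<beta> [^] p = \<pi> \<otimes> u" using ex_nth_root[OF p0, of "\<pi> \<otimes> u"] car by auto
  have pu: "\<pi> \<otimes> u \<in> K - {\<zero>}" "v (\<pi> \<otimes> u) = 1"
    using V.F_mult_nz[OF pi(1) u(1)] V.val_mult[OF pi(1) u(1)] pi u by auto
  interpret U: uniformizer_root L K v \<pi> \<alpha> p by (rule uniformizer_rootI[OF pi p0 al])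
  interpret U': uniformizer_root L K v "\<pi> \<otimes> u" \<beta> p by (rule uniformizer_rootI[OF pu p0 be])
  let ?F = "simple_extension K \<alpha>"
  have "?F = simple_extension K \<beta>"
    by (rule finite_subfield_eq_simple_extension[OF U.F_finite(1,4) pu be p0])
  then have bF: "\<beta> \<in> ?F" using U'.F_finite(3) by simp
  obtain \<sigma> where "field_aut L K ?F \<sigma>" using ex_aut[OF U.F_finite(1)] by blast
  then interpret S: field_aut L K ?F \<sigma> .
  have aF: "\<alpha> \<in> ?F - {\<zero>}" and bF': "\<beta> \<in> ?F - {\<zero>}"
    using U.F_finite(3) U.alpha_nz bF U'.alpha_nz by auto
  have quot: "\<sigma> x \<otimes> inv x \<in> ?F" "(\<sigma> x \<otimes> inv x) [^] p = \<one>" "\<sigma> x = (\<sigma> x \<otimes> inv x) \<otimes> x"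
    if x: "x \<in> ?F - {\<zero>}" "x [^] p \<in> K" for x
  proof -
    note i = subfield_m_inv[OF S.N x(1)]
    have c: "\<sigma> x \<in> carrier L" "x \<in> carrier L" "inv x \<in> carrier L" using x i by auto
    show "\<sigma> x \<otimes> inv x \<in> ?F" using x i(1) by auto
    have "\<sigma> x [^] p = x [^] p"
      using S.aut_fix[OF x(2)] S.iter_pow[of x 1 p] x(1) by simp
    then have "(\<sigma> x \<otimes> inv x) [^] p = (x \<otimes> inv x) [^] p" using c by (simp add: nat_pow_distrib)
    then show "(\<sigma> x \<otimes> inv x) [^] p = \<one>" using i by simp
    show "\<sigma> x = (\<sigma> x \<otimes> inv x) \<otimes> x" using c i by (simp add: m_assoc)
  qed
  define \<zeta> where "\<zeta> = \<sigma> \<alpha> \<otimes> inv \<alpha>"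
  have z: "\<zeta> \<in> ?F" "\<zeta> [^] p = \<one>" "\<sigma> \<alpha> = \<zeta> \<otimes> \<alpha>"
    using quot[OF aF] al(2) pi by (auto simp: \<zeta>_def)
  have zc: "\<zeta> \<in> carrier L" using z(1) by simp
  have z1: "\<zeta> \<noteq> \<one>"
  proof
    assume "\<zeta> = \<one>"
    then have "\<alpha> \<in> K" using S.fixed[of \<alpha>] z(3) aF al(1) by auto
    then have "int p * v \<alpha> = 1" using V.val_pow[of \<alpha> p] al(2) pi(2) aF by auto
    then have "int p dvd 1" by (metis dvd_triv_left)
    then show False using p1 by simp
  qed
  note ord = prime_pow_eq_one_iff[OF zc z1 p z(2)]
  \<comment> \<open>The degree of \<zeta> divides the prime \<open>p\<close>. If it were
    \<open>p\<close>, the \<open>p\<close> conjugates of \<zeta> under \<sigma> together with 1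
    would be too many roots of \<open>X^p - 1\<close>.\<close>
  have zK: "\<zeta> \<in> K"
  proof -
    let ?d = "degree (Irr K \<zeta>)"
    note o = S.orbit[OF z(1) alg[OF zc]]
    have "?d dvd p" using degree_Irr_dvd[OF V.F S.N S.KN U.F_finite(4) z(1)] .
    then consider "?d = 1" | "?d = p" using p by (metis prime_nat_iff)
    then show ?thesis
    proof cases
      case 1
      then have "\<sigma> \<zeta> = \<zeta>" using o(1) unfolding 1 by simp
      then show ?thesis using S.fixed z(1) by blast
    next
      case 2
      let ?S = "insert \<one> ((\<lambda>j. (\<sigma> ^^ j) \<zeta>) ` {..<p})"
      note X = X_pow_minus_props[OF p0 one_closed]
      have s1: "(\<sigma> ^^ j) \<one> = \<one>" for j using S.iter_fix V.F_sub by simp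
      have "card ?S < length (X_pow_minus p \<one>)"
      proof (rule card_roots_le_degree)
        show "eval (X_pow_minus p \<one>) y = \<zero>" if y: "y \<in> ?S" for y
        proof (cases "y = \<one>")
          case False
          then obtain j where j: "y = (\<sigma> ^^ j) \<zeta>" using y by auto
          then have "y [^] p = \<one>" using S.iter_pow[OF z(1), of j p] z(2) s1[of j] by simp
          then show ?thesis using X(4)[of y] j z(1) by (simp add: minus_eq r_neg)
        qed (use X(4) in \<open>simp add: minus_eq r_neg\<close>)
        show "X_pow_minus p \<one> \<noteq> []" using X(1) by auto
      qed (use z X in auto)
      moreover have "\<one> \<notin> (\<lambda>j. (\<sigma> ^^ j) \<zeta>) ` {..<p}"
      proof
        assume "\<one> \<in> (\<lambda>j. (\<sigma> ^^ j) \<zeta>) ` {..<p}"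
        then obtain j where "(\<sigma> ^^ j) \<zeta> = (\<sigma> ^^ j) \<one>" using s1 by auto
        then show False using S.iter_inj[OF z(1)] z1 by auto
      qed
      ultimately show ?thesis using X(1) card_image[OF o(2)] 2 by simp
    qed
  qed
  define \<xi> where "\<xi> = \<sigma> \<beta> \<otimes> inv \<beta>"
  have x: "\<xi> \<in> ?F" "\<xi> [^] p = \<one>" "\<sigma> \<beta> = \<xi> \<otimes> \<beta>"
    using quot[OF bF'] be(2) pu by (auto simp: \<xi>_def)
  obtain k where k: "k < p" "\<xi> = \<zeta> [^] k"
    using ex_primitive_power[OF zc ord p0 S.N_closed[OF x(1)] x(2)] .
  have ak: "\<alpha> [^] k \<in> ?F - {\<zero>}" using aF pow_nonzero[of \<alpha> k] by auto
  note i = subfield_m_inv[OF S.N ak]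
  define \<delta> where "\<delta> = \<beta> \<otimes> inv (\<alpha> [^] k)"
  have dF: "\<delta> \<in> ?F" using bF i(1) by (simp add: \<delta>_def)
  have db: "\<delta> \<otimes> \<alpha> [^] k = \<beta>" using i ak bF by (simp add: \<delta>_def m_assoc)
  have "\<sigma> \<delta> \<otimes> (\<xi> \<otimes> \<alpha> [^] k) = \<xi> \<otimes> \<beta>"
  proof -
    have "\<sigma> (\<alpha> [^] k) = \<xi> \<otimes> \<alpha> [^] k"
      using S.iter_pow[of \<alpha> 1 k] aF z(3) k(2) zc al(1) by (simp add: nat_pow_distrib)
    then show ?thesis using S.aut_mult[OF dF, of "\<alpha> [^] k"] ak db x(3) by simp
  qed
  also have "\<dots> = \<delta> \<otimes> (\<xi> \<otimes> \<alpha> [^] k)"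
    using db[symmetric] dF x(1) al(1) by (simp add: m_lcomm)
  finally have "\<sigma> \<delta> \<otimes> (\<xi> \<otimes> \<alpha> [^] k) = \<delta> \<otimes> (\<xi> \<otimes> \<alpha> [^] k)" .
  moreover have "\<xi> \<otimes> \<alpha> [^] k \<in> carrier L" "\<xi> \<otimes> \<alpha> [^] k \<noteq> \<zero>"
    using x(1,2) ak p0 al(1) integral[of \<xi> "\<alpha> [^] k"] by (auto simp: nat_pow_zero)
  ultimately have "\<sigma> \<delta> = \<delta>" using m_rcancel dF by auto
  then have dK: "\<delta> \<in> K" using S.fixed dF by blast
  have "\<delta> \<noteq> \<zero>" using db bF' al(1) by auto
  have dp: "\<delta> [^] p \<otimes> \<pi> [^] k = \<pi> \<otimes> u"
  proof -
    have "(\<delta> \<otimes> \<alpha> [^] k) [^] p = \<delta> [^] p \<otimes> (\<alpha> [^] p) [^] k"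
      using dF al(1) by (simp add: nat_pow_distrib nat_pow_pow mult.commute)
    then show ?thesis using db be al by simp
  qed
  \<comment> \<open>Since \<open>k < p\<close>, reducing this equation modulo \<open>p\<close>
    leaves only \<open>k = 1\<close>.\<close>
  have "int p * v \<delta> + int k = 1"
    using V.val_mult[OF V.F_pow_nz[of \<delta> p] V.F_pow_nz[OF pi(1), of k]] V.val_pow[of \<delta> p] V.val_pow[OF pi(1), of k]
      dp pu(2) pi(2) dK \<open>\<delta> \<noteq> \<zero>\<close> by simp
  then have "(int p * v \<delta> + int k) mod int p = 1 mod int p" by simp
  then have "k = 1" using k(1) p1 by (simp add: zmod_int[symmetric])
  then have "\<delta> [^] p \<otimes> \<pi> = u \<otimes> \<pi>" using dp car by (simp add: m_comm)
  then have "\<delta> [^] p = u" using m_rcancel[of \<pi>] pi car dF by simp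
  then show ?thesis using that dK by blast
qed

lemma prime_residue:
  assumes p: "Factorial_Ring.prime p"
  shows "[(p :: nat)] \<cdot> \<one> \<notin> V.gt 0"
proof
  assume pm: "[p] \<cdot> \<one> \<in> V.gt 0"
  have p0: "p > 0" using prime_gt_0_nat[OF p] .
  obtain \<pi> where pi: "\<pi> \<in> K - {\<zero>}" "v \<pi> = 1" by (rule ex_uniformizer)
  have pg: "\<pi> \<in> V.gt 0" using pi by (auto simp: V.gt_def)
  have pc: "\<pi> \<in> carrier L" using pi V.F_carrier by auto
  have e: "(\<one> \<oplus> \<pi>) \<ominus> \<one> = \<pi>" using pc by algebra
  have u: "\<one> \<oplus> \<pi> \<in> K - {\<zero>}" "v (\<one> \<oplus> \<pi>) = 0"
    using V.val_close[of \<one> "\<one> \<oplus> \<pi>"] V.val_one V.F_sub pi pg e by auto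
  obtain \<gamma> where g: "\<gamma> \<in> K" "\<gamma> [^] p = \<one> \<oplus> \<pi>"
    by (rule uniformizer_p_th_power[OF p pi u])
  have gc: "\<gamma> \<in> carrier L" using g(1) V.F_carrier by auto
  have g0: "\<gamma> \<noteq> \<zero>" using g(2) u(1) p0 by (auto simp: nat_pow_zero)
  have "int p * v \<gamma> = 0" using V.val_pow[of \<gamma> p] g g0 u(2) by simp
  then have gO: "\<gamma> \<in> V.ge 0" using g(1) p0 by (auto simp: V.ge_def)
  let ?q = "replicate p \<one>"
  have q: "set ?q \<subseteq> V.ge 0" using V.one_ge by (simp add: set_replicate_conv_if)
  have prod: "(\<gamma> \<ominus> \<one>) \<otimes> eval ?q \<gamma> = \<pi>" using geometric_eval[OF gc, of p] g(2) e by simp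
  \<comment> \<open>The residue of \<gamma> is a \<open>p\<close>-th root of 1 in a field of
    characteristic \<open>p\<close>, hence equal to 1.\<close>
  have "\<gamma> \<ominus> \<one> \<in> V.gt 0"
  proof -
    obtain \<theta> where hom: "ring_hom_ring (L\<lparr>carrier := V.ge 0\<rparr>) V.\<kappa> \<theta>" and f: "field V.\<kappa>"
      and ker: "\<And>x. x \<in> V.ge 0 \<Longrightarrow> \<theta> x = \<zero>\<^bsub>V.\<kappa>\<^esub> \<longleftrightarrow> x \<in> V.gt 0"
      by (rule V.residue_hom) blast
    interpret k: field V.\<kappa> by (rule f)
    interpret h: ring_hom_ring "L\<lparr>carrier := V.ge 0\<rparr>" V.\<kappa> \<theta> by (rule hom)
    have nat: "\<theta> ([n] \<cdot> \<one>) = [n] \<cdot>\<^bsub>V.\<kappa>\<^esub> \<one>\<^bsub>V.\<kappa>\<^esub>" for n :: nat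
    proof (induction n)
      case 0
      then show ?case using h.hom_zero by simp
    next
      case (Suc n)
      then show ?case using h.hom_add[of "[n] \<cdot> \<one>" \<one>] h.hom_one V.nat_ge0[of n] V.one_ge by simp
    qed
    have pow: "x [^] n \<in> V.ge 0 \<and> \<theta> (x [^] n) = \<theta> x [^]\<^bsub>V.\<kappa>\<^esub> n" if "x \<in> V.ge 0" for x and n :: nat
    proof (induction n)
      case 0
      then show ?case using h.hom_one V.one_ge by simp
    next
      case (Suc n)
      then show ?case using h.hom_mult[of "x [^] n" x] that V.ge_mult[of "x [^] n" 0 x 0] by simp
    qed
    have "\<theta> (\<one> \<oplus> \<pi>) = \<one>\<^bsub>V.\<kappa>\<^esub>"
      using h.hom_add[of \<one> \<pi>] h.hom_one V.one_ge V.gt_ge[OF pg] ker[of \<pi>] pg by simp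
    then have "\<theta> \<gamma> [^]\<^bsub>V.\<kappa>\<^esub> p = \<one>\<^bsub>V.\<kappa>\<^esub>" using pow[OF gO, of p] g(2) by simp
    moreover have "[p] \<cdot>\<^bsub>V.\<kappa>\<^esub> \<one>\<^bsub>V.\<kappa>\<^esub> = \<zero>\<^bsub>V.\<kappa>\<^esub>"
      using nat[of p, symmetric] ker[OF V.nat_ge0, of p] pm by simp
    moreover have "\<theta> \<gamma> \<in> carrier V.\<kappa>" using h.hom_closed[of \<gamma>] gO by simp
    ultimately have t1: "\<theta> \<gamma> = \<one>\<^bsub>V.\<kappa>\<^esub>"
      by (rule k.root_of_unity_char_p[OF p, rotated 2])
    have d: "\<gamma> \<ominus> \<one> \<in> V.ge 0" using V.ge_minus gO V.one_ge by auto
    have "\<gamma> = (\<gamma> \<ominus> \<one>) \<oplus> \<one>" using gc by algebra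
    then have "\<theta> \<gamma> = \<theta> (\<gamma> \<ominus> \<one>) \<oplus>\<^bsub>V.\<kappa>\<^esub> \<one>\<^bsub>V.\<kappa>\<^esub>"
      using h.hom_add[of "\<gamma> \<ominus> \<one>" \<one>] h.hom_one d V.one_ge by simp
    then have "\<theta> (\<gamma> \<ominus> \<one>) = \<zero>\<^bsub>V.\<kappa>\<^esub>"
      using t1 h.hom_closed[of "\<gamma> \<ominus> \<one>"] d by simp
    then show ?thesis using ker d by simp
  qed
  \<comment> \<open>As \<gamma> is congruent to 1, the geometric sum is congruent to its value
    \<open>p\<close> at 1, which is in the maximal ideal by assumption.\<close>
  moreover have "eval ?q \<gamma> \<in> V.gt 0"
  proof -
    have "eval ?q \<gamma> \<ominus> [p] \<cdot> \<one> \<in> V.gt 0"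
      using V.eval_cong_ge0[OF q gO V.one_ge] \<open>\<gamma> \<ominus> \<one> \<in> V.gt 0\<close> eval_replicate_one by simp
    then have "(eval ?q \<gamma> \<ominus> [p] \<cdot> \<one>) \<oplus> [p] \<cdot> \<one> \<in> V.gt 0" using V.gt_add pm by auto
    moreover have "a \<ominus> b \<oplus> b = a" if "a \<in> carrier L" "b \<in> carrier L" for a b using that by algebra
    then have "(eval ?q \<gamma> \<ominus> [p] \<cdot> \<one>) \<oplus> [p] \<cdot> \<one> = eval ?q \<gamma>"
      using V.eval_ge0[OF q gO] V.geD(1) V.F_carrier by simp
    ultimately show ?thesis by simp
  qed
  \<comment> \<open>Values are integers, so both factors have value at least 1, and their product at
    least 2; but \<open>v \<pi> = 1\<close>.\<close>
  ultimately have "\<gamma> \<ominus> \<one> \<in> V.ge 1" "eval ?q \<gamma> \<in> V.ge 1"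
    by (auto simp: V.ge_def V.gt_def)
  then have "\<pi> \<in> V.ge 2" using V.ge_mult[of "\<gamma> \<ominus> \<one>" 1 "eval ?q \<gamma>" 1] prod by simp
  then show False using V.geD(2)[of \<pi> 2] pi by auto
qed

text \<open>Units of the valuation ring are closed under products, which reduces the claim to
  primes.\<close>

lemma nat_residue:
  assumes "n > 0" shows "[(n :: nat)] \<cdot> \<one> \<notin> V.gt 0"
  using assms
proof (induction n rule: less_induct)
  case (less n)
  show ?case
  proof (cases "n = 1")
    case True
    then show ?thesis using V.one_not_gt by simp
  next
    case False
    then obtain p where p: "Factorial_Ring.prime p" "p dvd n" using prime_factor_nat by blast
    obtain m where n: "n = p * m" using p(2) by (rule dvdE)
    have m: "m > 0" "m < n" using n less.prems prime_gt_1_nat[OF p(1)] by auto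
    have unit: "x \<in> K - {\<zero>} \<and> v x = 0" if "x \<in> V.ge 0" "x \<notin> V.gt 0" for x
      using that V.zero_gt by (auto simp: V.ge_def V.gt_def)
    have "[n] \<cdot> \<one> = [p] \<cdot> \<one> \<otimes> [m] \<cdot> \<one>"
      unfolding n by (simp add: add_pow_ldistr add.nat_pow_pow mult.commute)
    moreover note unit[OF V.nat_ge0 prime_residue[OF p(1)]] unit[OF V.nat_ge0 less.IH[OF m(2,1)]]
    ultimately show ?thesis
      using V.val_mult[of "[p] \<cdot> \<one>" "[m] \<cdot> \<one>"] V.F_mult_nz[of "[p] \<cdot> \<one>" "[m] \<cdot> \<one>"] V.gtD(2)[of "[n] \<cdot> \<one>" 0] by auto
  qed
qed

end

section \<open>Henselian valuations with algebraically closed residue field\<close>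

lemma (in domain) hom_eval_fixed:
  assumes H: "subring H R" and \<tau>: "\<tau> \<in> ring_hom (R\<lparr>carrier := H\<rparr>) R"
    and fixed: "\<And>c. c \<in> K \<Longrightarrow> \<tau> c = c" and K: "K \<subseteq> H" and x: "x \<in> H" and p: "set p \<subseteq> K"
  shows "\<tau> (eval p x) = eval p (\<tau> x)"
proof -
  note sub = subringE[OF H]
  have pow: "x [^] n \<in> H \<and> \<tau> (x [^] n) = \<tau> x [^] n" for n :: nat
    by (induction n) (use ring_hom_one[OF \<tau>] ring_hom_mult[OF \<tau>] x sub in auto)
  have z: "\<tau> \<zero> = \<zero>"
  proof -
    have "\<tau> \<zero> \<in> carrier R" "\<tau> \<zero> = \<tau> \<zero> \<oplus> \<tau> \<zero>"
      using ring_hom_closed[OF \<tau>, of \<zero>] ring_hom_add[OF \<tau>, of \<zero> \<zero>] sub by auto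
    then show ?thesis using add.r_cancel_one' by metis
  qed
  show ?thesis using p
  proof (induction p)
    case (Cons a p)
    then have "a \<in> H" "eval p x \<in> H" "\<tau> a = a" using K eval_in_subring[OF H _ x, of p] fixed by auto
    then show ?case
      using Cons ring_hom_add[OF \<tau>, of "a \<otimes> x [^] length p" "eval p x"] ring_hom_mult[OF \<tau>, of a "x [^] length p"]
        pow[of "length p"] sub by simp
  qed (use z in simp)
qed

lemma (in domain) hom_nonzero:
  assumes H: "subfield H R" and \<tau>: "\<tau> \<in> ring_hom (R\<lparr>carrier := H\<rparr>) R" and x: "x \<in> H - {\<zero>}"
  shows "\<tau> x \<noteq> \<zero>"
proof
  assume "\<tau> x = \<zero>"
  note i = subfield_m_inv[OF H x]
  have "\<tau> (x \<otimes> inv x) = \<tau> x \<otimes> \<tau> (inv x)" using ring_hom_mult[OF \<tau>, of x "inv x"] i x by auto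
  moreover have "\<tau> (inv x) \<in> carrier R" using ring_hom_closed[OF \<tau>, of "inv x"] i by auto
  ultimately have "\<tau> \<one> = \<zero>" using i \<open>\<tau> x = \<zero>\<close> by simp
  then show False using ring_hom_one[OF \<tau>] by simp
qed

context field_val
begin

lemma eval_gt0: "\<lbrakk> set p \<subseteq> gt 0; x \<in> ge 0 \<rbrakk> \<Longrightarrow> eval p x \<in> gt 0"
proof (induction p)
  case (Cons a p)
  have "x [^] n \<in> ge 0" for n :: nat
    by (induction n) (use one_ge ge_mult[of _ 0 x 0] Cons.prems in auto)
  then show ?case using Cons gt_add gt0_mult by simp
qed (simp add: zero_gt)

lemma gt0_prime:
  assumes "x \<in> ge 0" "y \<in> ge 0" "x \<otimes> y \<in> gt 0" shows "x \<in> gt 0 \<or> y \<in> gt 0"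
proof (rule ccontr)
  assume "\<not> ?thesis"
  then have "x \<in> F - {\<zero>}" "w x = 0" "y \<in> F - {\<zero>}" "w y = 0"
    using assms zero_gt by (auto simp: ge_def gt_def)
  then show False using F_mult_nz[of x y] val_mult[of x y] gtD(2)[OF assms(3)] by auto
qed

text \<open>The list \<open>zs\<close> will consist of conjugates, all equally close to an element
  \<open>b\<close> of the base field; their sum is then close to a multiple of
  \<open>b\<close>.\<close>

lemma sum_close:
  assumes "set zs \<subseteq> F" "b \<in> F" "\<And>z. z \<in> set zs \<Longrightarrow> z \<ominus> b \<in> gt t"
  shows "foldr (\<oplus>) zs \<zero> \<ominus> [(length zs)] \<cdot> \<one> \<otimes> b \<in> gt t"
  using assms
proof (induction zs)
  case (Cons z zs)
  let ?s = "foldr (\<oplus>) zs \<zero>" and ?n = "[(length zs)] \<cdot> \<one>"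
  have c: "z \<in> carrier R" "b \<in> carrier R" "?s \<in> carrier R" "?n \<in> carrier R"
    using Cons.prems F_carrier foldr_add_closed[of zs] by auto
  have "z \<oplus> ?s \<ominus> (?n \<oplus> \<one>) \<otimes> b = (z \<ominus> b) \<oplus> (?s \<ominus> ?n \<otimes> b)" using c by algebra
  then show ?case using gt_add[OF Cons.prems(3)[of z] Cons.IH] Cons.prems by simp
qed (use zero_gt F_carrier in \<open>simp add: minus_eq\<close>)

lemma ex_val_multiple:
  assumes "x \<in> F - {\<zero>}"
  obtains y where "y \<in> F - {\<zero>}" "w y = of_int k * w x"
proof (cases k rule: int_cases2)
  case (nonneg m)
  then show ?thesis using that[of "x [^] m"] F_pow_nz[OF assms] val_pow[OF assms, of m] by simp
next
  case (nonpos m)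
  then show ?thesis
    using that[of "inv x [^] m"] F_pow_nz[OF F_inv_nz[OF assms]] val_pow[OF F_inv_nz[OF assms], of m]
      val_inv[OF assms] by simp
qed

end

section \<open>The valuation on the closure and its invariance under conjugation\<close>

locale henselian_closure = valued_closure +
  assumes unique_ext: "finite_subfield F \<Longrightarrow>
      \<exists>w. extension_on F w \<and> (\<forall>w'. extension_on F w' \<longrightarrow> (\<forall>x\<in>F - {\<zero>}. w' x = w x))"
    and residue_root: "\<lbrakk> set p \<subseteq> V.ge 0; length p \<ge> 2; hd p \<notin> V.gt 0 \<rbrakk> \<Longrightarrow> \<exists>c\<in>V.ge 0. eval p c \<in> V.gt 0"
    and nat_residue: "m > 0 \<Longrightarrow> [(m :: nat)] \<cdot> \<one> \<notin> V.gt 0"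
begin

definition ext :: "'a set \<Rightarrow> 'a \<Rightarrow> rat"
  where "ext F = (SOME w. extension_on F w)"

text \<open>\<open>W\<close> glues the extensions on the finite subfields into one valuation on
  \<open>L\<close>. The value is read off in the smallest field containing \<open>x\<close>;
  uniqueness makes every larger finite subfield agree, as \<open>ext_eq_W\<close> shows.\<close>

definition W :: "'a \<Rightarrow> rat"
  where "W x = ext (simple_extension K x) x"

lemma ext_extension: "finite_subfield F \<Longrightarrow> extension_on F (ext F)"
  using unique_ext[of F] unfolding ext_def by (metis someI)

lemma extension_eq_ext:
  assumes "finite_subfield F" "extension_on F w" "x \<in> F - {\<zero>}"
  shows "w x = ext F x"
  using unique_ext[OF assms(1)] ext_extension[OF assms(1)] assms(2,3) by metis

lemma extension_mono:
  assumes "extension_on F w" "F' \<subseteq> F" "subfield F' L"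
  shows "extension_on F' w"
proof -
  interpret E: field_val L F w using assms(1) by (simp add: extension_on_def)
  have "field_val L F' w"
    by (intro field_val.intro[OF field_axioms field_val_axioms.intro] assms(3) E.val_mult E.val_add)
      (use assms(2) in auto)
  then show ?thesis using assms(1) by (simp add: extension_on_def)
qed

lemma ext_eq_W:
  assumes F: "finite_subfield F" and x: "x \<in> F - {\<zero>}"
  shows "ext F x = W x"
proof -
  have xc: "x \<in> carrier L" using x F subfieldE(3) by (auto simp: finite_subfield_def)
  note S = finite_subfield_adjoin[OF finite_subfield_base xc]
  have "simple_extension K x \<subseteq> F"
    using simple_extension_subring_incl[OF subfieldE(1), of F K x] F x by (auto simp: finite_subfield_def)
  then have "extension_on (simple_extension K x) (ext F)"
    using extension_mono[OF ext_extension[OF F]] S(1) by (simp add: finite_subfield_def)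
  then show ?thesis unfolding W_def using extension_eq_ext[OF S(1)] S(3) x by auto
qed

text \<open>Any two elements lie in a common finite subfield, on which \<open>W\<close> coincides
  with a valuation.\<close>

lemma W_field_val: "field_val L (carrier L) W"
proof (rule field_val.intro[OF field_axioms field_val_axioms.intro])
  show "subfield (carrier L) L" by (rule carrier_is_subfield)
next
  fix x y assume xy: "x \<in> carrier L - {\<zero>}" "y \<in> carrier L - {\<zero>}"
  let ?F = "simple_extension (simple_extension K x) y"
  have x: "finite_subfield (simple_extension K x)" "x \<in> simple_extension K x"
    using finite_subfield_adjoin[OF finite_subfield_base] xy by auto
  have F: "finite_subfield ?F" "x \<in> ?F" "y \<in> ?F"
    using finite_subfield_adjoin[OF x(1)] x(2) xy by auto
  interpret E: field_val L ?F "ext ?F"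
    using ext_extension[OF F(1)] by (simp add: extension_on_def)
  show "W (x \<otimes> y) = W x + W y"
    using ext_eq_W[OF F(1)] E.val_mult[of x y] F xy E.F_mult_nz[of x y] by auto
  show "min (W x) (W y) \<le> W (x \<oplus> y)" if "x \<oplus> y \<noteq> \<zero>"
    using ext_eq_W[OF F(1)] E.val_add[of x y] F xy that E.F_sub(5)[of x y] by auto
qed

end

sublocale henselian_closure \<subseteq> W: field_val L "carrier L" W
  by (rule W_field_val)

context henselian_closure
begin

lemma W_base: "c \<in> K - {\<zero>} \<Longrightarrow> W c = of_int (v c)"
  using ext_eq_W[OF finite_subfield_base] ext_extension[OF finite_subfield_base]
  by (simp add: extension_on_def)

lemma ge0_W: "c \<in> V.ge 0 \<Longrightarrow> c \<in> W.ge 0"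
  using V.geD[of c 0] W_base[of c] V.F_carrier by (intro W.geI) auto

lemma gt0_W: assumes "c \<in> K" shows "c \<in> V.gt 0 \<longleftrightarrow> c \<in> W.gt 0"
  using assms W_base[of c] V.F_carrier
  by (cases "c = \<zero>") (auto simp: V.gt_def W.gt_def V.zero_gt W.zero_gt)

lemma nat_nz: "m > 0 \<Longrightarrow> [(m :: nat)] \<cdot> \<one> \<in> K - {\<zero>}" "m > 0 \<Longrightarrow> W ([m] \<cdot> \<one>) = 0"
proof -
  assume m: "m > 0"
  show *: "[m] \<cdot> \<one> \<in> K - {\<zero>}"
    using nat_residue[OF m] V.zero_gt V.geD(1)[OF V.nat_ge0] by auto
  have "v ([m] \<cdot> \<one>) = 0"
    using nat_residue[OF m] V.geD(2)[OF V.nat_ge0, of m] * V.gtI[of "[m] \<cdot> \<one>" 0] by force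
  then show "W ([m] \<cdot> \<one>) = 0" using W_base[OF *] by simp
qed

text \<open>Composing \<open>W\<close> with the homomorphism gives another extension of
  \<open>v\<close> to \<open>F\<close>, and there is only one.\<close>

lemma hom_preserves_W:
  assumes F: "finite_subfield F" and \<phi>: "\<phi> \<in> ring_hom (L\<lparr>carrier := F\<rparr>) L"
    and fixed: "\<And>c. c \<in> K \<Longrightarrow> \<phi> c = c" and x: "x \<in> F - {\<zero>}"
  shows "\<phi> x \<noteq> \<zero>" "W (\<phi> x) = W x"
proof -
  have sF: "subfield F L" "F \<subseteq> carrier L" using F subfieldE(3) by (auto simp: finite_subfield_def)
  have nz: "\<phi> y \<in> carrier L - {\<zero>}" if "y \<in> F - {\<zero>}" for y
    using hom_nonzero[OF sF(1) \<phi> that] ring_hom_closed[OF \<phi>, of y] that by auto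
  then show "\<phi> x \<noteq> \<zero>" using x by auto
  have "extension_on F (\<lambda>y. W (\<phi> y))"
    unfolding extension_on_def
  proof (intro conjI ballI field_val.intro[OF field_axioms field_val_axioms.intro] sF(1))
    fix a b assume ab: "a \<in> F - {\<zero>}" "b \<in> F - {\<zero>}"
    show "W (\<phi> (a \<otimes> b)) = W (\<phi> a) + W (\<phi> b)"
      using ring_hom_mult[OF \<phi>, of a b] W.val_mult[OF nz nz] ab by auto
    show "min (W (\<phi> a)) (W (\<phi> b)) \<le> W (\<phi> (a \<oplus> b))" if "a \<oplus> b \<noteq> \<zero>"
    proof -
      have "a \<oplus> b \<in> F - {\<zero>}" using that ab subringE(7)[OF subfieldE(1)[OF sF(1)]] by auto
      then show ?thesis
        using ring_hom_add[OF \<phi>, of a b] W.val_add[OF nz[OF ab(1)] nz[OF ab(2)]] nz[of "a \<oplus> b"] ab by auto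
    qed
  next
    fix c assume "c \<in> K - {\<zero>}"
    then show "W (\<phi> c) = of_int (v c)" using fixed W_base by auto
  qed
  then show "W (\<phi> x) = W x" using extension_eq_ext[OF F _ x] ext_eq_W[OF F x] by simp
qed

text \<open>The homomorphism that sends \<open>z\<close> to \<open>z'\<close> fixes
  \<open>c\<close>, so it maps one difference to the other, and \<open>W\<close> is invariant under
  it.\<close>

lemma conjugate_close:
  assumes F: "finite_subfield F" and z: "z \<in> carrier L" and z': "z' \<in> carrier L" "eval (Irr F z) z' = \<zero>"
    and c: "c \<in> F" and d: "z \<ominus> c \<in> W.gt t"
  shows "z' \<ominus> c \<in> W.gt t"
proof -
  have sF: "subfield F L" "K \<subseteq> F" "F \<subseteq> carrier L"
    using F subfieldE(3) by (auto simp: finite_subfield_def)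
  obtain \<phi> where \<phi>: "\<phi> \<in> ring_hom (L\<lparr>carrier := simple_extension F z\<rparr>) L" "\<And>c. c \<in> F \<Longrightarrow> \<phi> c = c"
    "\<And>p. set p \<subseteq> F \<Longrightarrow> \<phi> (eval p z) = eval p z'"
    using conjugate_hom[OF sF(1) z algebraic_over[OF sF(1,2) z] z'] by metis
  note N = finite_subfield_adjoin[OF F z]
  have cc: "c \<in> carrier L" using subsetD[OF sF(3) c] .
  have "set [\<one>, \<ominus> c] \<subseteq> F" using c subringE[OF subfieldE(1)[OF sF(1)]] by auto
  then have e: "\<phi> (z \<ominus> c) = z' \<ominus> c" using \<phi>(3)[of "[\<one>, \<ominus> c]"] z z' cc by (simp add: minus_eq)
  have zN: "z \<ominus> c \<in> simple_extension F z"
    using N c subringE[OF subfieldE(1), of "simple_extension F z"] by (auto simp: minus_eq finite_subfield_def)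
  \<comment> \<open>The value of zero carries no information, so the case \<open>z = c\<close> is
    separate; there \<open>z'\<close> equals \<open>c\<close> as well.\<close>
  show ?thesis
  proof (cases "z \<ominus> c = \<zero>")
    case True
    then have "z = c" using z cc by simp
    then have "\<phi> c = z'" using \<phi>(3)[of "[\<one>, \<zero>]"] z z' subringE[OF subfieldE(1)[OF sF(1)]] by simp
    then show ?thesis using \<phi>(2)[OF c] W.zero_gt cc by (simp add: minus_eq r_neg)
  next
    case False
    have "W (z' \<ominus> c) = W (z \<ominus> c)"
      using hom_preserves_W(2)[OF N(1) \<phi>(1), of "z \<ominus> c"] \<phi>(2) sF(2) zN False e by auto
    then show ?thesis using d False z' cc by (auto simp: W.gt_def)
  qed
qed

text \<open>Over the algebraically closed residue field the reduction of \<open>p\<close> splits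
  into linear factors. Since the maximal ideal is prime, one of these factors vanishes at the
  residue of \<open>x\<close>. The head of \<open>p\<close> survives each division, so the degree
  drops without the reduction becoming zero.\<close>

lemma residue_approx_root:
  assumes "set p \<subseteq> V.ge 0" "p \<noteq> []" "hd p \<notin> V.gt 0" "x \<in> W.ge 0" "eval p x \<in> W.gt 0"
  shows "\<exists>c\<in>V.ge 0. x \<ominus> c \<in> W.gt 0"
  using assms
proof (induction "length p" arbitrary: p rule: less_induct)
  case less
  have xc: "x \<in> carrier L" using less.prems(4) W.geD(1) by auto
  have h: "hd p \<in> V.ge 0" using less.prems(1,2) by (cases p) auto
  then have hK: "hd p \<in> K" "hd p \<in> carrier L" using V.geD(1) V.F_carrier by auto
  show ?case
  proof (cases "length p \<ge> 2")
    case False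
    then obtain a where "p = [a]" using less.prems(2) by (cases p) (auto simp: Suc_le_eq)
    then have "hd p \<in> W.gt 0" using less.prems(5) xc hK by simp
    then show ?thesis using gt0_W[OF hK(1)] less.prems(3) by simp
  next
    case True
    obtain c where c: "c \<in> V.ge 0" "eval p c \<in> V.gt 0"
      using residue_root[OF less.prems(1) True less.prems(3)] by blast
    obtain q where q: "length q = length p - 1" "set q \<subseteq> V.ge 0" "q \<noteq> [] \<Longrightarrow> hd q = hd p"
      "\<And>x. x \<in> carrier L \<Longrightarrow> eval p x = (x \<ominus> c) \<otimes> eval q x \<oplus> eval p c"
      by (rule synthetic_division[OF V.ge0_subring c(1) less.prems(1)]) blast
    have qn: "q \<noteq> []" using q(1) True by auto
    have cW: "c \<in> W.ge 0" "set q \<subseteq> W.ge 0" using c(1) q(2) ge0_W by auto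
    have a: "x \<ominus> c \<in> W.ge 0" "eval q x \<in> W.ge 0"
      using W.ge_minus less.prems(4) cW W.eval_ge0 by auto
    have pc: "eval p c \<in> W.gt 0" using c(2) gt0_W V.gtD(1) by auto
    have "y = (y \<oplus> z) \<ominus> z" if "y \<in> carrier L" "z \<in> carrier L" for y z using that by algebra
    then have "(x \<ominus> c) \<otimes> eval q x = eval p x \<ominus> eval p c"
      using q(4)[OF xc] a pc W.geD(1) W.gtD(1) by simp
    then have "(x \<ominus> c) \<otimes> eval q x \<in> W.gt 0" using W.gt_minus[OF less.prems(5) pc] by simp
    then consider "x \<ominus> c \<in> W.gt 0" | "eval q x \<in> W.gt 0" using W.gt0_prime[OF a] by blast
    then show ?thesis
    proof cases
      case 2
      have "length q < length p" using q(1) True by simp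
      then show ?thesis using less.hyps[of q] q(2,3) qn less.prems(3,4) 2 by auto
    qed (use c in auto)
  qed
qed

text \<open>The minimal polynomial of \<open>x\<close> over \<open>K\<close>, divided by a
  coefficient of least value, has coefficients in the valuation ring, one of them 1. Leading
  coefficients of positive value contribute nothing modulo the maximal ideal; once they are dropped,
  \<open>residue_approx_root\<close> applies.\<close>

lemma residue_trivial:
  assumes x: "x \<in> W.ge 0"
  obtains c where "c \<in> V.ge 0" "x \<ominus> c \<in> W.gt 0"
proof -
  have xc: "x \<in> carrier L" using W.geD(1)[OF x] .
  note I = Irr_props[OF V.F xc alg[OF xc]]
  let ?p = "Irr K x"
  have "hd ?p \<in> set ?p" using I(3) by (intro hd_in_set) auto
  then have "\<one> \<in> set ?p - {\<zero>}" using I(2) by auto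
  then obtain a where a: "a \<in> set ?p - {\<zero>}" and min: "\<And>b. b \<in> set ?p - {\<zero>} \<Longrightarrow> v a \<le> v b"
    using arg_min_if_finite[of "set ?p - {\<zero>}" v] by (metis List.finite_set empty_iff finite_Diff linorder_not_less)
  have aK: "a \<in> K - {\<zero>}" using a I(1) by auto
  note i = V.F_inv_nz[OF aK]
  define q where "q = map (\<lambda>b. inv a \<otimes> b) ?p"
  have qO: "set q \<subseteq> V.ge 0"
  proof
    fix y assume "y \<in> set q"
    then obtain b where b: "b \<in> set ?p" "y = inv a \<otimes> b" by (auto simp: q_def)
    show "y \<in> V.ge 0"
    proof (cases "b = \<zero>")
      case True
      then show ?thesis using b i V.F_carrier V.zero_ge by auto
    next
      case False
      then have "v y = v b - v a" using V.val_mult[OF i, of b] V.val_inv[OF aK] b I(1) by auto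
      then show ?thesis using min[of b] b False V.F_mult_nz[OF i, of b] I(1) by (intro V.geI) auto
    qed
  qed
  have "inv a \<otimes> a = \<one>" using subfield_m_inv(3)[OF V.F aK] .
  then have 1: "\<one> \<in> set q" using a by (force simp: q_def)
  have eq: "eval q x = \<zero>"
  proof -
    have ic: "inv a \<in> carrier L" using i V.F_carrier by auto
    have "eval (map (\<lambda>b. inv a \<otimes> b) p) x = inv a \<otimes> eval p x" if "set p \<subseteq> carrier L" for p
      using that
    proof (induction p)
      case (Cons b p)
      then show ?case using ic xc eval_in_carrier[of p x] by (simp add: r_distr m_assoc)
    qed (use ic in simp)
    moreover have "set ?p \<subseteq> carrier L" using I(1) V.F_carrier by auto
    ultimately show ?thesis using I(5) ic unfolding q_def by simp
  qed
  \<comment> \<open>The second part is nonempty because the entry 1 is never skipped, and its head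
    is a unit.\<close>
  let ?s = "takeWhile (\<lambda>y. y \<in> V.gt 0) q" and ?r = "dropWhile (\<lambda>y. y \<in> V.gt 0) q"
  have s: "set ?s \<subseteq> W.gt 0" using set_takeWhileD[of _ "\<lambda>y. y \<in> V.gt 0" q] gt0_W V.gtD(1) by fastforce
  have r: "set ?r \<subseteq> V.ge 0" using qO set_dropWhileD by fastforce
  have rn: "?r \<noteq> []" using 1 V.one_not_gt by (auto simp: dropWhile_eq_Nil_conv)
  have rh: "hd ?r \<notin> V.gt 0" using hd_dropWhile[OF rn] .
  have rW: "set ?r \<subseteq> W.ge 0" using r ge0_W by auto
  have car: "set ?s \<subseteq> carrier L" "set ?r \<subseteq> carrier L" using s rW W.gtD(1) W.geD(1) by auto
  have "eval ?s x \<otimes> x [^] length ?r \<oplus> eval ?r x = \<zero>"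
    using eval_append[OF car xc] eq by simp
  then have e: "eval ?r x = \<ominus> (eval ?s x \<otimes> x [^] length ?r)"
    using minus_equality[of "eval ?r x" "eval ?s x \<otimes> x [^] length ?r"] eval_in_carrier[OF car(1) xc] eval_in_carrier[OF car(2) xc] xc
    by (simp add: a_comm)
  have "x [^] m \<in> W.ge 0" for m :: nat
    by (induction m) (use W.one_ge W.ge_mult[of _ 0 x 0] x in auto)
  then have "eval ?r x \<in> W.gt 0" unfolding e using W.gt_neg W.gt0_mult(1) W.eval_gt0[OF s x] by blast
  then show ?thesis using residue_approx_root[OF r rn rh x] that by blast
qed

text \<open>The geometric sum in \<xi> is congruent to the integer \<open>m\<close>, a unit in
  residue characteristic 0. It is therefore nonzero, and the other factor of
  \<open>\<xi>^m - 1\<close> must vanish.\<close>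

lemma root_of_unity_close:
  assumes x: "\<xi> \<in> carrier L" "m > 0" "\<xi> [^] (m :: nat) = \<one>" and d: "\<xi> \<ominus> \<one> \<in> W.gt 0"
  shows "\<xi> = \<one>"
proof -
  let ?q = "replicate m \<one>"
  have q: "set ?q \<subseteq> W.ge 0" using W.one_ge by (simp add: set_replicate_conv_if)
  have xO: "\<xi> \<in> W.ge 0"
  proof -
    have "\<xi> = (\<xi> \<ominus> \<one>) \<oplus> \<one>" using x by algebra
    then show ?thesis using W.ge_add[OF W.gt_ge[OF d] W.one_ge] by simp
  qed
  have "(\<xi> \<ominus> \<one>) \<otimes> eval ?q \<xi> = \<zero>" using geometric_eval[OF x(1), of m] x(3) by (simp add: minus_eq r_neg)
  moreover have "eval ?q \<xi> \<noteq> \<zero>"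
  proof
    assume "eval ?q \<xi> = \<zero>"
    then have "\<ominus> ([m] \<cdot> \<one>) \<in> W.gt 0"
      using W.eval_cong_ge0[OF q xO W.one_ge d] eval_replicate_one[of m] by (simp add: minus_eq)
    then have "[m] \<cdot> \<one> \<in> W.gt 0" using W.gt_neg[of "\<ominus> ([m] \<cdot> \<one>)" 0] by simp
    then show False using gt0_W nat_nz(1)[OF x(2)] nat_residue[OF x(2)] by auto
  qed
  moreover have "eval ?q \<xi> \<in> carrier L" using eval_in_carrier[of ?q \<xi>] x by (simp add: set_replicate_conv_if)
  ultimately have "\<xi> \<ominus> \<one> = \<zero>" using integral[of "\<xi> \<ominus> \<one>"] x by auto
  then show ?thesis using x by simp
qed

text \<open>A conjugate of \<open>r\<close> over \<open>F\<close> has the same \<open>m\<close>-th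
  power, and also the same residue, since that residue comes from \<open>K\<close>. The quotient of
  the two is a root of unity congruent to 1, hence 1. So \<open>r\<close> is its only
  conjugate.\<close>

lemma unit_root_mem:
  assumes F: "finite_subfield F" and r: "r \<in> carrier L - {\<zero>}" "W r = 0" "m > 0" "r [^] (m :: nat) \<in> F"
  shows "r \<in> F"
proof -
  have sF: "subfield F L" "K \<subseteq> F" "F \<subseteq> carrier L"
    using F subfieldE(3) by (auto simp: finite_subfield_def)
  have rc: "r \<in> carrier L" using r by simp
  have rO: "r \<in> W.ge 0" using r by (auto simp: W.ge_def)
  obtain c where c: "c \<in> V.ge 0" "r \<ominus> c \<in> W.gt 0" using residue_trivial[OF rO] .
  have cF: "c \<in> F" "c \<in> carrier L" using V.geD(1)[OF c(1)] sF(2) V.F_carrier by auto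
  obtain zs where zs: "length zs = degree (Irr F r)" "set zs \<subseteq> carrier L" "zs \<noteq> []"
    "\<forall>z'\<in>set zs. eval (Irr F r) z' = \<zero>" "foldr (\<oplus>) zs \<zero> \<in> F" "foldr (\<lambda>z a. (\<ominus> z) \<otimes> a) zs \<one> \<in> F"
    by (rule conjugate_list[OF sF(1) rc algebraic_over[OF sF(1,2) rc]])
  have eq: "z = r" if z: "z \<in> set zs" for z
  proof -
    have zc: "z \<in> carrier L" "eval (Irr F r) z = \<zero>" using z zs by auto
    have zm: "z [^] m = r [^] m" using conjugate_pow[OF sF(1,2) rc r(3,4) zc] .
    have "z \<ominus> c \<in> W.gt 0" using conjugate_close[OF F rc zc cF(1) c(2)] .
    then have d: "(z \<ominus> c) \<ominus> (r \<ominus> c) \<in> W.gt 0" using W.gt_minus c(2) by auto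
    have i: "inv r \<in> carrier L - {\<zero>}" "r \<otimes> inv r = \<one>" using W.F_inv_nz[of r] r field_Units by auto
    have iO: "inv r \<in> W.ge 0" using i W.val_inv[of r] r by (auto simp: W.ge_def)
    have "z \<otimes> inv r \<ominus> r \<otimes> inv r = ((z \<ominus> c) \<ominus> (r \<ominus> c)) \<otimes> inv r"
    proof -
      have "z \<otimes> s \<ominus> r \<otimes> s = ((z \<ominus> c) \<ominus> (r \<ominus> c)) \<otimes> s" if "s \<in> carrier L" for s
        using that zc(1) rc cF(2) by algebra
      then show ?thesis using i(1) by blast
    qed
    then have "z \<otimes> inv r \<ominus> \<one> \<in> W.gt 0" using W.gt0_mult(1)[OF d iO] i by simp
    moreover have "(z \<otimes> inv r) [^] m = (r \<otimes> inv r) [^] m"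
      using zm zc(1) rc i(1) by (simp add: nat_pow_distrib)
    ultimately have "z \<otimes> inv r = \<one>" using root_of_unity_close[of "z \<otimes> inv r" m] r(3) zc(1) i by simp
    then have "z \<otimes> (inv r \<otimes> r) = r" using zc rc i by (simp add: m_assoc[symmetric])
    then show ?thesis using i zc rc by (simp add: m_comm)
  qed
  \<comment> \<open>The sum of the conjugates lies in \<open>F\<close> and is an integer multiple of
    \<open>r\<close> by a nonzero integer, which can be cancelled inside \<open>F\<close>.\<close>
  have "foldr (\<oplus>) zs \<zero> = [(length zs)] \<cdot> \<one> \<otimes> r"
    using eq
  proof (induction zs)
    case (Cons z zs)
    then have "z = r" "foldr (\<oplus>) zs \<zero> = [(length zs)] \<cdot> \<one> \<otimes> r" by auto
    then show ?case using rc by (simp add: l_distr a_comm)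
  qed (use rc in simp)
  then have "[(length zs)] \<cdot> \<one> \<otimes> r \<in> F" using zs(5) by simp
  moreover have "[(length zs)] \<cdot> \<one> \<in> F - {\<zero>}" using nat_nz(1)[of "length zs"] zs(3) sF(2) by auto
  ultimately show ?thesis using subfield_m_inv_simprule[OF sF(1) _ rc] by blast
qed

text \<open>Subtract from \<open>z\<close> the mean \<open>a\<close> of its conjugates over
  \<open>G\<close>. If something is left, the hypothesis approximates it by some \<open>c\<close> in
  \<open>G\<close>, and all conjugates of \<open>z\<close> are then close to the sum of
  \<open>a\<close> and \<open>c\<close>. So is their mean \<open>a\<close>, which would give
  \<open>c\<close> a value larger than its own.\<close>

lemma immediate_imp_subset:
  assumes G: "finite_subfield G" and E: "subring E L" "G \<subseteq> E"
    and imm: "\<And>y. y \<in> E - {\<zero>} \<Longrightarrow> \<exists>c\<in>G - {\<zero>}. y \<ominus> c \<in> W.gt (W c)"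
  shows "E \<subseteq> G"
proof
  fix z assume zE: "z \<in> E"
  have sG: "subfield G L" "K \<subseteq> G" "G \<subseteq> carrier L"
    using G subfieldE(3) by (auto simp: finite_subfield_def)
  have zc: "z \<in> carrier L" using zE subringE(1)[OF E(1)] by auto
  obtain zs where zs: "length zs = degree (Irr G z)" "set zs \<subseteq> carrier L" "zs \<noteq> []"
    "\<forall>z'\<in>set zs. eval (Irr G z) z' = \<zero>" "foldr (\<oplus>) zs \<zero> \<in> G" "foldr (\<lambda>z a. (\<ominus> z) \<otimes> a) zs \<one> \<in> G"
    by (rule conjugate_list[OF sG(1) zc algebraic_over[OF sG(1,2) zc]])
  let ?s = "foldr (\<oplus>) zs \<zero>" and ?m = "[(length zs)] \<cdot> \<one>"
  have m: "?m \<in> K - {\<zero>}" "W ?m = 0" using nat_nz[of "length zs"] zs(3) by auto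
  have mG: "?m \<in> G - {\<zero>}" using m sG by auto
  note i = subfield_m_inv[OF sG(1) mG]
  define a where "a = inv ?m \<otimes> ?s"
  have car: "?s \<in> carrier L" "inv ?m \<in> carrier L" "?m \<in> carrier L" using i m V.F_carrier subsetD[OF sG(3)] zs(5) by blast+
  have a: "a \<in> G" "a \<in> carrier L" "?m \<otimes> a = ?s"
    using i zs(5) subringE(6)[OF subfieldE(1)[OF sG(1)]] sG(3) car
    by (auto simp: a_def m_assoc[symmetric])
  show "z \<in> G"
  proof (rule ccontr)
    assume nz: "z \<notin> G"
    then have "z \<ominus> a \<in> E - {\<zero>}"
      using zE a E subringE[OF E(1)] zc by (auto simp: minus_eq dest: minus_equality)
    then obtain c where c: "c \<in> G - {\<zero>}" "(z \<ominus> a) \<ominus> c \<in> W.gt (W c)" using imm by blast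
    have cc: "c \<in> carrier L" "c \<noteq> \<zero>" using c subsetD[OF sG(3)] by auto
    have "z \<ominus> (a \<oplus> c) = (z \<ominus> a) \<ominus> c" using zc a cc by algebra
    then have zac: "z \<ominus> (a \<oplus> c) \<in> W.gt (W c)" using c by simp
    have acG: "a \<oplus> c \<in> G" using a c subringE(7)[OF subfieldE(1)[OF sG(1)]] by auto
    \<comment> \<open>The left-hand side is minus \<open>?m\<close> times \<open>c\<close>, and
      \<open>?m\<close> has value 0.\<close>
    have "?s \<ominus> ?m \<otimes> (a \<oplus> c) \<in> W.gt (W c)"
      by (rule W.sum_close) (use zs a cc conjugate_close[OF G zc _ _ acG zac] in auto)
    moreover have "(?m \<otimes> a) \<ominus> ?m \<otimes> (a \<oplus> c) = \<ominus> (?m \<otimes> c)" using car a cc by algebra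
    ultimately have "\<ominus> (?m \<otimes> c) \<in> W.gt (W c)" using a by simp
    then have "?m \<otimes> c \<in> W.gt (W c)" using W.gt_neg[of "\<ominus> (?m \<otimes> c)"] car cc by simp
    moreover have "?m \<otimes> c \<in> carrier L - {\<zero>}" "W (?m \<otimes> c) = W c"
      using W.F_mult_nz[of ?m c] W.val_mult[of ?m c] m V.F_carrier cc by auto
    ultimately show False using W.gtD(2)[of "?m \<otimes> c" "W c"] by auto
  qed
qed

end

text \<open>Cyclicity without the Galois group as an object, a form that is easy to carry along
  isomorphisms. The exponents are natural numbers, which is suited to a generator of finite
  order.\<close>

definition (in ring) cyclic_over :: "'a set \<Rightarrow> bool" where "cyclic_over K \<longleftrightarrow>
  (\<exists>\<sigma>. \<sigma> \<in> ring_hom R R \<and> bij_betw \<sigma> (carrier R) (carrier R) \<and>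
    (\<forall>x\<in>carrier R. \<sigma> x = x \<longleftrightarrow> x \<in> K) \<and>
    (\<forall>\<tau>. \<tau> \<in> ring_hom R R \<longrightarrow> (\<forall>x\<in>K. \<tau> x = x) \<longrightarrow> (\<exists>k :: nat. \<forall>x\<in>carrier R. \<tau> x = (\<sigma> ^^ k) x)))"

lemma (in cring) finsum_pow_eq_eval:
  "y \<in> carrier R \<Longrightarrow> (\<Oplus>j\<in>{..<n}. y [^] (j :: nat)) = eval (replicate n \<one>) y"
  by (induction n) (auto simp: lessThan_Suc)

section \<open>Kummer generators of finite subfields\<close>

context henselian_closure
begin

lemma finite_subfield_memD: "finite_subfield F \<Longrightarrow> x \<in> F \<Longrightarrow> x \<in> carrier L"
  using subfieldE(3) by (auto simp: finite_subfield_def)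

lemma W_uniformizer_root:
  assumes "uniformizer_root L K v \<pi> \<alpha> n"
  shows "W \<alpha> = 1 / of_nat n"
proof -
  interpret U: uniformizer_root L K v \<pi> \<alpha> n by (rule assms)
  have "of_nat n * W \<alpha> = 1"
    using W.val_pow[of \<alpha> n] U.al U.alpha_nz W_base[OF U.pi(1)] U.pi(2) by simp
  then show ?thesis using U.n by (simp add: field_simps)
qed

text \<open>The \<open>l\<close>-th power of \<beta> is \<pi> times a unit \<open>u\<close> of
  \<open>F\<close>. An \<open>l\<close>-th root \<open>r\<close> of \<open>u\<close> has value 0, so
  \<open>unit_root_mem\<close> puts it in \<open>F\<close>, and \<beta> is corrected by dividing by
  \<open>r\<close>.\<close>

lemma ex_root_of_uniformizer:
  assumes F: "finite_subfield F" and b: "\<beta> \<in> F - {\<zero>}" "W \<beta> = 1 / of_nat l" and l: "l > 0"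
    and pi: "\<pi> \<in> K - {\<zero>}" "v \<pi> = 1"
  obtains \<alpha> where "\<alpha> \<in> F" "\<alpha> [^] l = \<pi>"
proof -
  have sF: "subfield F L" "K \<subseteq> F" using F by (auto simp: finite_subfield_def)
  note sub = subringE[OF subfieldE(1)[OF sF(1)]]
  have bc: "\<beta> \<in> carrier L - {\<zero>}" using b F finite_subfield_memD by auto
  have piF: "\<pi> \<in> F - {\<zero>}" "\<pi> \<in> carrier L - {\<zero>}" using pi sF(2) V.F_carrier by auto
  note i = subfield_m_inv[OF sF(1) piF(1)]
  have ic: "inv \<pi> \<in> carrier L - {\<zero>}" using W.F_inv_nz[OF piF(2)] .
  have bl: "\<beta> [^] l \<in> F" for l :: nat by (induction l) (use b sub in auto)
  define u where "u = \<beta> [^] l \<otimes> inv \<pi>"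
  have u: "u \<in> F" "u \<in> carrier L - {\<zero>}" "W u = 0"
  proof -
    show "u \<in> F" using bl i sub by (auto simp: u_def)
    show "u \<in> carrier L - {\<zero>}" unfolding u_def by (rule W.F_mult_nz[OF W.F_pow_nz[OF bc] ic])
    show "W u = 0"
      unfolding u_def using W.val_mult[OF W.F_pow_nz[OF bc] ic] W.val_pow[OF bc, of l] W.val_inv[OF piF(2)]
        W_base[OF pi(1)] pi(2) b(2) l by simp
  qed
  obtain r where r: "r \<in> carrier L" "r [^] l = u" using ex_nth_root[OF l, of u] u(2) by auto
  have rn: "r \<in> carrier L - {\<zero>}" using r u(2) l by (auto simp: nat_pow_zero)
  have "of_nat l * W r = 0" using W.val_pow[OF rn, of l] r(2) u(3) by simp
  then have rF: "r \<in> F" using unit_root_mem[OF F rn _ l] r(2) u(1) l by simp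
  note j = subfield_m_inv[OF sF(1), of r]
  have jr: "inv r \<in> F" "r \<otimes> inv r = \<one>" "inv r \<in> carrier L" using j rF rn finite_subfield_memD[OF F] by auto
  have "\<beta> [^] l = r [^] l \<otimes> \<pi>" using r(2) i bc ic piF by (simp add: u_def m_assoc)
  then have "(\<beta> \<otimes> inv r) [^] l = (r \<otimes> inv r) [^] l \<otimes> \<pi>"
    using bc jr(3) r(1) piF(2) by (simp add: nat_pow_distrib m_ac)
  then have "(\<beta> \<otimes> inv r) [^] l = \<pi>" using jr piF by simp
  moreover have "\<beta> \<otimes> inv r \<in> F" using b jr sub by auto
  ultimately show ?thesis using that by blast
qed

text \<open>Choose \<open>e\<close> maximal such that \<open>F\<close> contains an \<open>e\<close>-th root of \<open>\<pi>\<close>. A value \<open>a / b\<close> of \<open>F\<close>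
  together with \<open>1\<close> and \<open>1 / e\<close> generates the value \<open>1 / lcm\<close>, so \<open>a / b\<close> is a multiple of \<open>1 / e\<close>.\<close>

lemma finite_subfield_eq_simple_extension:
  assumes F: "finite_subfield F" and pi: "\<pi> \<in> K - {\<zero>}" "v \<pi> = 1"
  obtains \<alpha> e where "uniformizer_root L K v \<pi> \<alpha> e" "F = simple_extension K \<alpha>"
proof -
  have sF: "subfield F L" "K \<subseteq> F" using F by (auto simp: finite_subfield_def)
  note sub = subringE[OF subfieldE(1)[OF sF(1)]]
  obtain n where n: "n > 0" "dimension n K F" using finite_subfield_dimension[OF F] .
  let ?S = "{e. e > 0 \<and> (\<exists>\<alpha>\<in>F. \<alpha> [^] (e :: nat) = \<pi>)}"
  have piF: "\<pi> \<in> F" using pi sF by auto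
  \<comment> \<open>An \<open>e\<close>-th root of \<pi> has degree \<open>e\<close> over
    \<open>K\<close>, so \<open>e\<close> divides the dimension of \<open>F\<close>.\<close>
  have bound: "e \<le> n" if e: "e \<in> ?S" for e
  proof -
    obtain \<alpha> where a: "\<alpha> \<in> F" "\<alpha> [^] e = \<pi>" "e > 0" using e by auto
    interpret U: uniformizer_root L K v \<pi> \<alpha> e
      using uniformizer_rootI[OF pi a(3) finite_subfield_memD[OF F a(1)] a(2)] .
    have "e dvd n" using degree_Irr_dvd[OF V.F sF n(2) a(1)] U.degree_Irr by simp
    then show ?thesis using n(1) by (rule dvd_imp_le)
  qed
  then have fin: "finite ?S" by (meson finite_nat_set_iff_bounded_le)
  have "1 \<in> ?S" using piF finite_subfield_memD[OF F] by (auto intro!: bexI[of _ \<pi>])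
  then have ne: "?S \<noteq> {}" by (metis empty_iff)
  define e where "e = Max ?S"
  have eS: "e \<in> ?S" and emax: "\<And>l. l \<in> ?S \<Longrightarrow> l \<le> e" using Max_in[OF fin ne] Max_ge[OF fin] by (auto simp: e_def)
  obtain \<alpha> where a: "\<alpha> \<in> F" "\<alpha> [^] e = \<pi>" "e > 0" using eS by auto
  have ac: "\<alpha> \<in> carrier L" using finite_subfield_memD[OF F a(1)] .
  have UR: "uniformizer_root L K v \<pi> \<alpha> e" using uniformizer_rootI[OF pi a(3) ac a(2)] .
  interpret U: uniformizer_root L K v \<pi> \<alpha> e by (rule UR)
  let ?G = "simple_extension K \<alpha>"
  have GF: "?G \<subseteq> F" using simple_extension_subring_incl[OF subfieldE(1)[OF sF(1)] sF(2) a(1)] .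
  have Wa: "W \<alpha> = 1 / of_nat e" using W_uniformizer_root[OF UR] .
  have fvF: "field_val L F' W" if "finite_subfield F'" for F'
  proof (intro field_val.intro[OF field_axioms field_val_axioms.intro] W.val_mult W.val_add)
    show "subfield F' L" using that by (simp add: finite_subfield_def)
  qed (use finite_subfield_memD[OF that] in auto)
  interpret WF: field_val L F W by (rule fvF[OF F])
  interpret WG: field_val L ?G W by (rule fvF[OF U.F_finite(1)])
  have aF: "\<alpha> \<in> F - {\<zero>}" "\<alpha> \<in> ?G - {\<zero>}" using a U.alpha_nz U.F_finite(3) by auto
  have imm: "\<exists>c\<in>?G - {\<zero>}. y \<ominus> c \<in> W.gt (W c)" if y: "y \<in> F - {\<zero>}" for y
  proof -
    obtain p q where pq: "q > 0" "W y = of_int p / of_int q"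
      using quotient_of_div[of "W y"] quotient_of_denom_pos[of "W y"] by (metis surj_pair)
    \<comment> \<open>Bezout coefficients combine the value \<open>p / q\<close> of \<open>y\<close>
      with the value \<open>1 / e\<close> of \<alpha> into \<open>1 / (e m)\<close>, where
      \<open>m\<close> is the quotient of \<open>q\<close> by the greatest common divisor.\<close>
    obtain s t where st: "s * (p * int e) + t * q = gcd (p * int e) q" using bezout_int by blast
    define g where "g = gcd (p * int e) q"
    have g: "g > 0" "g dvd q" "g dvd p * int e" using pq(1) by (auto simp: g_def)
    obtain m where m: "q = g * m" using g(2) by auto
    have m0: "m > 0" using m pq(1) g(1) by (simp add: zero_less_mult_iff)
    obtain y' where y': "y' \<in> F - {\<zero>}" "W y' = of_int s * W y" using WF.ex_val_multiple[OF y] .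
    obtain a' where a': "a' \<in> F - {\<zero>}" "W a' = of_int t * W \<alpha>" using WF.ex_val_multiple[OF aF(1)] .
    let ?l = "e * nat m"
    have "W (y' \<otimes> a') = of_int s * (of_int p / of_int q) + of_int t / of_nat e"
      using WF.val_mult[OF y'(1) a'(1)] y'(2) a'(2) pq(2) Wa by simp
    also have "\<dots> = of_int (s * (p * int e) + t * q) / (of_int q * of_nat e)"
      using pq(1) a(3) by (simp add: field_simps)
    also have "\<dots> = of_int g / (of_int q * of_nat e)" using st by (simp add: g_def)
    also have "\<dots> = 1 / of_nat ?l" using m m0 g(1) a(3) by (simp add: field_simps)
    finally have "W (y' \<otimes> a') = 1 / of_nat ?l" .
    moreover have "?l > 0" using m0 a(3) by simp
    ultimately obtain \<alpha>' where "\<alpha>' \<in> F" "\<alpha>' [^] ?l = \<pi>"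
      using ex_root_of_uniformizer[OF F WF.F_mult_nz[OF y'(1) a'(1)] _ _ pi] by blast
    then have "?l \<in> ?S" using \<open>?l > 0\<close> by blast
    then have "?l \<le> e" by (rule emax)
    \<comment> \<open>Maximality of \<open>e\<close> leaves no room for \<open>m\<close>; now
      \<open>q\<close> divides \<open>p * int e\<close>, so \<open>W y\<close> is a multiple of
      \<open>1 / e\<close>.\<close>
    then have "m = 1" using m0 a(3) by simp
    then have "q dvd p * int e" using g m by simp
    then obtain k where k: "p * int e = q * k" by auto
    have "W y * of_nat e = of_int k"
    proof -
      have "(of_int p * of_nat e :: rat) = of_int q * of_int k"
        using arg_cong[OF k, of "of_int :: int \<Rightarrow> rat"] by simp
      then have "of_int p * of_nat e / of_int q = (of_int k :: rat)" using pq(1) by simp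
      then show ?thesis using pq(2) by simp
    qed
    then have "W y = of_int k / of_nat e" using a(3) by (simp add: field_simps)
    then have Wy: "W y = of_int k * W \<alpha>" by (simp add: Wa)
    \<comment> \<open>An element of \<open>?G\<close> with the value of \<open>y\<close>: the
      quotient of \<open>y\<close> by \<open>d\<close> is a unit, its residue is represented by some
      \<open>c\<close> in \<open>K\<close>, and the product of \<open>c\<close> and \<open>d\<close>
      approximates \<open>y\<close>.\<close>
    obtain d where d: "d \<in> ?G - {\<zero>}" "W d = of_int k * W \<alpha>" using WG.ex_val_multiple[OF aF(2)] .
    have dc: "d \<in> carrier L - {\<zero>}" and yc: "y \<in> carrier L - {\<zero>}"
      using d y finite_subfield_memD[OF U.F_finite(1)] finite_subfield_memD[OF F] by auto
    have i: "inv d \<in> carrier L - {\<zero>}" "inv d \<otimes> d = \<one>" using W.F_inv_nz[OF dc] dc field_Units by auto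
    have z: "y \<otimes> inv d \<in> carrier L - {\<zero>}" "W (y \<otimes> inv d) = 0"
      using W.F_mult_nz[OF yc i(1)] W.val_mult[OF yc i(1)] W.val_inv[OF dc] Wy d(2) by auto
    have "y \<otimes> inv d \<in> W.ge 0" using z by (auto simp: W.ge_def)
    then obtain c where c: "c \<in> V.ge 0" "y \<otimes> inv d \<ominus> c \<in> W.gt 0" using residue_trivial by blast
    have cK: "c \<in> K" "c \<in> carrier L" using V.geD(1)[OF c(1)] V.F_carrier by auto
    have cn: "c \<noteq> \<zero>" "W c = 0"
    proof -
      have e1: "c \<ominus> y \<otimes> inv d = \<ominus> (y \<otimes> inv d \<ominus> c)"
      proof -
        have "c \<ominus> x = \<ominus> (x \<ominus> c)" if "x \<in> carrier L" for x using that cK(2) by algebra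
        then show ?thesis using z(1) by blast
      qed
      have "c \<ominus> y \<otimes> inv d \<in> W.gt 0" unfolding e1 using W.gt_neg[OF c(2)] .
      then show "c \<noteq> \<zero>" "W c = 0" using W.val_close[OF z(1), of c] z(2) cK(2) by auto
    qed
    have cdG: "c \<otimes> d \<in> ?G - {\<zero>}"
      using WG.F_mult_nz[of c d] cK(1) cn(1) d(1) U.F_finite(2) by auto
    have Wcd: "W (c \<otimes> d) = W d" using W.val_mult[of c d] cK(2) cn dc by auto
    have "y \<ominus> c \<otimes> d = (y \<otimes> inv d \<ominus> c) \<otimes> d"
    proof -
      have "y \<otimes> (s \<otimes> d) \<ominus> c \<otimes> d = (y \<otimes> s \<ominus> c) \<otimes> d" if "s \<in> carrier L" for s
        using that DiffD1[OF yc] DiffD1[OF dc] cK(2) by algebra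
      then show ?thesis using i yc by (metis DiffD1 r_one)
    qed
    moreover have "d \<in> W.ge (W d)" using dc by (auto simp: W.ge_def)
    ultimately have "y \<ominus> c \<otimes> d \<in> W.gt (W (c \<otimes> d))"
      using W.gt_mult_ge[OF c(2), of d "W d"] Wcd by simp
    then show ?thesis using cdG by blast
  qed
  have "F \<subseteq> ?G" using immediate_imp_subset[OF U.F_finite(1) subfieldE(1)[OF sF(1)] GF imm] .
  then show ?thesis using that[OF UR] GF by blast
qed

text \<open>Kummer theory for \<open>\<alpha>^e = \<pi>\<close>: the generator multiplies \<alpha>
  by a primitive \<open>e\<close>-th root of unity \<zeta> in \<open>K\<close>.\<close>

lemma cyclic_finite_subfield:
  assumes F: "finite_subfield F"
  shows "ring.cyclic_over (L\<lparr>carrier := F\<rparr>) K"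
proof -
  obtain \<pi> where pi: "\<pi> \<in> K - {\<zero>}" "v \<pi> = 1" by (rule ex_uniformizer)
  obtain \<alpha> e where UR: "uniformizer_root L K v \<pi> \<alpha> e" and FG: "F = simple_extension K \<alpha>"
    using finite_subfield_eq_simple_extension[OF F pi] .
  interpret U: uniformizer_root L K v \<pi> \<alpha> e by (rule UR)
  have sF: "subfield F L" "K \<subseteq> F" using F by (auto simp: finite_subfield_def)
  note sub = subringE[OF subfieldE(1)[OF sF(1)]]
  have Fc: "\<And>x. x \<in> F \<Longrightarrow> x \<in> carrier L" using finite_subfield_memD[OF F] .
  interpret LF: ring "L\<lparr>carrier := F\<rparr>" using subring_is_ring[OF subfieldE(1)[OF sF(1)]] .
  have aF: "\<alpha> \<in> F" "\<alpha> \<noteq> \<zero>" "\<alpha> \<in> carrier L" using U.F_finite(3) FG U.alpha_nz U.al by auto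
  have elem: "\<exists>p. set p \<subseteq> K \<and> x = eval p \<alpha>" if "x \<in> F" for x
  proof -
    obtain p where p: "p \<in> carrier (K[X])" "x = eval p \<alpha>"
      using \<open>x \<in> F\<close> simple_extension_as_eval_img[OF subfieldE(3)[OF V.F] aF(3)] FG by auto
    then have "set p \<subseteq> K" unfolding sym[OF univ_poly_carrier] polynomial_def by auto
    then show ?thesis using p(2) by blast
  qed
  obtain \<zeta> where z: "\<zeta> \<in> carrier L" "\<And>i :: nat. \<zeta> [^] i = \<one> \<longleftrightarrow> e dvd i"
    using ex_primitive_root[OF _ U.n] nat_nz(1) by blast
  have ze: "\<zeta> [^] e = \<one>" using z(2) by simp
  \<comment> \<open>A root of unity has value 0 and its \<open>e\<close>-th power 1 lies in
    \<open>K\<close>, so \<open>unit_root_mem\<close> applies with base field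
    \<open>K\<close>.\<close>
  have root_K: "\<xi> \<in> K" if x: "\<xi> \<in> carrier L" "\<xi> [^] e = \<one>" for \<xi>
  proof -
    have xn: "\<xi> \<in> carrier L - {\<zero>}" using x U.n by (auto simp: nat_pow_zero)
    have "of_nat e * W \<xi> = 0" using W.val_pow[OF xn, of e] x(2) W.val_one by simp
    then show ?thesis using unit_root_mem[OF finite_subfield_base xn _ U.n] x(2) V.F_sub U.n by simp
  qed
  have zK: "\<zeta> \<in> K" using root_K z(1) ze by blast
  have zF: "\<zeta> [^] k \<otimes> \<alpha> \<in> F" for k :: nat
    using sub(6)[OF subsetD[OF sF(2) V.F_pow[OF zK]] aF(1)] .
  have zaF: "\<zeta> \<otimes> \<alpha> \<in> F" using zF[of 1] z(1) by simp
  have pc: "\<pi> \<in> carrier L" using pi V.F_carrier by auto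
  note X = X_pow_minus_props[OF U.n pc]
  note a = alg[OF aF(3)]
  note I = IrrE[OF V.F aF(3) a]
  let ?q = "X_pow_minus e \<pi>"
  have qK: "set ?q \<subseteq> K" using X(5)[OF subfieldE(1)[OF V.F]] pi by auto
  \<comment> \<open>The minimal polynomial of \<alpha> divides \<open>X^e - \<pi>\<close> and has
    the same degree \<open>e\<close>, so the two differ by a constant factor, and \<zeta> times
    \<alpha> is a root of the second.\<close>
  have "eval (Irr K \<alpha>) (\<zeta> \<otimes> \<alpha>) = \<zero>"
  proof -
    have ql: "?q \<noteq> []" using X(1) by auto
    then have qc: "?q \<in> carrier (K[X])"
      using qK X(2) unfolding sym[OF univ_poly_carrier] polynomial_def by auto
    have "eval ?q \<alpha> = \<zero>" using X(4)[OF aF(3)] U.al pc by (simp add: minus_eq r_neg)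
    then have "Irr K \<alpha> pdivides ?q" using Irr_minimal[OF V.F aF(3) a qc] by simp
    then have "Irr K \<alpha> divides\<^bsub>K[X]\<^esub> ?q" using pdivides_iff_shell[OF V.F I(1) qc] by simp
    then obtain r where r: "r \<in> carrier (K[X])" "?q = poly_mult (Irr K \<alpha>) r"
      unfolding factor_def univ_poly_mult by auto
    have rK: "polynomial K r" "polynomial K (Irr K \<alpha>)" using r(1) I(1) univ_poly_carrier by blast+
    have In: "Irr K \<alpha> \<noteq> []" using U.degree_Irr U.n by auto
    have rn: "r \<noteq> []"
    proof
      assume "r = []"
      then have "?q = []" using r(2) poly_mult_zero(2)[of "Irr K \<alpha>"] polynomial_in_carrier[OF subfieldE(1)[OF V.F] rK(2)]
        by (simp del: poly_mult.simps)
      then show False using ql by simp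
    qed
    have "degree ?q = degree (Irr K \<alpha>) + degree r"
      using poly_mult_degree_eq[OF subfieldE(1)[OF V.F] rK(2,1)] rn In r(2) by (simp del: poly_mult.simps)
    then have "degree r = 0" using X(1) U.degree_Irr by simp
    then obtain k where k: "r = [k]" using rn by (cases r) auto
    then have kK: "k \<in> K - {\<zero>}" using rK(1) unfolding polynomial_def by auto
    have kc: "k \<in> carrier L" "k \<noteq> \<zero>" using kK V.F_carrier by auto
    have zac: "\<zeta> \<otimes> \<alpha> \<in> carrier L" using z(1) aF by simp
    have Ic: "set (Irr K \<alpha>) \<subseteq> carrier L" using polynomial_in_carrier[OF subfieldE(1)[OF V.F] rK(2)] .
    have "eval ?q (\<zeta> \<otimes> \<alpha>) = \<zero>"
      using X(4)[OF zac] U.al ze z(1) pc by (simp add: nat_pow_distrib minus_eq r_neg)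
    moreover have "eval ?q (\<zeta> \<otimes> \<alpha>) = eval (Irr K \<alpha>) (\<zeta> \<otimes> \<alpha>) \<otimes> k"
      unfolding r(2) k using eval_poly_mult[OF Ic _ zac, of "[k]"] kc zac by (simp del: poly_mult.simps)
    ultimately show ?thesis
      using integral[of "eval (Irr K \<alpha>) (\<zeta> \<otimes> \<alpha>)" k] eval_in_carrier[OF Ic zac] kc by auto
  qed
  then obtain \<sigma> where \<sigma>: "\<sigma> \<in> ring_hom (L\<lparr>carrier := F\<rparr>) L" "\<And>c. c \<in> K \<Longrightarrow> \<sigma> c = c" "\<sigma> \<alpha> = \<zeta> \<otimes> \<alpha>"
    "\<And>p. set p \<subseteq> K \<Longrightarrow> \<sigma> (eval p \<alpha>) = eval p (\<zeta> \<otimes> \<alpha>)"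
    using conjugate_hom[OF V.F aF(3) a, of "\<zeta> \<otimes> \<alpha>"] z(1) aF(3) unfolding FG by (metis m_closed)
  have eF: "eval p x \<in> F" if "set p \<subseteq> K" "x \<in> F" for p x
    using eval_in_subring[OF subfieldE(1)[OF sF(1)] _ that(2), of p] that(1) sF(2) by auto
  have \<sigma>F: "\<sigma> x \<in> F" if "x \<in> F" for x
  proof -
    obtain p where p: "set p \<subseteq> K" "x = eval p \<alpha>" using elem[OF \<open>x \<in> F\<close>] by auto
    show ?thesis using \<sigma>(4)[OF p(1)] eF[OF p(1) zaF] p(2) by simp
  qed
  have hom: "\<sigma> \<in> ring_hom (L\<lparr>carrier := F\<rparr>) (L\<lparr>carrier := F\<rparr>)"
    using \<sigma>(1) \<sigma>F by (auto simp: ring_hom_def)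
  have hom_eval: "\<tau> (eval p x) = eval p (\<tau> x)"
    if "\<tau> \<in> ring_hom (L\<lparr>carrier := F\<rparr>) (L\<lparr>carrier := F\<rparr>)" "\<forall>x\<in>K. \<tau> x = x" "set p \<subseteq> K" "x \<in> F" for \<tau> p x
  proof -
    have "\<tau> \<in> ring_hom (L\<lparr>carrier := F\<rparr>) L" using that(1) Fc by (auto simp: ring_hom_def)
    then show ?thesis using hom_eval_fixed[OF subfieldE(1)[OF sF(1)] _ _ sF(2) that(4,3)] that(2) by blast
  qed
  have iter: "(\<sigma> ^^ k) \<alpha> = \<zeta> [^] k \<otimes> \<alpha>" for k
  proof (induction k)
    case (Suc k)
    have "\<sigma> (\<zeta> [^] k \<otimes> \<alpha>) = \<zeta> [^] k \<otimes> (\<zeta> \<otimes> \<alpha>)"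
      using ring_hom_mult[OF \<sigma>(1), of "\<zeta> [^] k" \<alpha>] \<sigma>(2,3) V.F_pow[OF zK] sF(2) aF by auto
    then show ?case using Suc z(1) aF by (simp add: m_assoc)
  qed (use aF in simp)
  have iter_eval: "(\<sigma> ^^ k) (eval p \<alpha>) = eval p (\<zeta> [^] k \<otimes> \<alpha>)" if "set p \<subseteq> K" for k p
  proof (induction k)
    case (Suc k)
    then show ?case
      using hom_eval[OF hom _ that zF[of k]] \<sigma>(2) iter[of k] iter[of "Suc k"] by simp
  qed (use aF in simp)
  have fixed: "x \<in> K" if x: "x \<in> F" "\<sigma> x = x" for x
  proof -
    obtain p where p: "set p \<subseteq> K" "x = eval p \<alpha>" using elem[OF x(1)] by auto
    \<comment> \<open>This sum is the trace of \<open>x\<close>. When \<open>x\<close> is fixed by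
      \<sigma>, every summand is \<open>x\<close>, so \<open>e\<close> times \<open>x\<close> lies
      in \<open>K\<close>, and \<open>e\<close> is invertible there.\<close>
    have "(\<Oplus>j\<in>{..<e}. eval p (\<zeta> [^] j \<otimes> \<alpha>)) \<in> K" using p(1)
    proof (induction p)
      case Nil
      then show ?case using V.F_sub by simp
    next
      case (Cons b p)
      then have b: "b \<in> K" "b \<in> carrier L" and pK: "set p \<subseteq> K" using V.F_carrier by auto
      let ?m = "length p"
      have ec: "eval p (\<zeta> [^] j \<otimes> \<alpha>) \<in> carrier L" for j :: nat using Fc eF[OF pK zF] by simp
      have "(\<Oplus>j\<in>{..<e}. eval (b # p) (\<zeta> [^] j \<otimes> \<alpha>)) =
        (\<Oplus>j\<in>{..<e}. (b \<otimes> \<alpha> [^] ?m) \<otimes> (\<zeta> [^] ?m) [^] j \<oplus> eval p (\<zeta> [^] j \<otimes> \<alpha>))"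
        using b z(1) aF(3) ec
        by (intro finsum_cong') (auto simp: nat_pow_distrib nat_pow_pow m_ac mult.commute)
      also have "\<dots> = (\<Oplus>j\<in>{..<e}. (b \<otimes> \<alpha> [^] ?m) \<otimes> (\<zeta> [^] ?m) [^] j) \<oplus> (\<Oplus>j\<in>{..<e}. eval p (\<zeta> [^] j \<otimes> \<alpha>))"
        using b z(1) aF(3) ec by (intro finsum_addf) auto
      also have "(\<Oplus>j\<in>{..<e}. (b \<otimes> \<alpha> [^] ?m) \<otimes> (\<zeta> [^] ?m) [^] j) =
        (b \<otimes> \<alpha> [^] ?m) \<otimes> (\<Oplus>j\<in>{..<e}. (\<zeta> [^] ?m) [^] j)"
        using b z(1) aF(3) by (intro finsum_rdistr[symmetric]) auto
      also have "(\<Oplus>j\<in>{..<e}. (\<zeta> [^] ?m) [^] j) = eval (replicate e \<one>) (\<zeta> [^] ?m)"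
        using finsum_pow_eq_eval z(1) by simp
      finally have eq: "(\<Oplus>j\<in>{..<e}. eval (b # p) (\<zeta> [^] j \<otimes> \<alpha>)) =
        (b \<otimes> \<alpha> [^] ?m) \<otimes> eval (replicate e \<one>) (\<zeta> [^] ?m) \<oplus> (\<Oplus>j\<in>{..<e}. eval p (\<zeta> [^] j \<otimes> \<alpha>))" .
      \<comment> \<open>Exponents divisible by \<open>e\<close> give powers of \<pi> with weight
        \<open>e\<close>; for the others the sum of the powers of a nontrivial \<open>e\<close>-th
        root of unity vanishes.\<close>
      have "(b \<otimes> \<alpha> [^] ?m) \<otimes> eval (replicate e \<one>) (\<zeta> [^] ?m) \<in> K"
      proof (cases "e dvd ?m")
        case True
        then obtain k where k: "?m = e * k" by auto
        have "\<alpha> [^] ?m = \<pi> [^] k" unfolding k using U.al by (simp add: nat_pow_pow[symmetric])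
        then have "\<alpha> [^] ?m \<in> K" using V.F_pow pi by simp
        moreover have "\<zeta> [^] ?m = \<one>" using z(2) True by simp
        then have "eval (replicate e \<one>) (\<zeta> [^] ?m) \<in> K"
          using eval_replicate_one V.geD(1)[OF V.nat_ge0] by simp
        ultimately show ?thesis using b V.F_sub by simp
      next
        case False
        let ?y = "\<zeta> [^] ?m"
        have y: "?y \<in> carrier L" "?y \<noteq> \<one>" using z False by auto
        have "?y [^] e = \<one>" using z(1) z(2)[of "?m * e"] by (simp add: nat_pow_pow)
        then have "(?y \<ominus> \<one>) \<otimes> eval (replicate e \<one>) ?y = \<zero>"
          using geometric_eval[OF y(1)] by (simp add: minus_eq r_neg)
        moreover have "eval (replicate e \<one>) ?y \<in> carrier L"
          using eval_in_carrier[of "replicate e \<one>" ?y] y(1) by (simp add: set_replicate_conv_if)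
        ultimately have "eval (replicate e \<one>) ?y = \<zero>" using integral[of "?y \<ominus> \<one>"] y by auto
        then show ?thesis using b aF V.F_sub by simp
      qed
      then show ?case unfolding eq using Cons.IH[OF pK] V.F_sub by simp
    qed
    moreover have "eval p (\<zeta> [^] j \<otimes> \<alpha>) = x" for j :: nat
    proof -
      have "(\<sigma> ^^ j) x = x" by (induction j) (use x in auto)
      then show ?thesis using iter_eval[OF p(1), of j] p(2) by simp
    qed
    ultimately have "(\<Oplus>j\<in>{..<e}. x) \<in> K" by simp
    moreover have xc: "x \<in> carrier L" using Fc x(1) .
    have "(\<Oplus>j\<in>{..<k}. x) = [k] \<cdot> \<one> \<otimes> x" for k :: nat
      by (induction k) (use xc in \<open>auto simp: lessThan_Suc l_distr a_comm\<close>)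
    ultimately have "[e] \<cdot> \<one> \<otimes> x \<in> K" by simp
    then show ?thesis using subfield_m_inv_simprule[OF V.F nat_nz(1)[OF U.n] xc] by simp
  qed
  have order: "(\<sigma> ^^ e) x = x" if "x \<in> F" for x
  proof -
    obtain p where p: "set p \<subseteq> K" "x = eval p \<alpha>" using elem[OF \<open>x \<in> F\<close>] by auto
    then show ?thesis using iter_eval[OF p(1), of e] ze aF by simp
  qed
  have bij: "bij_betw \<sigma> F F"
  proof -
    have it: "(\<sigma> ^^ k) x \<in> F" if "x \<in> F" for k x by (induction k) (use that \<sigma>F in auto)
    have e: "e = Suc (e - 1)" using U.n by simp
    show ?thesis
    proof (rule bij_betw_byWitness[where f' = "\<sigma> ^^ (e - 1)"])
      show "\<forall>a\<in>F. (\<sigma> ^^ (e - 1)) (\<sigma> a) = a"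
        using order e by (metis funpow_Suc_right comp_apply)
      show "\<forall>a\<in>F. \<sigma> ((\<sigma> ^^ (e - 1)) a) = a"
        using order e by (metis funpow.simps(2) comp_apply)
    qed (use \<sigma>F it in auto)
  qed
  \<comment> \<open>A homomorphism over \<open>K\<close> is determined by the image of \<alpha>.
    That image is an \<open>e\<close>-th root of \<pi>, hence \<alpha> times a power of
    \<zeta>.\<close>
  have all: "\<exists>k :: nat. \<forall>x\<in>F. \<tau> x = (\<sigma> ^^ k) x"
    if \<tau>: "\<tau> \<in> ring_hom (L\<lparr>carrier := F\<rparr>) (L\<lparr>carrier := F\<rparr>)" "\<forall>x\<in>K. \<tau> x = x" for \<tau>
  proof -
    have t: "\<tau> \<alpha> \<in> F" using ring_hom_closed[OF \<tau>(1), of \<alpha>] aF by simp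
    have pw: "\<tau> (\<alpha> [^] k) = \<tau> \<alpha> [^] k \<and> \<alpha> [^] k \<in> F" for k :: nat
      by (induction k) (use ring_hom_one[OF \<tau>(1)] ring_hom_mult[OF \<tau>(1)] aF sub in auto)
    have te: "\<tau> \<alpha> [^] e = \<alpha> [^] e" using pw[of e] U.al \<tau>(2) pi by simp
    have ia: "inv \<alpha> \<in> carrier L" "\<alpha> \<otimes> inv \<alpha> = \<one>" "inv \<alpha> \<otimes> \<alpha> = \<one>"
      using aF field_Units by auto
    have "(\<tau> \<alpha> \<otimes> inv \<alpha>) [^] e = (\<alpha> \<otimes> inv \<alpha>) [^] e"
      using te aF(3) Fc[OF t] ia(1) by (simp add: nat_pow_distrib)
    then have q1: "(\<tau> \<alpha> \<otimes> inv \<alpha>) [^] e = \<one>" using ia by simp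
    have qc: "\<tau> \<alpha> \<otimes> inv \<alpha> \<in> carrier L" using Fc[OF t] ia(1) by simp
    obtain k where "k < e" and k: "\<tau> \<alpha> \<otimes> inv \<alpha> = \<zeta> [^] k"
      by (rule ex_primitive_power[OF z U.n qc q1])
    have "\<tau> \<alpha> = (\<tau> \<alpha> \<otimes> inv \<alpha>) \<otimes> \<alpha>" 
      using m_assoc[OF Fc[OF t] ia(1) aF(3)] ia(3) Fc[OF t] by simp
    then have ta: "\<tau> \<alpha> = \<zeta> [^] k \<otimes> \<alpha>" unfolding k .
    have "\<tau> x = (\<sigma> ^^ k) x" if "x \<in> F" for x
    proof -
      obtain p where p: "set p \<subseteq> K" "x = eval p \<alpha>" using elem[OF \<open>x \<in> F\<close>] by auto
      then show ?thesis using hom_eval[OF \<tau> p(1) aF(1)] iter_eval[OF p(1)] ta by simp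
    qed
    then show ?thesis by blast
  qed
  have "\<forall>x\<in>F. \<sigma> x = x \<longleftrightarrow> x \<in> K" using fixed \<sigma>(2) by auto
  then show ?thesis
    unfolding LF.cyclic_over_def using hom bij all by (intro exI[of _ \<sigma>]) simp
qed

end

section \<open>Transfer from an algebraic closure\<close>

lemma ring_iso_inverse:
  assumes "field M" "field N" "\<phi> \<in> ring_iso M N"
  shows "\<phi> \<in> ring_hom M N" "inj_on \<phi> (carrier M)" "\<phi> ` carrier M = carrier N"
    "inv_into (carrier M) \<phi> \<in> ring_hom N M"
  using assms ring_iso_set_sym[OF field.is_ring[OF assms(1)] assms(3)]
  by (auto simp: ring_iso_def bij_betw_def)

lemma ring_hom_nonzero:
  assumes "field M" "field N" "\<phi> \<in> ring_hom M N" "x \<in> carrier M - {\<zero>\<^bsub>M\<^esub>}"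
  shows "\<phi> x \<in> carrier N - {\<zero>\<^bsub>N\<^esub>}"
proof -
  have "field_extension M N \<phi>" using assms by (simp add: field_extension_def)
  then have "inj_on \<phi> (carrier M)" "ring_hom_ring M N \<phi>" using field_extension_base by auto
  then show ?thesis
    using assms ring_hom_closed[OF assms(3)] ring_hom_zero[OF assms(3) field.is_ring field.is_ring]
      ring.ring_simprules(2)[OF field.is_ring[OF assms(1)]] inj_onD[of \<phi> "carrier M" x "\<zero>\<^bsub>M\<^esub>"]
    by auto
qed

lemma valuation_pullback:
  assumes M: "field M" and w: "valuation N w" and \<phi>: "\<phi> \<in> ring_hom M N"
  shows "valuation M (\<lambda>x. w (\<phi> x))"
proof -
  interpret N: valuation N w by (rule w)
  interpret M: field M by (rule M)
  note nz = ring_hom_nonzero[OF M N.field_axioms \<phi>]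
  show ?thesis
  proof (intro valuation.intro[OF M] valuation_axioms.intro)
    fix x y assume xy: "x \<in> carrier M - {\<zero>\<^bsub>M\<^esub>}" "y \<in> carrier M - {\<zero>\<^bsub>M\<^esub>}"
    show "w (\<phi> (x \<otimes>\<^bsub>M\<^esub> y)) = w (\<phi> x) + w (\<phi> y)"
      using N.val_mult[OF nz[OF xy(1)] nz[OF xy(2)]] ring_hom_mult[OF \<phi>, of x y] xy by simp
    assume "x \<oplus>\<^bsub>M\<^esub> y \<noteq> \<zero>\<^bsub>M\<^esub>"
    then have "\<phi> (x \<oplus>\<^bsub>M\<^esub> y) \<noteq> \<zero>\<^bsub>N\<^esub>" using nz[of "x \<oplus>\<^bsub>M\<^esub> y"] xy by simp
    then show "min (w (\<phi> x)) (w (\<phi> y)) \<le> w (\<phi> (x \<oplus>\<^bsub>M\<^esub> y))"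
      using N.val_add[OF nz[OF xy(1)] nz[OF xy(2)]] ring_hom_add[OF \<phi>, of x y] xy by simp
  qed
qed

text \<open>The condition that \<open>henselian\<close> imposes on a single extension, isolated so
  that it can be moved along isomorphisms.\<close>

definition uniquely_extends ::
  "('a, 'm) ring_scheme \<Rightarrow> ('a \<Rightarrow> int) \<Rightarrow> ('c, 'n) ring_scheme \<Rightarrow> ('a \<Rightarrow> 'c) \<Rightarrow> bool"
  where "uniquely_extends E v L h \<longleftrightarrow> (\<exists>w. extends_valuation E v L h w \<and>
    (\<forall>w'. extends_valuation E v L h w' \<longrightarrow> (\<forall>x\<in>carrier L - {\<zero>\<^bsub>L\<^esub>}. w' x = w x)))"

lemma uniquely_extends_iso:
  assumes M: "field M" and N: "field N" and \<phi>: "\<phi> \<in> ring_iso M N"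
    and g: "g \<in> carrier E \<rightarrow> carrier M" and u: "uniquely_extends E v N (\<phi> \<circ> g)"
  shows "uniquely_extends E v M g"
proof -
  note iso = ring_iso_inverse[OF M N \<phi>]
  let ?\<psi> = "inv_into (carrier M) \<phi>"
  obtain w where w: "extends_valuation E v N (\<phi> \<circ> g) w"
    and uniq: "\<And>w' x. extends_valuation E v N (\<phi> \<circ> g) w' \<Longrightarrow> x \<in> carrier N - {\<zero>\<^bsub>N\<^esub>} \<Longrightarrow> w' x = w x"
    using u by (auto simp: uniquely_extends_def)
  have "extends_valuation E v M g (\<lambda>x. w (\<phi> x))"
    using w valuation_pullback[OF M _ iso(1)] by (auto simp: extends_valuation_def)
  moreover have "w' x = w (\<phi> x)"
    if w': "extends_valuation E v M g w'" and x: "x \<in> carrier M - {\<zero>\<^bsub>M\<^esub>}" for w' x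
  proof -
    have inv: "?\<psi> (\<phi> y) = y" if "y \<in> carrier M" for y using iso(2) that by simp
    have "extends_valuation E v N (\<phi> \<circ> g) (\<lambda>y. w' (?\<psi> y))"
      using w' valuation_pullback[OF N _ iso(4)] inv g by (auto simp: extends_valuation_def Pi_iff)
    then show ?thesis using uniq[OF _ ring_hom_nonzero[OF M N iso(1) x]] inv x by auto
  qed
  ultimately show ?thesis unfolding uniquely_extends_def by blast
qed

lemma cyclic_over_iso:
  assumes M: "field M" and N: "field N" and \<phi>: "\<phi> \<in> ring_iso M N"
    and K: "K \<subseteq> carrier M" and c: "ring.cyclic_over N (\<phi> ` K)"
  shows "ring.cyclic_over M K"
proof -
  interpret M: field M by (rule M)
  interpret N: field N by (rule N)
  note iso = ring_iso_inverse[OF M N \<phi>]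
  let ?\<psi> = "inv_into (carrier M) \<phi>"
  have inv: "?\<psi> (\<phi> x) = x" if "x \<in> carrier M" for x using iso(2) that by simp
  have inv': "\<phi> (?\<psi> y) = y" "?\<psi> y \<in> carrier M" if "y \<in> carrier N" for y
    using iso(3) that by (auto simp: f_inv_into_f inv_into_into)
  have bij: "bij_betw \<phi> (carrier M) (carrier N)" "bij_betw ?\<psi> (carrier N) (carrier M)"
    using iso(2,3) bij_betw_inv_into[of \<phi> "carrier M" "carrier N"] by (auto simp: bij_betw_def)
  obtain \<sigma> where \<sigma>: "\<sigma> \<in> ring_hom N N" "bij_betw \<sigma> (carrier N) (carrier N)"
    "\<And>x. x \<in> carrier N \<Longrightarrow> \<sigma> x = x \<longleftrightarrow> x \<in> \<phi> ` K"
    "\<forall>\<tau>. \<tau> \<in> ring_hom N N \<and> (\<forall>x\<in>\<phi> ` K. \<tau> x = x) \<longrightarrow> (\<exists>k :: nat. \<forall>x\<in>carrier N. \<tau> x = (\<sigma> ^^ k) x)"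
    using c unfolding N.cyclic_over_def by metis
  have \<sigma>c: "\<sigma> y \<in> carrier N" if "y \<in> carrier N" for y using ring_hom_closed[OF \<sigma>(1) that] .
  define \<sigma>' where "\<sigma>' = ?\<psi> \<circ> (\<sigma> \<circ> \<phi>)"
  have \<phi>c: "\<phi> x \<in> carrier N" if "x \<in> carrier M" for x using ring_hom_closed[OF iso(1) that] .
  have hom: "\<sigma>' \<in> ring_hom M M"
    unfolding \<sigma>'_def by (intro ring_hom_trans[OF ring_hom_trans[OF iso(1) \<sigma>(1)] iso(4)])
  have "bij_betw \<sigma>' (carrier M) (carrier M)"
    unfolding \<sigma>'_def by (intro bij_betw_trans[OF bij_betw_trans[OF bij(1) \<sigma>(2)] bij(2)])
  moreover have "\<sigma>' x = x \<longleftrightarrow> x \<in> K" if x: "x \<in> carrier M" for x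
  proof -
    have "\<sigma>' x = x \<longleftrightarrow> \<sigma> (\<phi> x) = \<phi> x"
      unfolding \<sigma>'_def comp_apply using inv'(1)[OF \<sigma>c[OF \<phi>c[OF x]]] inv[OF x] by metis
    also have "\<dots> \<longleftrightarrow> x \<in> K" using \<sigma>(3)[OF \<phi>c[OF x]] inj_on_image_mem_iff[OF iso(2) x K] by simp
    finally show ?thesis .
  qed
  moreover have "\<exists>k :: nat. \<forall>x\<in>carrier M. \<tau> x = (\<sigma>' ^^ k) x"
    if \<tau>: "\<tau> \<in> ring_hom M M" "\<forall>x\<in>K. \<tau> x = x" for \<tau>
  proof -
    let ?\<tau> = "\<phi> \<circ> (\<tau> \<circ> ?\<psi>)"
    have "?\<tau> \<in> ring_hom N N" by (intro ring_hom_trans[OF ring_hom_trans[OF iso(4) \<tau>(1)] iso(1)])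
    moreover have "\<forall>x\<in>\<phi> ` K. ?\<tau> x = x" using \<tau>(2) inv K by auto
    ultimately have "\<exists>k :: nat. \<forall>x\<in>carrier N. ?\<tau> x = (\<sigma> ^^ k) x" using \<sigma>(4)[rule_format, of ?\<tau>] by simp
    then obtain k :: nat where k: "\<And>x. x \<in> carrier N \<Longrightarrow> ?\<tau> x = (\<sigma> ^^ k) x" by blast
    have it: "(\<sigma> ^^ j) (\<phi> x) = \<phi> ((\<sigma>' ^^ j) x) \<and> (\<sigma>' ^^ j) x \<in> carrier M" if x: "x \<in> carrier M" for x j
    proof (induction j)
      case (Suc j)
      then show ?case using inv'[OF \<sigma>c[OF \<phi>c]] by (simp add: \<sigma>'_def)
    qed (use x in simp)
    have "\<tau> x = (\<sigma>' ^^ k) x" if x: "x \<in> carrier M" for x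
    proof -
      have "\<phi> (\<tau> x) = \<phi> ((\<sigma>' ^^ k) x)" using k[OF \<phi>c[OF x]] it[OF x, of k] inv[OF x] by simp
      then show ?thesis using inj_onD[OF iso(2)] ring_hom_closed[OF \<tau>(1) x] it[OF x, of k] by blast
    qed
    then show ?thesis by blast
  qed
  ultimately show ?thesis unfolding M.cyclic_over_def using hom by blast
qed

section \<open>Cyclic Galois groups\<close>

lemma Gal_pow:
  assumes L: "field L" and K: "K \<subseteq> carrier L" and s: "\<sigma> \<in> carrier (Gal L K)" and x: "x \<in> carrier L"
  shows "(\<sigma> [^]\<^bsub>Gal L K\<^esub> (k :: nat)) x = (\<sigma> ^^ k) x"
proof -
  interpret G: group "Gal L K" by (rule Gal_group[OF L K])
  have hom: "\<sigma> \<in> ring_hom L L" using s by (simp add: Gal_def)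
  have G: "\<And>f g. f \<in> carrier (Gal L K) \<Longrightarrow> g \<in> carrier (Gal L K) \<Longrightarrow>
      f \<otimes>\<^bsub>Gal L K\<^esub> g = compose (carrier L) f g" "\<one>\<^bsub>Gal L K\<^esub> = (\<lambda>x\<in>carrier L. x)"
    by (auto simp: Gal_def BijGroup_def)
  show ?thesis
  proof (induction k)
    case 0
    then show ?case using G(2) x by simp
  next
    case (Suc k)
    have "(\<sigma> [^]\<^bsub>Gal L K\<^esub> Suc k) x = (\<sigma> \<otimes>\<^bsub>Gal L K\<^esub> \<sigma> [^]\<^bsub>Gal L K\<^esub> k) x"
      using G.nat_pow_Suc2[OF s, of k] by simp
    then show ?case using Suc G(1)[OF s G.nat_pow_closed[OF s]] x by (simp add: compose_def)
  qed
qed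

text \<open>An element fixed by a generator is fixed by all its powers, hence by the whole group,
  and the extension is Galois.\<close>

lemma cyclic_extension_imp_aut:
  assumes fe: "field_extension E L h" and c: "cyclic_extension E L h"
  obtains \<sigma> where "\<sigma> \<in> ring_hom L L" "\<And>x. x \<in> carrier L \<Longrightarrow> \<sigma> x = x \<longleftrightarrow> x \<in> h ` carrier E"
proof -
  let ?K = "h ` carrier E"
  let ?G = "Gal L ?K"
  interpret L: field L using fe by (simp add: field_extension_def)
  have K: "?K \<subseteq> carrier L" using subfieldE(3)[OF field_extension_base(3)[OF fe]] .
  interpret G: group ?G by (rule Gal_group[OF L.field_axioms K])
  have fixed: "{x \<in> carrier L. \<forall>\<sigma>\<in>carrier ?G. \<sigma> x = x} = ?K"
    using c by (simp add: cyclic_extension_def galois_extension_def)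
  obtain \<sigma> where s: "\<sigma> \<in> carrier ?G" and gen: "carrier ?G = range (\<lambda>n :: int. \<sigma> [^]\<^bsub>?G\<^esub> n)"
    using c G.cyclic_group by (auto simp: cyclic_extension_def)
  have "x \<in> ?K" if x: "x \<in> carrier L" "\<sigma> x = x" for x
  proof -
    have nat: "(\<sigma> [^]\<^bsub>?G\<^esub> n) x = x" for n :: nat
    proof -
      have "(\<sigma> ^^ n) x = x" by (induction n) (use x in auto)
      then show ?thesis using Gal_pow[OF L.field_axioms K s x(1)] by simp
    qed
    have "\<tau> x = x" if t: "\<tau> \<in> carrier ?G" for \<tau>
    proof -
      obtain n :: int where n: "\<tau> = \<sigma> [^]\<^bsub>?G\<^esub> n" using gen t by auto
      show ?thesis
      proof (cases n rule: int_cases2)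
        case (nonneg m)
        then show ?thesis using n nat[of m] by (simp add: int_pow_int)
      next
        case (nonpos m)
        have m: "\<sigma> [^]\<^bsub>?G\<^esub> m \<in> carrier ?G" using s by simp
        have "\<tau> = inv\<^bsub>?G\<^esub> (\<sigma> [^]\<^bsub>?G\<^esub> m)" using n nonpos s by (simp add: G.int_pow_neg int_pow_int)
        then have "\<tau> \<otimes>\<^bsub>?G\<^esub> (\<sigma> [^]\<^bsub>?G\<^esub> m) = \<one>\<^bsub>?G\<^esub>" using m by simp
        then have "compose (carrier L) \<tau> (\<sigma> [^]\<^bsub>?G\<^esub> m) = (\<lambda>x\<in>carrier L. x)"
          using m t by (simp add: Gal_def BijGroup_def)
        then have "\<tau> ((\<sigma> [^]\<^bsub>?G\<^esub> m) x) = x" using x(1) by (metis compose_eq restrict_apply')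
        then show ?thesis using nat[of m] by simp
      qed
    qed
    then show ?thesis using fixed x(1) by blast
  qed
  moreover have "\<sigma> \<in> ring_hom L L" "\<forall>x\<in>?K. \<sigma> x = x" using s by (auto simp: Gal_def)
  ultimately show ?thesis using that by blast
qed

lemma cyclic_over_imp_cyclic_extension:
  assumes fe: "field_extension E L h" and c: "ring.cyclic_over L (h ` carrier E)"
  shows "cyclic_extension E L h"
proof -
  let ?K = "h ` carrier E"
  let ?G = "Gal L ?K"
  interpret L: field L using fe by (simp add: field_extension_def)
  have K: "?K \<subseteq> carrier L" using subfieldE(3)[OF field_extension_base(3)[OF fe]] .
  interpret G: group ?G by (rule Gal_group[OF L.field_axioms K])
  obtain \<sigma> where \<sigma>: "\<sigma> \<in> ring_hom L L" "bij_betw \<sigma> (carrier L) (carrier L)"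
    "\<And>x. x \<in> carrier L \<Longrightarrow> \<sigma> x = x \<longleftrightarrow> x \<in> ?K"
    "\<forall>\<tau>. \<tau> \<in> ring_hom L L \<and> (\<forall>x\<in>?K. \<tau> x = x) \<longrightarrow> (\<exists>k :: nat. \<forall>x\<in>carrier L. \<tau> x = (\<sigma> ^^ k) x)"
    using c unfolding L.cyclic_over_def by metis
  \<comment> \<open>Elements of \<open>BijGroup\<close> are extensional on the carrier, so a
    generator has to be restricted.\<close>
  define \<sigma>' where "\<sigma>' = restrict \<sigma> (carrier L)"
  have s: "\<sigma>' \<in> carrier ?G"
  proof -
    have "\<sigma>' \<in> ring_hom L L" using \<sigma>(1) by (auto simp: \<sigma>'_def ring_hom_def)
    moreover have "\<sigma>' \<in> Bij (carrier L)"
      using \<sigma>(2) bij_betw_cong[of "carrier L" \<sigma>' \<sigma>] by (auto simp: Bij_def \<sigma>'_def)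
    moreover have "\<forall>x\<in>?K. \<sigma>' x = x" using \<sigma>(3) K by (auto simp: \<sigma>'_def)
    ultimately show ?thesis by (simp add: Gal_def)
  qed
  have "{x \<in> carrier L. \<forall>\<tau>\<in>carrier ?G. \<tau> x = x} = ?K"
  proof
    show "{x \<in> carrier L. \<forall>\<tau>\<in>carrier ?G. \<tau> x = x} \<subseteq> ?K"
      using \<sigma>(3) s by (auto simp: \<sigma>'_def)
    show "?K \<subseteq> {x \<in> carrier L. \<forall>\<tau>\<in>carrier ?G. \<tau> x = x}" using K by (auto simp: Gal_def)
  qed
  moreover have "carrier ?G = range (\<lambda>n :: int. \<sigma>' [^]\<^bsub>?G\<^esub> n)"
  proof
    show "range (\<lambda>n :: int. \<sigma>' [^]\<^bsub>?G\<^esub> n) \<subseteq> carrier ?G" using s by auto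
    show "carrier ?G \<subseteq> range (\<lambda>n :: int. \<sigma>' [^]\<^bsub>?G\<^esub> n)"
    proof
      fix \<tau> assume t: "\<tau> \<in> carrier ?G"
      then have t': "\<tau> \<in> ring_hom L L" "\<And>x. x \<in> ?K \<Longrightarrow> \<tau> x = x" by (auto simp: Gal_def)
      obtain k :: nat where k: "\<And>x. x \<in> carrier L \<Longrightarrow> \<tau> x = (\<sigma> ^^ k) x" using \<sigma>(4) t' by blast
      have it: "(\<sigma>' ^^ j) x = (\<sigma> ^^ j) x \<and> (\<sigma> ^^ j) x \<in> carrier L" if "x \<in> carrier L" for j x
        by (induction j) (use that ring_hom_closed[OF \<sigma>(1)] in \<open>auto simp: \<sigma>'_def\<close>)
      have "\<tau> = \<sigma>' [^]\<^bsub>?G\<^esub> k"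
      proof (rule extensionalityI[of _ "carrier L"])
        show "\<tau> \<in> extensional (carrier L)" using t by (auto simp: Gal_def Bij_def)
        show "\<sigma>' [^]\<^bsub>?G\<^esub> k \<in> extensional (carrier L)"
          using G.nat_pow_closed[OF s, of k] by (auto simp: Gal_def Bij_def)
        show "\<tau> x = (\<sigma>' [^]\<^bsub>?G\<^esub> k) x" if "x \<in> carrier L" for x
          using k[OF that] Gal_pow[OF L.field_axioms K s that, of k] it[OF that, of k] by simp
      qed
      then show "\<tau> \<in> range (\<lambda>n :: int. \<sigma>' [^]\<^bsub>?G\<^esub> n)" by (metis int_pow_int rangeI)
    qed
  qed
  then have "cyclic_group ?G" using G.cyclic_group s by blast
  ultimately show ?thesis by (simp add: cyclic_extension_def galois_extension_def)
qed

lemma (in field) dimension_restrict_carrier: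
  assumes K: "subfield K R" and F: "subfield F R" and KF: "K \<subseteq> F" and n: "dimension n K F"
  shows "ring.dimension (R\<lparr>carrier := F\<rparr>) n K F"
proof -
  let ?M = "R\<lparr>carrier := F\<rparr>"
  interpret M: field ?M using subfield_iff(2)[OF F] .
  have KM: "subfield K ?M"
    using M.subfield_iff(1)[of K] subfield_iff(2)[OF K] KF by simp
  obtain Us where Us: "set Us \<subseteq> carrier R" "Span K Us = F"
    using exists_base[OF K n] by blast
  have "set Us \<subseteq> carrier ?M" using Span_base_incl[OF K Us(1)] Us(2) by simp
  then have "M.finite_dimension K F"
    using M.Span_finite_dimension[OF KM, of Us] Us(2) Span_consistent[OF subfieldE(1)[OF F]] by simp
  then obtain m where m: "M.dimension m K F" by auto
  have "id \<in> ring_hom ?M R" using subfieldE(3)[OF F] by (auto simp: ring_hom_def)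
  then interpret h: ring_hom_ring ?M R id by (rule ring_hom_ringI2[OF M.is_ring is_ring])
  have "dimension m K F" using h.inj_hom_dimension[OF KM one_not_zero _ m] by simp
  then show ?thesis using m dimension_is_inj[OF K n] by simp
qed

section \<open>Base fields embedded into an algebraic closure\<close>

locale embedded_closure = valued_closure L K v for L :: "('c, 'n) ring_scheme" (structure) and K v +
  fixes E :: "('a, 'm) ring_scheme" and i and u :: "'a \<Rightarrow> int"
  assumes E: "field E" and u: "Z_valuation E u"
    and emb: "i \<in> ring_hom E L" "i ` carrier E = K" and val_emb: "\<And>a. a \<in> carrier E \<Longrightarrow> v (i a) = u a"
begin

interpretation E: field E by (rule E)

lemma field_val_E: "field_val E (carrier E) u"
proof -
  have "valuation E u" using u by (simp add: Z_valuation_def)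
  then show ?thesis using E.valuation_iff_field_val[OF E.carrier_is_subfield, of u] by simp
qed

interpretation U: field_val E "carrier E" u by (rule field_val_E)

interpretation i: ring_hom_ring E L i by (rule ring_hom_ringI2[OF E.is_ring is_ring emb(1)])

lemma emb_inj: "inj_on i (carrier E)"
  using field_extension_base(2)[of E L i] E emb(1) field_axioms by (simp add: field_extension_def)

lemma emb_zero_iff: "a \<in> carrier E \<Longrightarrow> i a = \<zero> \<longleftrightarrow> a = \<zero>\<^bsub>E\<^esub>"
  using inj_onD[OF emb_inj, of a "\<zero>\<^bsub>E\<^esub>"] by auto

lemma emb_ge: "a \<in> carrier E \<Longrightarrow> i a \<in> V.ge t \<longleftrightarrow> a \<in> U.ge t"
  and emb_gt: "a \<in> carrier E \<Longrightarrow> i a \<in> V.gt t \<longleftrightarrow> a \<in> U.gt t"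
  using emb(2) val_emb emb_zero_iff by (auto simp: V.ge_def U.ge_def V.gt_def U.gt_def)

lemma emb_nat: "i ([n] \<cdot>\<^bsub>E\<^esub> \<one>\<^bsub>E\<^esub>) = [(n :: nat)] \<cdot> \<one>"
  by (induction n) auto

lemma residue_algebraically_closed_iff:
  "algebraically_closed (residue_field E u) \<longleftrightarrow>
    (\<forall>p. set p \<subseteq> V.ge 0 \<and> length p \<ge> 2 \<and> hd p \<notin> V.gt 0 \<longrightarrow> (\<exists>c\<in>V.ge 0. eval p c \<in> V.gt 0))"
proof -
  have "algebraically_closed (residue_field E u) \<longleftrightarrow>
    (\<forall>p. set p \<subseteq> U.ge 0 \<and> length p \<ge> 2 \<and> hd p \<notin> U.gt 0 \<longrightarrow> (\<exists>c\<in>U.ge 0. E.eval p c \<in> U.gt 0))"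
    using U.residue_algebraically_closed by simp
  also have "\<dots> \<longleftrightarrow>
    (\<forall>p. set p \<subseteq> V.ge 0 \<and> length p \<ge> 2 \<and> hd p \<notin> V.gt 0 \<longrightarrow> (\<exists>c\<in>V.ge 0. eval p c \<in> V.gt 0))"
  proof (intro iffI allI impI)
    fix p assume *: "\<forall>p. set p \<subseteq> U.ge 0 \<and> length p \<ge> 2 \<and> hd p \<notin> U.gt 0 \<longrightarrow> (\<exists>c\<in>U.ge 0. E.eval p c \<in> U.gt 0)"
      and p: "set p \<subseteq> V.ge 0 \<and> length p \<ge> 2 \<and> hd p \<notin> V.gt 0"
    define q where "q = map (inv_into (carrier E) i) p"
    have pK: "set p \<subseteq> i ` carrier E" using p V.geD(1) emb(2) by auto
    then have q: "map i q = p" "set q \<subseteq> carrier E"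
      by (auto simp: q_def f_inv_into_f inv_into_into intro!: map_idI)
    have "set q \<subseteq> U.ge 0"
    proof
      fix x assume x: "x \<in> set q"
      then have "i x \<in> set p" using q(1) by (metis imageI set_map)
      then have "i x \<in> V.ge 0" using p by (meson subsetD)
      then show "x \<in> U.ge 0" using emb_ge[of x 0] subsetD[OF q(2) x] by simp
    qed
    moreover have "length q \<ge> 2" using p by (simp add: q_def)
    moreover have "hd q \<in> carrier E" "i (hd q) = hd p" using q \<open>length q \<ge> 2\<close> by (cases q; auto)+
    then have "hd q \<notin> U.gt 0" using p emb_gt[of "hd q" 0] by metis
    ultimately obtain c where c: "c \<in> U.ge 0" "E.eval q c \<in> U.gt 0" using * by blast
    have cE: "c \<in> carrier E" using U.geD(1)[OF c(1)] .
    have "i (E.eval q c) = eval p (i c)" using i.eval_hom'[OF cE q(2)] q(1) by simp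
    then show "\<exists>c\<in>V.ge 0. eval p c \<in> V.gt 0"
      using emb_ge[OF cE] emb_gt[OF U.gtD(1)[OF c(2)]] c by metis
  next
    fix p assume *: "\<forall>p. set p \<subseteq> V.ge 0 \<and> length p \<ge> 2 \<and> hd p \<notin> V.gt 0 \<longrightarrow> (\<exists>c\<in>V.ge 0. eval p c \<in> V.gt 0)"
      and p: "set p \<subseteq> U.ge 0 \<and> length p \<ge> 2 \<and> hd p \<notin> U.gt 0"
    have pE: "set p \<subseteq> carrier E" using p U.geD(1) by auto
    have "hd p \<in> carrier E" "hd (map i p) = i (hd p)" using p pE by (cases p; auto)+
    then have "hd (map i p) \<notin> V.gt 0" using p emb_gt[of "hd p" 0] by metis
    moreover have "set (map i p) \<subseteq> V.ge 0" using p pE emb_ge by auto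
    ultimately obtain c where c: "c \<in> V.ge 0" "eval (map i p) c \<in> V.gt 0" using * p by (metis length_map)
    obtain d where d: "d \<in> carrier E" "c = i d" using V.geD(1)[OF c(1)] emb(2) by auto
    have ev: "E.eval p d \<in> carrier E" using E.eval_in_carrier[OF pE d(1)] .
    have "i (E.eval p d) = eval (map i p) c" using i.eval_hom'[OF d(1) pE] d(2) by simp
    then show "\<exists>c\<in>U.ge 0. E.eval p c \<in> U.gt 0"
      using emb_ge[OF d(1)] emb_gt[OF ev] c d by metis
  qed
  finally show ?thesis .
qed

lemma residue_characteristic_iff:
  "characteristic (residue_field E u) = 0 \<longleftrightarrow> (\<forall>n :: nat. n > 0 \<longrightarrow> [n] \<cdot> \<one> \<notin> V.gt 0)"
proof -
  have "[n] \<cdot> \<one> \<in> V.gt 0 \<longleftrightarrow> [n] \<cdot>\<^bsub>E\<^esub> \<one>\<^bsub>E\<^esub> \<in> U.gt 0" for n :: nat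
    using emb_gt[OF U.geD(1)[OF U.nat_ge0]] emb_nat by metis
  then show ?thesis using U.residue_characteristic by simp
qed

lemma finite_subfield_extension:
  assumes "finite_subfield F"
  shows "field (L\<lparr>carrier := F\<rparr>)" "i \<in> carrier E \<rightarrow> carrier (L\<lparr>carrier := F\<rparr>)"
    "dimension n K F \<Longrightarrow> extension_of_degree n E (L\<lparr>carrier := F\<rparr>) i"
proof -
  have F: "subfield F L" "K \<subseteq> F" using assms by (auto simp: finite_subfield_def)
  show f: "field (L\<lparr>carrier := F\<rparr>)" using subfield_iff(2)[OF F(1)] .
  show "i \<in> carrier E \<rightarrow> carrier (L\<lparr>carrier := F\<rparr>)" using emb(2) F(2) by auto
  then have "i \<in> ring_hom E (L\<lparr>carrier := F\<rparr>)" using emb(1) by (auto simp: ring_hom_def)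
  then show "extension_of_degree n E (L\<lparr>carrier := F\<rparr>) i" if "dimension n K F"
    using f E dimension_restrict_carrier[OF V.F F that] emb(2)
    by (simp add: extension_of_degree_def field_extension_def)
qed

text \<open>\<open>quasi_finite\<close> and \<open>henselian\<close> speak of extensions whose
  carriers consist of lists over the type of \<open>E\<close>, so a subfield of \<open>L\<close>
  must be copied there before they can be applied.\<close>

lemma finite_subfield_list_copy:
  assumes "finite_subfield F"
  obtains M :: "'a list ring" and \<phi>
  where "\<phi> \<in> ring_iso (L\<lparr>carrier := F\<rparr>) M" "field M" "Defs.finite_extension E M (\<phi> \<circ> i)"
proof -
  obtain n where "dimension n K F" using finite_subfield_dimension[OF assms] .
  then obtain M :: "'a list ring" and \<phi>
    where "\<phi> \<in> ring_iso (L\<lparr>carrier := F\<rparr>) M" "extension_of_degree n E M (\<phi> \<circ> i)"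
    using finite_extension_universe[OF finite_subfield_extension(3)[OF assms]] by blast
  moreover from this(2) have "field M" "Defs.finite_extension E M (\<phi> \<circ> i)"
    using ring.finite_dimensionI[OF field.is_ring]
    by (auto simp: extension_of_degree_def Defs.finite_extension_def field_extension_def)
  ultimately show ?thesis using that by blast
qed

lemma extension_on_iff:
  assumes "finite_subfield F"
  shows "extension_on F w \<longleftrightarrow> extends_valuation E u (L\<lparr>carrier := F\<rparr>) i w"
proof -
  have F: "subfield F L" using assms by (auto simp: finite_subfield_def)
  have "(\<forall>c\<in>K - {\<zero>}. w c = of_int (v c)) \<longleftrightarrow> (\<forall>a\<in>carrier E - {\<zero>\<^bsub>E\<^esub>}. w (i a) = of_int (u a))"
  proof -
    have "K - {\<zero>} = i ` (carrier E - {\<zero>\<^bsub>E\<^esub>})" using emb(2) emb_zero_iff by auto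
    then show ?thesis using val_emb by simp
  qed
  then show ?thesis
    unfolding extension_on_def extends_valuation_def valuation_iff_field_val[OF F] by simp
qed

lemma uniquely_extends_iff:
  assumes "finite_subfield F"
  shows "uniquely_extends E u (L\<lparr>carrier := F\<rparr>) i \<longleftrightarrow>
    (\<exists>w. extension_on F w \<and> (\<forall>w'. extension_on F w' \<longrightarrow> (\<forall>x\<in>F - {\<zero>}. w' x = w x)))"
  unfolding uniquely_extends_def extension_on_iff[OF assms] by simp

lemma quasi_finite_closureI:
  assumes "quasi_finite E" shows "quasi_finite_closure L K v"
proof (intro quasi_finite_closure.intro[OF valued_closure_axioms] quasi_finite_closure_axioms.intro)
  fix F assume F: "finite_subfield F"
  then have sF: "subfield F L" "K \<subseteq> F" by (auto simp: finite_subfield_def)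
  let ?F = "L\<lparr>carrier := F\<rparr>"
  obtain M :: "'a list ring" and \<phi> where M: "\<phi> \<in> ring_iso ?F M" "field M" "Defs.finite_extension E M (\<phi> \<circ> i)"
    using finite_subfield_list_copy[OF F] .
  have fe: "field_extension E M (\<phi> \<circ> i)" using M(3) by (simp add: Defs.finite_extension_def)
  have "cyclic_extension E M (\<phi> \<circ> i)" using assms M(3) by (simp add: quasi_finite_def)
  then obtain \<sigma> where \<sigma>: "\<sigma> \<in> ring_hom M M"
    "\<And>x. x \<in> carrier M \<Longrightarrow> \<sigma> x = x \<longleftrightarrow> x \<in> (\<phi> \<circ> i) ` carrier E"
    using cyclic_extension_imp_aut[OF fe] by metis
  have K: "(\<phi> \<circ> i) ` carrier E = \<phi> ` K" using emb(2) by auto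
  note iso = ring_iso_inverse[OF finite_subfield_extension(1)[OF F] M(2,1)]
  let ?\<psi> = "inv_into (carrier ?F) \<phi>"
  let ?\<sigma> = "?\<psi> \<circ> (\<sigma> \<circ> \<phi>)"
  have "?\<sigma> \<in> ring_hom ?F ?F"
    by (intro ring_hom_trans[OF ring_hom_trans[OF iso(1) \<sigma>(1)] iso(4)])
  moreover have "?\<sigma> x = x \<longleftrightarrow> x \<in> K" if x: "x \<in> F" for x
  proof -
    have c: "\<phi> x \<in> carrier M" "\<sigma> (\<phi> x) \<in> carrier M"
      using ring_hom_closed[OF iso(1), of x] ring_hom_closed[OF \<sigma>(1)] x by auto
    have "\<phi> (?\<psi> (\<sigma> (\<phi> x))) = \<sigma> (\<phi> x)" using f_inv_into_f[of "\<sigma> (\<phi> x)" \<phi> "carrier ?F"] c iso(3) by simp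
    moreover have "?\<psi> (\<phi> x) = x" using inv_into_f_f[OF iso(2), of x] x by simp
    ultimately have "?\<sigma> x = x \<longleftrightarrow> \<sigma> (\<phi> x) = \<phi> x" unfolding comp_apply by metis
    also have "\<dots> \<longleftrightarrow> x \<in> K"
      using \<sigma>(2)[OF c(1)] inj_on_image_mem_iff[OF iso(2), of x K] x sF(2) unfolding K by simp
    finally show ?thesis .
  qed
  ultimately show "\<exists>\<sigma>. field_aut L K F \<sigma>"
    using field_axioms V.F sF unfolding field_aut_def field_aut_axioms_def by blast
qed

lemma henselian_closureI:
  assumes h: "henselian E u" and "algebraically_closed (residue_field E u)"
    and "characteristic (residue_field E u) = 0"
  shows "henselian_closure L K v"
proof (intro henselian_closure.intro[OF valued_closure_axioms] henselian_closure_axioms.intro)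
  fix F assume F: "finite_subfield F"
  obtain M :: "'a list ring" and \<phi>
    where M: "\<phi> \<in> ring_iso (L\<lparr>carrier := F\<rparr>) M" "field M" "Defs.finite_extension E M (\<phi> \<circ> i)"
    using finite_subfield_list_copy[OF F] .
  have "uniquely_extends E u M (\<phi> \<circ> i)"
    using h M(3) by (simp add: henselian_def uniquely_extends_def)
  then have "uniquely_extends E u (L\<lparr>carrier := F\<rparr>) i"
    using uniquely_extends_iso[OF finite_subfield_extension(1)[OF F] M(2,1) finite_subfield_extension(2)[OF F]]
    by blast
  then show "\<exists>w. extension_on F w \<and> (\<forall>w'. extension_on F w' \<longrightarrow> (\<forall>x\<in>F - {\<zero>}. w' x = w x))"
    using uniquely_extends_iff[OF F] by blast
qed (use assms residue_algebraically_closed_iff residue_characteristic_iff in blast)+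

end

text \<open>The closure is formed over the given extension \<open>M\<close>, not over
  \<open>E\<close>. In this way \<open>M\<close> itself appears as a finite subfield, and no
  embedding has to be extended.\<close>

lemma ex_embedded_closure:
  fixes E :: "('a, 'm) ring_scheme" and M :: "('c, 'n) ring_scheme"
  assumes u: "Z_valuation E u" and M: "finite_extension E M g"
  obtains L :: "(('c list \<times> nat) multiset \<Rightarrow> 'c) ring" and j K v
  where "embedded_closure L K v E (j \<circ> g) u" "j \<in> ring_iso M (L\<lparr>carrier := j ` carrier M\<rparr>)"
    "valued_closure.finite_subfield L K (j ` carrier M)"
proof -
  have fe: "field_extension E M g" and fd: "ring.finite_dimension M (g ` carrier E) (carrier M)"
    using M by (auto simp: finite_extension_def)
  interpret E: Z_valuation E u by (rule u)
  interpret M: field M using fe by (simp add: field_extension_def)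
  note base = field_extension_base[OF fe]
  define L where "L = M.alg_closure"
  define j where "j = (M.indexed_const :: 'c \<Rightarrow> ('c list \<times> nat) multiset \<Rightarrow> 'c)"
  interpret L: algebraic_closure L "j ` carrier M"
    using M.alg_closureE(1) by (simp add: L_def j_def)
  have jh: "j \<in> ring_hom M L" using M.alg_closureE(2) by (simp add: L_def j_def)
  have fj: "field_extension M L j" using jh M.field_axioms L.field_axioms by (simp add: field_extension_def)
  note jbase = field_extension_base[OF fj]
  interpret j: ring_hom_ring M L j by (rule jbase(1))
  let ?i = "j \<circ> g"
  define K where "K = ?i ` carrier E"
  have gh: "g \<in> ring_hom E M" using fe by (simp add: field_extension_def)
  have ih: "?i \<in> ring_hom E L" using ring_hom_trans[OF gh jh] .
  have fi: "field_extension E L ?i" using ih E.field_axioms L.field_axioms by (simp add: field_extension_def)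
  note ibase = field_extension_base[OF fi]
  have KF: "K \<subseteq> j ` carrier M" using ring_hom_closed[OF gh] by (auto simp: K_def)
  have sK: "subfield K L" using ibase(3) by (simp add: K_def)
  obtain n where n: "M.dimension n (g ` carrier E) (carrier M)" using fd by auto
  have "L.dimension n (j ` g ` carrier E) (j ` carrier M)"
    using j.inj_hom_dimension[OF base(3) L.one_not_zero jbase(2) n] .
  then have fin: "L.finite_dimension K (j ` carrier M)"
    using L.finite_dimensionI by (simp add: K_def image_comp)
  define v where "v x = u (inv_into (carrier E) ?i x)" for x
  have vi: "v (?i a) = u a" if "a \<in> carrier E" for a
    using inv_into_f_f[OF ibase(2) that] by (simp add: v_def)
  have nz: "?i a \<noteq> \<zero>\<^bsub>L\<^esub> \<longleftrightarrow> a \<noteq> \<zero>\<^bsub>E\<^esub>" if "a \<in> carrier E" for a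
    using ring_hom_nonzero[OF E.field_axioms L.field_axioms ih, of a] that
      ring_hom_zero[OF ih E.is_ring L.is_ring] by auto
  have KE: "K - {\<zero>\<^bsub>L\<^esub>} = ?i ` (carrier E - {\<zero>\<^bsub>E\<^esub>})" using nz by (auto simp: K_def)
  have V: "field_val L K v"
  proof (intro field_val.intro[OF L.field_axioms] field_val_axioms.intro sK)
    fix x y assume "x \<in> K - {\<zero>\<^bsub>L\<^esub>}" "y \<in> K - {\<zero>\<^bsub>L\<^esub>}"
    then obtain a b where ab: "a \<in> carrier E - {\<zero>\<^bsub>E\<^esub>}" "x = ?i a" "b \<in> carrier E - {\<zero>\<^bsub>E\<^esub>}" "y = ?i b"
      unfolding KE by blast
    have m: "x \<otimes>\<^bsub>L\<^esub> y = ?i (a \<otimes>\<^bsub>E\<^esub> b)" "x \<oplus>\<^bsub>L\<^esub> y = ?i (a \<oplus>\<^bsub>E\<^esub> b)"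
      using ring_hom_mult[OF ih, of a b] ring_hom_add[OF ih, of a b] ab by auto
    have vxy: "v x = u a" "v y = u b" using vi ab by auto
    have "v (x \<otimes>\<^bsub>L\<^esub> y) = u (a \<otimes>\<^bsub>E\<^esub> b)" unfolding m(1) by (rule vi) (use ab in auto)
    then show "v (x \<otimes>\<^bsub>L\<^esub> y) = v x + v y" unfolding vxy using E.val_mult[OF ab(1,3)] by simp
    have s: "a \<oplus>\<^bsub>E\<^esub> b \<in> carrier E" using ab by auto
    show "min (v x) (v y) \<le> v (x \<oplus>\<^bsub>L\<^esub> y)" if xy: "x \<oplus>\<^bsub>L\<^esub> y \<noteq> \<zero>\<^bsub>L\<^esub>"
    proof -
      have "a \<oplus>\<^bsub>E\<^esub> b \<noteq> \<zero>\<^bsub>E\<^esub>" using xy nz[OF s] unfolding m(2) by blast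
      moreover have "v (x \<oplus>\<^bsub>L\<^esub> y) = u (a \<oplus>\<^bsub>E\<^esub> b)" unfolding m(2) by (rule vi[OF s])
      ultimately show ?thesis unfolding vxy using E.val_add[OF ab(1,3)] by simp
    qed
  qed
  \<comment> \<open>The closure is algebraic over the image of \<open>M\<close> by construction;
    algebraicity over \<open>K\<close> follows because that image is finite over
    \<open>K\<close>.\<close>
  have alg: "(L.algebraic over K) x" if x: "x \<in> carrier L" for x
  proof -
    let ?F = "j ` carrier M"
    have F: "subfield ?F L" by (rule jbase(3))
    have a: "(L.algebraic over ?F) x" using L.algebraic_extension[OF x] .
    have "L.finite_dimension ?F (L.simple_extension ?F x)"
      using L.finite_dimension_simple_extension[OF F x] a by simp
    then have "L.finite_dimension K (L.simple_extension ?F x)"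
      using L.telescopic_base_dim(1)[OF sK F fin] by blast
    moreover have "subring (L.simple_extension ?F x) L" "x \<in> L.simple_extension ?F x"
      using L.simple_extension_is_subring[OF subfieldE(1)[OF F] x] L.simple_extension_mem[OF subfieldE(1)[OF F] x]
      by auto
    ultimately show ?thesis using L.finite_dimension_imp_algebraic[OF sK] by blast
  qed
  have "v ` (K - {\<zero>\<^bsub>L\<^esub>}) = u ` (carrier E - {\<zero>\<^bsub>E\<^esub>})"
    unfolding KE image_image using vi by (intro image_cong) auto
  then have vg: "v ` (K - {\<zero>\<^bsub>L\<^esub>}) = UNIV" using E.value_group by simp
  have vc: "valued_closure L K v"
    using L.algebraically_closed_axioms alg V vg by (intro valued_closure.intro valued_closure_axioms.intro) auto
  have ec: "embedded_closure L K v E ?i u"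
    using vc E.field_axioms u ih vi
    by (intro embedded_closure.intro embedded_closure_axioms.intro) (auto simp: K_def)
  have "j \<in> ring_iso M (L\<lparr>carrier := j ` carrier M\<rparr>)"
    using jh jbase(2) by (auto simp: ring_iso_def ring_hom_def bij_betw_def)
  moreover have "valued_closure.finite_subfield L K (j ` carrier M)"
    unfolding valued_closure.finite_subfield_def[OF vc] using jbase(3) KF fin by blast
  ultimately show ?thesis using that[OF ec] by blast
qed

theorem theorem9p2:
  fixes E :: "('a, 'm) ring_scheme" and v :: "'a \<Rightarrow> int"
  assumes "field E" and "Z_valuation E v"
  shows "quasi_finite E \<longleftrightarrow>
    henselian E v \<and> algebraically_closed (residue_field E v) \<and>
    characteristic (residue_field E v) = 0"
proof -
  interpret E: field E by (rule assms)
  \<comment> \<open>The trivial extension supplies a closure of \<open>E\<close> itself, used for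
    the claims on the residue field and for the extensions of prescribed degree.\<close>
  have "finite_extension E E id"
    using E.dimension_one[OF E.carrier_is_subfield] E.finite_dimensionI E.field_axioms
    by (auto simp: finite_extension_def field_extension_def ring_hom_def)
  then obtain L :: "(('a list \<times> nat) multiset \<Rightarrow> 'a) ring" and j K u
    where ec: "embedded_closure L K u E (j \<circ> id) v"
    using ex_embedded_closure[OF assms(2)] by metis
  interpret C: embedded_closure L K u E "j \<circ> id" v by (rule ec)
  show ?thesis
  proof
    assume qf: "quasi_finite E"
    interpret Q: quasi_finite_closure L K u by (rule C.quasi_finite_closureI[OF qf])
    \<comment> \<open>Each \<open>M\<close> is treated inside a closure of its own, in which its
      image is a finite subfield.\<close>
    have "uniquely_extends E v M h" if M: "finite_extension E M h" for M :: "'a list ring" and h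
    proof -
      obtain N :: "(('a list list \<times> nat) multiset \<Rightarrow> 'a list) ring" and j K u
        where N: "embedded_closure N K u E (j \<circ> h) v" "j \<in> ring_iso M (N\<lparr>carrier := j ` carrier M\<rparr>)"
          "valued_closure.finite_subfield N K (j ` carrier M)"
        using ex_embedded_closure[OF assms(2) M] by metis
      interpret N: embedded_closure N K u E "j \<circ> h" v by (rule N(1))
      interpret Q: quasi_finite_closure N K u by (rule N.quasi_finite_closureI[OF qf])
      have f: "field M" "h \<in> carrier E \<rightarrow> carrier M"
        using M by (auto simp: finite_extension_def field_extension_def ring_hom_def)
      show ?thesis
        using uniquely_extends_iso[OF f(1) N.finite_subfield_extension(1)[OF N(3)] N(2) f(2)]
          N.uniquely_extends_iff[OF N(3)] Q.unique_extension[OF N(3)] by blast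
    qed
    then have "henselian E v"
      using assms(2) by (simp add: henselian_def Z_valuation_def uniquely_extends_def)
    then show "henselian E v \<and> algebraically_closed (residue_field E v) \<and>
        characteristic (residue_field E v) = 0"
      using C.residue_algebraically_closed_iff C.residue_characteristic_iff Q.residue_root Q.nat_residue
      by blast
  next
    assume h: "henselian E v \<and> algebraically_closed (residue_field E v) \<and>
        characteristic (residue_field E v) = 0"
    \<comment> \<open>Adjoining an \<open>n\<close>-th root of a uniformizer gives degree exactly
      \<open>n\<close>.\<close>
    have "\<exists>(M :: 'a list ring) h. extension_of_degree n E M h" if n: "n > 0" for n
    proof -
      obtain \<pi> where pi: "\<pi> \<in> K - {\<zero>\<^bsub>L\<^esub>}" "u \<pi> = 1" by (rule C.ex_uniformizer)
      then obtain \<alpha> where al: "\<alpha> \<in> carrier L" "\<alpha> [^]\<^bsub>L\<^esub> n = \<pi>"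
        using C.ex_nth_root[OF n] C.V.F_carrier by blast
      interpret U: uniformizer_root L K u \<pi> \<alpha> n by (rule C.uniformizer_rootI[OF pi n al])
      show ?thesis
        using finite_extension_universe[OF C.finite_subfield_extension(3)[OF U.F_finite(1,4)]] by metis
    qed
    moreover have "cyclic_extension E M h" if M: "finite_extension E M h" for M :: "'a list ring" and h
    proof -
      obtain N :: "(('a list list \<times> nat) multiset \<Rightarrow> 'a list) ring" and j K u
        where N: "embedded_closure N K u E (j \<circ> h) v" "j \<in> ring_iso M (N\<lparr>carrier := j ` carrier M\<rparr>)"
          "valued_closure.finite_subfield N K (j ` carrier M)"
        using ex_embedded_closure[OF assms(2) M] by metis
      interpret N: embedded_closure N K u E "j \<circ> h" v by (rule N(1))
      interpret H: henselian_closure N K u by (rule N.henselian_closureI) (use h in blast)+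
      have f: "field M" "h ` carrier E \<subseteq> carrier M" and fe: "field_extension E M h"
        using M by (auto simp: finite_extension_def field_extension_def ring_hom_def)
      have "j ` h ` carrier E = K" using N.emb(2) by (simp add: image_comp)
      then have "ring.cyclic_over M (h ` carrier E)"
        using cyclic_over_iso[OF f(1) N.finite_subfield_extension(1)[OF N(3)] N(2) f(2)]
          H.cyclic_finite_subfield[OF N(3)] by simp
      then show ?thesis by (rule cyclic_over_imp_cyclic_extension[OF fe])
    qed
    ultimately show "quasi_finite E" using assms(1) by (simp add: quasi_finite_def)
  qed
qed

end
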